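(* Let $d\ge3$ be an integer, $m\in(1-1/d,1)$ and $p=1/(2m-1)$ (so that $p\in(1,d/(d-2))$). Let $\gamma^\ast\in(0,d-(d-2)p\,]$ be such that $\mathsf C_\gamma=\mathsf C^\star_\gamma$ for all $\gamma\in(0,\gamma^\ast)$, and let $\gamma\in(0,\gamma^\ast)$. If $v$ is a solution to $$v_t+|x|^\gamma\,\nabla\cdot\Big[\,v\,\nabla\left(v^{m-1}-|x|^{2-\gamma}\right)\Big]=0\,,\quad(t,x)\in\mathbb R^+\times\mathbb R^d\,,\qquad v(t=0,\cdot)=u_0\,,$$ with nonnegative, nontrivial initial datum $u_0\in\mathrm L^1(\mathbb R^d,|x|^{-\gamma}\,dx)$ such that $\int_{\mathbb R^d}u_0^m\,|x|^{-\gamma}\,dx+\int_{\mathbb R^d}u_0\,|x|^{2-2\gamma}\,dx$ is finite, then $$\mathcal F[v(t,\cdot)]\le\mathcal F[u_0]\;e^{-(2-\gamma)^2\,t}\quad\forall\,t>0\,.$$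
   Context: $\mathcal D(\mathbb R^d)$ is the space of smooth compactly supported functions on $\mathbb R^d$ and $\mathcal D^\star(\mathbb R^d)$ its subset of radial functions. With $\|w\|_{q,\gamma}:=\left(\int_{\mathbb R^d}|w|^q\,|x|^{-\gamma}\,dx\right)^{1/q}$, $\|w\|_q:=\|w\|_{q,0}$, and for $\gamma\in(0,d-(d-2)p)$, $$\vartheta:=\frac{(d-\gamma)\,(p-1)}{p\,\big(d+2-2\,\gamma-p\,(d-2)\big)}\,,\qquad \mathcal Q_\gamma[w]:=\frac{\|\nabla w\|_2^{\vartheta}\,\|w\|_{p+1,\gamma}^{1-\vartheta}}{\|w\|_{2p,\gamma}}\,,$$ the constants $\mathsf C_\gamma,\mathsf C_\gamma^\star$ are defined by $(\mathsf C_\gamma)^{-1}:=\inf_{w\in\mathcal D(\mathbb R^d)\setminus\{0\}}\mathcal Q_\gamma[w]$ and $(\mathsf C_\gamma^\star)^{-1}:=\inf_{w\in\mathcal D^\star(\mathbb R^d)\setminus\{0\}}\mathcal Q_\gamma[w]$. (A $\gamma^\ast>0$ as in the claim exists for every $p\in(1,d/(d-2))$.) Let $M:=\int_{\mathbb R^d}u_0\,|x|^{-\gamma}\,dx$; the mass $\int_{\mathbb R^d}v(t,x)\,|x|^{-\gamma}\,dx$ of the solution is independent of $t$. The stationary solution is $\mathfrak B(x):=\left(C+|x|^{2-\gamma}\right)^{\frac1{m-1}}$, where $C>0$ is uniquely determined by $\int_{\mathbb R^d}\mathfrak B\,|x|^{-\gamma}\,dx=M$. The free energy (relative entropy) is $$\mathcal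 F[v]:=\frac1{m-1}\int_{\mathbb R^d}\left(v^m-\mathfrak B^m-m\,\mathfrak B^{m-1}\,(v-\mathfrak B)\right)|x|^{-\gamma}\,dx\,.$$ Solutions are the nonnegative solutions of the Cauchy problem, which satisfy $\frac{d}{dt}\mathcal F[v(t,\cdot)]=-\mathcal I[v(t,\cdot)]$ with $\mathcal I[v]:=\frac m{1-m}\int_{\mathbb R^d}v\left|\nabla v^{m-1}-(2-\gamma)\,\frac{x}{|x|^{\gamma}}\right|^2dx$. *)

theory Defs
  imports "HOL-Analysis.Analysis"
begin

text \<open>Throughout, the space dimension \<open>d\<close> is \<open>DIM('a)\<close> for \<open>'a :: euclidean_space\<close>.\<close>

definition grad :: "('a::euclidean_space \<Rightarrow> real) \<Rightarrow> 'a \<Rightarrow> 'a" where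
  "grad f x = (\<Sum>b\<in>Basis. frechet_derivative f (at x) b *\<^sub>R b)"

primrec iter_partial :: "'a::euclidean_space list \<Rightarrow> ('a \<Rightarrow> real) \<Rightarrow> 'a \<Rightarrow> real" where
  "iter_partial [] f = f"
| "iter_partial (b # bs) f = (\<lambda>x. frechet_derivative (iter_partial bs f) (at x) b)"

text \<open>Differentiability of every iterated partial derivative makes all of them continuous,
  so this is the class of infinitely differentiable functions.\<close>

definition smooth :: "('a::euclidean_space \<Rightarrow> real) \<Rightarrow> bool" where
  "smooth f \<longleftrightarrow> (\<forall>bs. set bs \<subseteq> Basis \<longrightarrow> (\<forall>x. iter_partial bs f differentiable (at x)))"

definition test_functions :: "('a::euclidean_space \<Rightarrow> real) set" where
  "test_functions = {w. smooth w \<and> compact (closure {x. w x \<noteq> 0})}"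

definition radial :: "('a::euclidean_space \<Rightarrow> real) \<Rightarrow> bool" where
  "radial w \<longleftrightarrow> (\<exists>g. \<forall>x. w x = g (norm x))"

definition radial_test_functions :: "('a::euclidean_space \<Rightarrow> real) set" where
  "radial_test_functions = {w \<in> test_functions. radial w}"

text \<open>In Isabelle \<open>0 powr a = 0\<close>, so the weight \<open>norm x powr (-\<gamma>)\<close> vanishes at the origin,
  also for \<open>\<gamma> = 0\<close>; this concerns a null set only.\<close>

definition wnorm :: "real \<Rightarrow> real \<Rightarrow> ('a::euclidean_space \<Rightarrow> 'b::real_normed_vector) \<Rightarrow> real" where
  "wnorm q \<gamma> w = (LINT x|lborel. norm (w x) powr q * norm x powr (-\<gamma>)) powr (1 / q)"

definition ckn_exponent :: "real \<Rightarrow> real \<Rightarrow> real \<Rightarrow> real" where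
  "ckn_exponent d p \<gamma> = (d - \<gamma>) * (p - 1) / (p * (d + 2 - 2 * \<gamma> - p * (d - 2)))"

definition ckn_quotient :: "real \<Rightarrow> real \<Rightarrow> ('a::euclidean_space \<Rightarrow> real) \<Rightarrow> real" where
  "ckn_quotient p \<gamma> w =
     (let \<theta> = ckn_exponent (real DIM('a)) p \<gamma> in
      wnorm 2 0 (grad w) powr \<theta> * wnorm (p + 1) \<gamma> w powr (1 - \<theta>) / wnorm (2 * p) \<gamma> w)"

definition ckn_const :: "'a::euclidean_space itself \<Rightarrow> real \<Rightarrow> real \<Rightarrow> real" where
  "ckn_const _ p \<gamma> =
     inverse (INF w \<in> (test_functions :: ('a \<Rightarrow> real) set) - {\<lambda>x. 0}. ckn_quotient p \<gamma> w)"

definition ckn_const_radial :: "'a::euclidean_space itself \<Rightarrow> real \<Rightarrow> real \<Rightarrow> real" where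
  "ckn_const_radial _ p \<gamma> =
     inverse (INF w \<in> (radial_test_functions :: ('a \<Rightarrow> real) set) - {\<lambda>x. 0}. ckn_quotient p \<gamma> w)"

definition wmass :: "real \<Rightarrow> ('a::euclidean_space \<Rightarrow> real) \<Rightarrow> real" where
  "wmass \<gamma> u = (LINT x|lborel. u x * norm x powr (-\<gamma>))"

definition barenblatt :: "real \<Rightarrow> real \<Rightarrow> real \<Rightarrow> 'a::euclidean_space \<Rightarrow> real" where
  "barenblatt m \<gamma> C x = (C + norm x powr (2 - \<gamma>)) powr (1 / (m - 1))"

definition entropy_density ::
  "real \<Rightarrow> real \<Rightarrow> real \<Rightarrow> ('a::euclidean_space \<Rightarrow> real) \<Rightarrow> 'a \<Rightarrow> real" where
  "entropy_density m \<gamma> C u x =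
     (u x powr m - barenblatt m \<gamma> C x powr m
       - m * barenblatt m \<gamma> C x powr (m - 1) * (u x - barenblatt m \<gamma> C x)) * norm x powr (-\<gamma>)"

definition free_energy :: "real \<Rightarrow> real \<Rightarrow> real \<Rightarrow> ('a::euclidean_space \<Rightarrow> real) \<Rightarrow> real" where
  "free_energy m \<gamma> C u = 1 / (m - 1) * (LINT x|lborel. entropy_density m \<gamma> C u x)"

definition locally_integrable :: "('a::euclidean_space \<Rightarrow> 'b::euclidean_space) \<Rightarrow> bool" where
  "locally_integrable f \<longleftrightarrow> (\<forall>K. compact K \<longrightarrow> set_integrable lborel K f)"

definition has_weak_gradient ::
  "('a::euclidean_space \<Rightarrow> real) \<Rightarrow> ('a \<Rightarrow> 'a) \<Rightarrow> bool" where
  "has_weak_gradient f g \<longleftrightarrow> locally_integrable f \<and> locally_integrable g \<and>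
     (\<forall>\<phi>\<in>test_functions.
        (LINT x|lborel. f x *\<^sub>R grad \<phi> x) = - (LINT x|lborel. \<phi> x *\<^sub>R g x))"

text \<open>The field \<open>G\<close> is the gradient of \<open>u\<^sup>m\<^sup>-\<^sup>1\<close>. As \<open>m < 1\<close>, the pressure \<open>u\<^sup>m\<^sup>-\<^sup>1\<close> is infinite where
  \<open>u\<close> vanishes (whereas \<open>0 powr (m - 1) = 0\<close>), so the gradient is taken, as usual, through the
  truncations \<open>min (u\<^sup>m\<^sup>-\<^sup>1) (\<epsilon>\<^sup>m\<^sup>-\<^sup>1) = (max u \<epsilon>)\<^sup>m\<^sup>-\<^sup>1\<close>. It is determined almost everywhere on
  \<open>{u > 0}\<close>, and it is only used multiplied by \<open>u\<close>. If \<open>u > 0\<close> and \<open>u\<^sup>m\<^sup>-\<^sup>1\<close> has a weak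
  gradient, \<open>G\<close> is that gradient.\<close>

definition is_pressure_gradient ::
  "real \<Rightarrow> ('a::euclidean_space \<Rightarrow> real) \<Rightarrow> ('a \<Rightarrow> 'a) \<Rightarrow> bool" where
  "is_pressure_gradient m u G \<longleftrightarrow>
     (\<forall>\<epsilon>>0. has_weak_gradient (\<lambda>x. max (u x) \<epsilon> powr (m - 1))
                              (\<lambda>x. indicator {y. u y > \<epsilon>} x *\<^sub>R G x))"

text \<open>With \<open>G\<close> the gradient of \<open>u\<^sup>m\<^sup>-\<^sup>1\<close>, this is the gradient of \<open>u\<^sup>m\<^sup>-\<^sup>1 - |x|\<^sup>2\<^sup>-\<^sup>\<gamma>\<close>.\<close>

definition drift :: "real \<Rightarrow> ('a::euclidean_space \<Rightarrow> 'a) \<Rightarrow> 'a \<Rightarrow> 'a" where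
  "drift \<gamma> G x = G x - ((2 - \<gamma>) * norm x powr (-\<gamma>)) *\<^sub>R x"

definition entropy_production ::
  "real \<Rightarrow> real \<Rightarrow> ('a::euclidean_space \<Rightarrow> real) \<Rightarrow> ('a \<Rightarrow> 'a) \<Rightarrow> ennreal" where
  "entropy_production m \<gamma> u G =
     ennreal (m / (1 - m)) * (\<integral>\<^sup>+x. ennreal (u x * (norm (drift \<gamma> G x))\<^sup>2) \<partial>lborel)"

text \<open>Distributional form on \<open>(0,\<infinity>) \<times> \<real>\<^sup>d\<close> of
  \<open>|x|\<^sup>-\<^sup>\<gamma> v\<^sub>t + div (v \<nabla>(v\<^sup>m\<^sup>-\<^sup>1 - |x|\<^sup>2\<^sup>-\<^sup>\<gamma>)) = 0\<close>, where \<open>G t\<close> stands for the gradient of \<open>v(t)\<^sup>m\<^sup>-\<^sup>1\<close>.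
  For a test function \<open>\<phi>\<close> of \<open>z = (t, x)\<close>, \<open>grad \<phi> z\<close> is the pair of the time
  derivative and the spatial gradient of \<open>\<phi>\<close>.\<close>

definition solves_equation ::
  "real \<Rightarrow> (real \<Rightarrow> 'a::euclidean_space \<Rightarrow> real) \<Rightarrow> (real \<Rightarrow> 'a \<Rightarrow> 'a) \<Rightarrow> bool" where
  "solves_equation \<gamma> v G \<longleftrightarrow>
     (let density = (\<lambda>z. v (fst z) (snd z) * norm (snd z) powr (-\<gamma>));
          flux = (\<lambda>z. v (fst z) (snd z) *\<^sub>R drift \<gamma> (G (fst z)) (snd z))
      in (\<forall>K. compact K \<and> K \<subseteq> {0<..} \<times> UNIV \<longrightarrow>
            set_integrable lborel K density \<and> set_integrable lborel K flux) \<and>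
         (\<forall>\<phi>\<in>test_functions. closure {z. \<phi> z \<noteq> 0} \<subseteq> {0<..} \<times> UNIV \<longrightarrow>
            (LINT z|lborel. density z * fst (grad \<phi> z) + flux z \<bullet> snd (grad \<phi> z)) = 0))"

text \<open>Nonnegative solutions of the Cauchy problem, continuous in time with values in
  \<open>L\<^sup>1(|x|\<^sup>-\<^sup>\<gamma> dx)\<close>, with their two standing properties: conservation of mass, and the
  entropy identity \<open>d/dt F[v(t)] = - I[v(t)]\<close>. The latter is written in integrated form, which
  includes the initial time and allows \<open>I[v(t)]\<close> to be infinite for \<open>t\<close> in a null set; for \<open>C\<close>
  positive the free energy is nonnegative, so that \<open>ennreal\<close> loses nothing.\<close>

definition fde_solution ::
  "real \<Rightarrow> real \<Rightarrow> real \<Rightarrow> ('a::euclidean_space \<Rightarrow> real) \<Rightarrow> (real \<Rightarrow> 'a \<Rightarrow> real) \<Rightarrow> bool" where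
  "fde_solution m \<gamma> C u0 v \<longleftrightarrow>
     (\<forall>t\<ge>0. \<forall>x. v t x \<ge> 0) \<and>
     v 0 = u0 \<and>
     (\<forall>t\<ge>0. integrable lborel (\<lambda>x. v t x * norm x powr (-\<gamma>))) \<and>
     (\<forall>t\<ge>0. ((\<lambda>s. LINT x|lborel. \<bar>v s x - v t x\<bar> * norm x powr (-\<gamma>)) \<longlongrightarrow> 0)
               (at t within {0..})) \<and>
     (\<forall>t\<ge>0. wmass \<gamma> (v t) = wmass \<gamma> u0) \<and>
     (\<forall>t>0. integrable lborel (entropy_density m \<gamma> C (v t))) \<and>
     (\<exists>G. (AE t in lborel. t > 0 \<longrightarrow> is_pressure_gradient m (v t) (G t)) \<and>
          solves_equation \<gamma> v G \<and>
          (\<forall>s t. 0 \<le> s \<and> s \<le> t \<longrightarrow>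
             ennreal (free_energy m \<gamma> C (v t))
               + (\<integral>\<^sup>+\<tau>\<in>{s..t}. entropy_production m \<gamma> (v \<tau>) (G \<tau>) \<partial>lborel)
             = ennreal (free_energy m \<gamma> C (v s))))"

end

theory Submission
  imports Defs
begin

text \<open>
  Everything rests on \<open>(2 - \<gamma>)\<^sup>2 F[u] \<le> I[u]\<close>. With \<open>w = u\<^bsup>m-1/2\<^esup>\<close>, expand the square in \<open>I[u]\<close> and
  integrate the cross term by parts: the second moments cancel, and the inequality becomes a lower bound
  for a linear combination of \<open>\<parallel>\<nabla>w\<parallel>\<^sub>2\<^sup>2\<close> and \<open>\<integral>|w|\<^bsup>p+1\<^esup>|x|\<^bsup>-\<gamma>\<^esup>\<close> at fixed \<open>\<integral>|w|\<^bsup>2p\<^esup>|x|\<^bsup>-\<gamma>\<^esup>\<close>, with equality for the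
  Barenblatt profile \<open>B\<close>. This is the interpolation inequality with its sharp constant, written without
  scale invariance. As the two constants agree, it is enough to know it for radial test functions.
  There, transport \<open>|w|\<^bsup>2p\<^esup>\<close> onto \<open>B\<close> by the monotone map \<open>T\<close> of the half line: in the variable
  \<open>r\<^bsup>1-\<gamma>/2\<^esup>\<close> the weights are those of the dimension \<open>n = 2(d - \<gamma>)/(2 - \<gamma>)\<close>, and since \<open>n(1 - m) < 1\<close> the
  inequality of arithmetic and geometric means bounds the power \<open>1 - m\<close> of the Jacobian of \<open>T\<close> by a
  divergence; an integration by parts and Young's inequality conclude. The result is carried from test
  functions to densities \<open>u\<close> by truncating, cutting off and mollifying the pressure \<open>u\<^bsup>m-1\<^esup>\<close>. Finally
  \<open>F(t) (1 + (2 - \<gamma>)\<^sup>2 (t - s)) \<le> F(s)\<close> for \<open>s \<le> t\<close>, and \<open>n\<close> steps of length \<open>t/n\<close> give the exponential.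
\<close>

subsection \<open>Smooth functions\<close>

text \<open>The hypothesis equates two infima only, so the radial inequality has to come with its
  exact constant and in product form. Transport gives it for a whole family in \<mu> > 0, a
  parameter that stands for dilations; a suitable \<mu> yields the product, the common infimum
  carries it to all test functions, and the inequality of arithmetic and geometric means turns it
  back into a sum. The optimal function is no test function; what is used is a lower bound for the
  radial infimum whose constants are integrals of the Barenblatt profile. The bound \<gamma> < d -
  (d - 2) p is \<nu> = n (1 - m) < 1, which leaves a third weight 1 - \<nu> in that inequality of
  means. The other obstacle is the weakness of a solution: \<open>u\<close> may vanish or be
  unbounded, only truncations of its pressure have weak gradients, and \<open>G\<close> means
  nothing where \<open>u = 0\<close>. Hence the approximations are functions of the truncated
  pressure that vanish for \<open>u \<le> \<epsilon>\<close>, their gradients are controlled from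
  above only, and the second moment and the integral of u^m at positive times are recovered from the
  finite entropy.\<close>

lemma iter_partial_append: "iter_partial (bs @ cs) f = iter_partial bs (iter_partial cs f)"
  by (induction bs) auto

lemma smooth_partial:
  assumes "smooth f" "b \<in> Basis"
  shows "smooth (\<lambda>x. frechet_derivative f (at x) b)"
  unfolding smooth_def
proof (intro allI impI)
  fix bs x assume "set bs \<subseteq> (Basis::'a set)"
  then have "set (bs @ [b]) \<subseteq> Basis" using assms(2) by auto
  then have "iter_partial (bs @ [b]) f differentiable at x"
    using assms(1) unfolding smooth_def by blast
  then show "iter_partial bs (\<lambda>x. frechet_derivative f (at x) b) differentiable at x"
    by (simp add: iter_partial_append)
qed

lemma smooth_differentiable: "smooth f \<Longrightarrow> f differentiable at x"
  unfolding smooth_def by (metis iter_partial.simps(1) empty_subsetI list.set(1))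

text \<open>Induction on the list of directions keeps the iterated derivative inside
  \<open>A\<close>. The closure rules below all take for \<open>A\<close> the functions of a shape
  that differentiation reproduces.\<close>

lemma smooth_coinduct:
  assumes "f \<in> A"
    and diff: "\<And>g x. g \<in> A \<Longrightarrow> g differentiable at x"
    and partial: "\<And>g b. g \<in> A \<Longrightarrow> b \<in> Basis \<Longrightarrow> (\<lambda>x. frechet_derivative g (at x) b) \<in> A"
  shows "smooth f"
  unfolding smooth_def
proof (intro allI impI)
  fix bs x assume "set bs \<subseteq> (Basis::'a set)"
  then have "iter_partial bs f \<in> A"
    by (induction bs) (auto simp: assms(1) intro: partial)
  then show "iter_partial bs f differentiable at x" by (rule diff)
qed

lemma smooth_coinduct_deriv:
  assumes "f \<in> A"
    and "\<And>g. g \<in> A \<Longrightarrow> \<exists>g'. (\<forall>x. (g has_derivative g' x) (at x)) \<and> (\<forall>b\<in>Basis. (\<lambda>x. g' x b) \<in> A)"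
  shows "smooth f"
proof (rule smooth_coinduct[OF assms(1)])
  fix g x assume "g \<in> A"
  then show "g differentiable at x" using assms(2) unfolding differentiable_def by blast
next
  fix g and b :: 'a assume "g \<in> A" "b \<in> Basis"
  then obtain g' where g': "\<And>x. (g has_derivative g' x) (at x)" "(\<lambda>x. g' x b) \<in> A"
    using assms(2) by blast
  have "frechet_derivative g (at x) = g' x" for x
    using g'(1) frechet_derivative_at by metis
  then show "(\<lambda>x. frechet_derivative g (at x) b) \<in> A" using g'(2) by simp
qed

lemma smooth_has_derivative:
  "smooth f \<Longrightarrow> (f has_derivative frechet_derivative f (at x)) (at x)"
  using smooth_differentiable frechet_derivative_works by blast

lemma smooth_const: "smooth (\<lambda>x. c)"
  by (rule smooth_coinduct_deriv[where A="range (\<lambda>c x. c)"]) (auto intro!: exI[of _ "\<lambda>x h. 0"])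

lemma smooth_inner: "smooth (\<lambda>x. x \<bullet> a)"
proof (rule smooth_coinduct_deriv[where A="insert (\<lambda>x. x \<bullet> a) (range (\<lambda>c x. c))"])
  fix g assume "g \<in> insert (\<lambda>x. x \<bullet> a) (range (\<lambda>c x. c))"
  then consider "g = (\<lambda>x. x \<bullet> a)" | c where "g = (\<lambda>x. c)" by auto
  then show "\<exists>g'. (\<forall>x. (g has_derivative g' x) (at x)) \<and>
      (\<forall>b\<in>Basis. (\<lambda>x. g' x b) \<in> insert (\<lambda>x. x \<bullet> a) (range (\<lambda>c x. c)))"
  proof cases
    case 1
    then show ?thesis
      by (intro exI[of _ "\<lambda>x h. h \<bullet> a"]) (auto intro!: derivative_eq_intros)
  next
    case 2
    then show ?thesis by (intro exI[of _ "\<lambda>x h. 0"]) auto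
  qed
qed simp

text \<open>Leibniz' rule turns one product into two, so products alone are not stable under partial
  derivatives, but their finite sums are.\<close>

inductive_set product_sums :: "('a::euclidean_space \<Rightarrow> real) set" where
  mult: "smooth f \<Longrightarrow> smooth g \<Longrightarrow> (\<lambda>x. f x * g x) \<in> product_sums"
| add: "f \<in> product_sums \<Longrightarrow> g \<in> product_sums \<Longrightarrow> (\<lambda>x. f x + g x) \<in> product_sums"

lemma product_sums_smooth:
  assumes "f \<in> product_sums" shows "smooth f"
proof (rule smooth_coinduct_deriv[OF assms])
  fix g assume "g \<in> (product_sums :: ('a \<Rightarrow> real) set)"
  then show "\<exists>g'. (\<forall>x. (g has_derivative g' x) (at x)) \<and> (\<forall>b\<in>Basis. (\<lambda>x. g' x b) \<in> product_sums)"
  proof induction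
    case (mult f g)
    then show ?case
      by (intro exI[of _ "\<lambda>x h. f x * frechet_derivative g (at x) h + frechet_derivative f (at x) h * g x"])
        (auto intro!: has_derivative_mult smooth_has_derivative product_sums.intros smooth_partial)
  next
    case (add f g)
    then obtain f' g' where "\<And>x. (f has_derivative f' x) (at x)" "\<And>x. (g has_derivative g' x) (at x)"
      "\<And>b. b \<in> Basis \<Longrightarrow> (\<lambda>x. f' x b) \<in> product_sums" "\<And>b. b \<in> Basis \<Longrightarrow> (\<lambda>x. g' x b) \<in> product_sums"
      by blast
    then show ?case
      by (intro exI[of _ "\<lambda>x h. f' x h + g' x h"])
        (auto intro!: has_derivative_add product_sums.intros)
  qed
qed

lemma smooth_mult: "smooth f \<Longrightarrow> smooth g \<Longrightarrow> smooth (\<lambda>x. f x * g x)"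
  by (rule product_sums_smooth[OF product_sums.mult])

lemma smooth_add:
  assumes "smooth f" "smooth g" shows "smooth (\<lambda>x. f x + g x)"
proof -
  have "(\<lambda>x. f x * 1 + g x * 1) \<in> product_sums"
    by (intro product_sums.intros assms smooth_const)
  then show ?thesis using product_sums_smooth by fastforce
qed

lemma smooth_diff:
  assumes "smooth f" "smooth g" shows "smooth (\<lambda>x. f x - g x)"
proof -
  have "smooth (\<lambda>x. f x + (-1) * g x)"
    by (intro smooth_add smooth_mult assms smooth_const)
  then show ?thesis by simp
qed

lemma smooth_sum:
  "(\<And>i. i \<in> I \<Longrightarrow> smooth (f i)) \<Longrightarrow> smooth (\<lambda>x. \<Sum>i\<in>I. f i x)"
  by (induction I rule: infinite_finite_induct) (auto intro: smooth_const smooth_add)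

lemma smooth_inner_self: "smooth (\<lambda>x. x \<bullet> x)"
proof -
  have "smooth (\<lambda>x::'a. \<Sum>b\<in>Basis. (x \<bullet> b) * (x \<bullet> b))"
    by (intro smooth_sum smooth_mult smooth_inner)
  then show ?thesis by (simp add: euclidean_inner[symmetric])
qed

text \<open>The exponent differs between summands: differentiating the power lowers it by one and
  moves a smooth factor to the front.\<close>

inductive_set powr_sums :: "('a::euclidean_space \<Rightarrow> real) \<Rightarrow> ('a \<Rightarrow> real) set" for q where
  mult: "smooth f \<Longrightarrow> (\<lambda>x. f x * q x powr a) \<in> powr_sums q"
| add: "f \<in> powr_sums q \<Longrightarrow> g \<in> powr_sums q \<Longrightarrow> (\<lambda>x. f x + g x) \<in> powr_sums q"

lemma smooth_powr:
  assumes q: "smooth q" and pos: "\<And>x. q x > 0"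
  shows "smooth (\<lambda>x. q x powr a)"
proof -
  have sm: "smooth f" if "f \<in> powr_sums q" for f
  proof (rule smooth_coinduct_deriv[OF that])
    fix g assume "g \<in> powr_sums q"
    then show "\<exists>g'. (\<forall>x. (g has_derivative g' x) (at x)) \<and> (\<forall>b\<in>Basis. (\<lambda>x. g' x b) \<in> powr_sums q)"
    proof induction
      case (mult f a)
      have der: "((\<lambda>x. f x * q x powr a) has_derivative
          (\<lambda>h. frechet_derivative f (at x) h * q x powr a
            + (a * f x * frechet_derivative q (at x) h) * q x powr (a - 1))) (at x)" for x
      proof -
        have "((\<lambda>x. q x powr a) has_derivative (\<lambda>h. a * q x powr (a - 1) * frechet_derivative q (at x) h)) (at x)"
          using DERIV_compose_FDERIV[OF has_real_derivative_powr[OF pos[of x], of a] smooth_has_derivative[OF q]]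
          by (simp add: mult_ac)
        from has_derivative_mult[OF smooth_has_derivative[OF mult(1)] this] show ?thesis
          by (rule has_derivative_eq_rhs) (auto simp: algebra_simps)
      qed
      show ?case
        by (rule exI[of _ "\<lambda>x h. frechet_derivative f (at x) h * q x powr a
            + (a * f x * frechet_derivative q (at x) h) * q x powr (a - 1)"])
          (intro conjI allI ballI der powr_sums.intros smooth_partial smooth_mult smooth_const mult q)
    next
      case (add f g)
      then obtain f' g' where "\<And>x. (f has_derivative f' x) (at x)" "\<And>x. (g has_derivative g' x) (at x)"
        "\<And>b. b \<in> Basis \<Longrightarrow> (\<lambda>x. f' x b) \<in> powr_sums q" "\<And>b. b \<in> Basis \<Longrightarrow> (\<lambda>x. g' x b) \<in> powr_sums q"
        by blast
      then show ?case
        by (intro exI[of _ "\<lambda>x h. f' x h + g' x h"])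
          (auto intro!: has_derivative_add powr_sums.intros)
    qed
  qed
  have "(\<lambda>x. 1 * q x powr a) \<in> powr_sums q" by (intro powr_sums.intros smooth_const)
  from sm[OF this] show ?thesis by simp
qed

text \<open>The factor \<open>c\<close> of the class collects the powers of \<open>a\<close> that
  the chain rule produces.\<close>

lemma smooth_affine:
  assumes "smooth f"
  shows "smooth (\<lambda>x. f (z + a *\<^sub>R x))"
proof (rule smooth_coinduct_deriv[where A="{\<lambda>x. c * g (z + a *\<^sub>R x) | c g. smooth g}"])
  show "(\<lambda>x. f (z + a *\<^sub>R x)) \<in> {\<lambda>x. c * g (z + a *\<^sub>R x) | c g. smooth g}"
    using assms by (intro CollectI exI[of _ 1] exI[of _ f]) auto
next
  fix g assume "g \<in> {\<lambda>x. c * g (z + a *\<^sub>R x) | c g. smooth g}"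
  then obtain c h where g: "g = (\<lambda>x. c * h (z + a *\<^sub>R x))" "smooth h" by blast
  have der: "(g has_derivative (\<lambda>v. c * a * frechet_derivative h (at (z + a *\<^sub>R x)) v)) (at x)" for x
  proof -
    have lin: "linear (frechet_derivative h (at (z + a *\<^sub>R x)))"
      using smooth_differentiable[OF g(2)] linear_frechet_derivative by blast
    have "((\<lambda>x. z + a *\<^sub>R x) has_derivative (\<lambda>v. a *\<^sub>R v)) (at x)"
      by (auto intro!: derivative_eq_intros)
    from has_derivative_compose[OF this smooth_has_derivative[OF g(2)]]
    have "((\<lambda>x. h (z + a *\<^sub>R x)) has_derivative
        (\<lambda>v. frechet_derivative h (at (z + a *\<^sub>R x)) (a *\<^sub>R v))) (at x)" by simp
    from has_derivative_mult_right[OF this, of c] show ?thesis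
      unfolding g by (simp add: linear_cmul[OF lin] mult_ac)
  qed
  show "\<exists>g'. (\<forall>x. (g has_derivative g' x) (at x)) \<and>
      (\<forall>b\<in>Basis. (\<lambda>x. g' x b) \<in> {\<lambda>x. c * g (z + a *\<^sub>R x) | c g. smooth g})"
  proof (intro exI conjI allI ballI)
    show "(g has_derivative (\<lambda>v. c * a * frechet_derivative h (at (z + a *\<^sub>R x)) v)) (at x)" for x
      by (rule der)
    show "(\<lambda>x. c * a * frechet_derivative h (at (z + a *\<^sub>R x)) b) \<in> {\<lambda>x. c * g (z + a *\<^sub>R x) | c g. smooth g}"
      if "b \<in> Basis" for b
      using smooth_partial[OF g(2) that]
      by (intro CollectI exI[of _ "c * a"] exI[of _ "\<lambda>y. frechet_derivative h (at y) b"]) auto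
  qed
qed

text \<open>Every derivative of exp (-1/t) is a polynomial in 1/t times exp (-1/t); carrying the
  polynomial along makes the family stable under differentiation.\<close>

definition flat :: "real poly \<Rightarrow> real \<Rightarrow> real" where
  "flat P t = (if t > 0 then poly P (1 / t) * exp (- (1 / t)) else 0)"

lemma flat_tendsto_0: "(flat P \<longlongrightarrow> 0) (at_right 0)"
proof -
  have "((\<lambda>y. poly P y * exp (- y)) \<longlongrightarrow> 0) at_top"
  proof (induction P)
    case 0
    then show ?case by simp
  next
    case (pCons a P)
    have "((\<lambda>y. a * (y ^ 0 / exp y) + (\<Sum>i\<le>degree P. coeff P i * (y ^ Suc i / exp y))) \<longlongrightarrow>
        a * 0 + (\<Sum>i\<le>degree P. coeff P i * 0)) at_top"
      by (intro tendsto_add tendsto_sum tendsto_mult tendsto_const tendsto_power_div_exp_0)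
    then show ?case
      by (simp add: poly_altdef[of P] exp_minus divide_inverse algebra_simps sum_distrib_left)
  qed
  moreover have "filterlim (\<lambda>t::real. 1 / t) at_top (at_right 0)"
    using filterlim_inverse_at_top_right by (simp add: inverse_eq_divide)
  ultimately have "((\<lambda>t. poly P (1 / t) * exp (- (1 / t))) \<longlongrightarrow> 0) (at_right 0)"
    by (rule filterlim_compose)
  then show ?thesis
    by (rule Lim_transform_eventually)
      (auto simp: flat_def eventually_at_right_field intro!: exI[of _ 1])
qed

text \<open>With z = 1/t, differentiation in t is - z^2 d/dz, and - z^2 (P e^(-z))' = z^2 (P - P')
  e^(-z); \<open>[:0, 0, 1:]\<close> is the polynomial z^2.\<close>

lemma flat_has_real_derivative:
  "(flat P has_real_derivative flat ([:0, 0, 1:] * (P - pderiv P)) t) (at t)"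
proof -
  consider "t > 0" | "t < 0" | "t = 0" by linarith
  then show ?thesis
  proof cases
    case 1
    have "((\<lambda>t. poly P (1 / t) * exp (- (1 / t))) has_real_derivative
        flat ([:0, 0, 1:] * (P - pderiv P)) t) (at t)"
      using 1 unfolding flat_def
      by (auto intro!: derivative_eq_intros DERIV_chain'[OF _ poly_DERIV] simp: field_simps power2_eq_square)
    then show ?thesis
      by (rule has_field_derivative_transform_within_open[where S="{0<..}"]) (use 1 in \<open>auto simp: flat_def\<close>)
  next
    case 2
    have "((\<lambda>t. 0) has_real_derivative 0) (at t)" by simp
    then have "(flat P has_real_derivative 0) (at t)"
      by (rule has_field_derivative_transform_within_open[where S="{..<0}"]) (use 2 in \<open>auto simp: flat_def\<close>)
    then show ?thesis using 2 by (simp add: flat_def)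
  next
    case 3
    \<comment> \<open>From the right the difference quotient at 0 is P (1/t) exp (-1/t) / t, that
      is, \<open>flat\<close> of the polynomial z P.\<close>
    have "((\<lambda>h. (flat P (0 + h) - flat P 0) / h) \<longlongrightarrow> 0) (at_right 0)"
      by (rule Lim_transform_eventually[OF flat_tendsto_0[of "[:0,1:] * P"]])
        (auto simp: flat_def eventually_at_right_field intro!: exI[of _ 1])
    moreover have "((\<lambda>h. (flat P (0 + h) - flat P 0) / h) \<longlongrightarrow> 0) (at_left 0)"
      by (rule Lim_transform_eventually[OF tendsto_const])
        (auto simp: flat_def eventually_at_left_field intro!: exI[of _ "-1"])
    ultimately have "((\<lambda>h. (flat P (0 + h) - flat P 0) / h) \<longlongrightarrow> 0) (at 0)"
      by (simp add: filterlim_at_split)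
    then show ?thesis using 3 by (simp add: DERIV_def flat_def)
  qed
qed

inductive_set flat_sums :: "('a::euclidean_space \<Rightarrow> real) \<Rightarrow> ('a \<Rightarrow> real) set" for q where
  mult: "smooth f \<Longrightarrow> (\<lambda>x. f x * flat P (q x)) \<in> flat_sums q"
| add: "f \<in> flat_sums q \<Longrightarrow> g \<in> flat_sums q \<Longrightarrow> (\<lambda>x. f x + g x) \<in> flat_sums q"

lemma smooth_flat:
  assumes q: "smooth q"
  shows "smooth (\<lambda>x. flat P (q x))"
proof -
  have sm: "smooth f" if "f \<in> flat_sums q" for f
  proof (rule smooth_coinduct_deriv[OF that])
    fix g assume "g \<in> flat_sums q"
    then show "\<exists>g'. (\<forall>x. (g has_derivative g' x) (at x)) \<and> (\<forall>b\<in>Basis. (\<lambda>x. g' x b) \<in> flat_sums q)"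
    proof induction
      case (mult f P)
      let ?P = "[:0, 0, 1:] * (P - pderiv P)"
      have der: "((\<lambda>x. f x * flat P (q x)) has_derivative
          (\<lambda>h. frechet_derivative f (at x) h * flat P (q x)
            + (f x * frechet_derivative q (at x) h) * flat ?P (q x))) (at x)" for x
      proof -
        have "((\<lambda>x. flat P (q x)) has_derivative (\<lambda>h. flat ?P (q x) * frechet_derivative q (at x) h)) (at x)"
          using DERIV_compose_FDERIV[OF flat_has_real_derivative[of P] smooth_has_derivative[OF q]]
          by (simp add: mult_ac)
        from has_derivative_mult[OF smooth_has_derivative[OF mult(1)] this] show ?thesis
          by (rule has_derivative_eq_rhs) (auto simp: algebra_simps)
      qed
      show ?case
        by (rule exI[of _ "\<lambda>x h. frechet_derivative f (at x) h * flat P (q x)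
            + (f x * frechet_derivative q (at x) h) * flat ?P (q x)"])
          (intro conjI allI ballI der flat_sums.intros smooth_partial smooth_mult mult q)
    next
      case (add f g)
      then obtain f' g' where "\<And>x. (f has_derivative f' x) (at x)" "\<And>x. (g has_derivative g' x) (at x)"
        "\<And>b. b \<in> Basis \<Longrightarrow> (\<lambda>x. f' x b) \<in> flat_sums q" "\<And>b. b \<in> Basis \<Longrightarrow> (\<lambda>x. g' x b) \<in> flat_sums q"
        by blast
      then show ?case
        by (intro exI[of _ "\<lambda>x h. f' x h + g' x h"])
          (auto intro!: has_derivative_add flat_sums.intros)
    qed
  qed
  have "(\<lambda>x. 1 * flat P (q x)) \<in> flat_sums q" by (intro flat_sums.intros smooth_const)
  from sm[OF this] show ?thesis by simp
qed

definition bump :: "'a::euclidean_space \<Rightarrow> real" where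
  "bump x = exp 1 * flat 1 (1 - x \<bullet> x)"

lemma smooth_bump: "smooth bump"
  unfolding bump_def
  by (intro smooth_mult smooth_const smooth_flat smooth_diff smooth_inner_self)

lemma bump_nonneg: "bump x \<ge> 0"
  by (simp add: bump_def flat_def)

lemma bump_pos: "norm x < 1 \<Longrightarrow> bump x > 0"
  by (simp add: bump_def flat_def dot_square_norm power_less_one_iff abs_square_less_1)

lemma bump_eq_0: "norm x \<ge> 1 \<Longrightarrow> bump x = 0"
  using one_le_power[of "norm x" 2] by (simp add: bump_def flat_def dot_square_norm del: one_le_power)

lemma bump_0: "bump 0 = 1"
  by (simp add: bump_def flat_def exp_minus)

lemma bump_le_1: "bump x \<le> 1"
proof (cases "1 - x \<bullet> x > 0")
  case True
  then have "1 / (1 - x \<bullet> x) \<ge> 1" by (simp add: field_simps)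
  then show ?thesis using True
    by (simp add: bump_def flat_def exp_add[symmetric] del: one_le_inverse_iff)
qed (simp add: bump_def flat_def)

section \<open>Test functions and their gradients\<close>

lemma test_functionsI:
  assumes "smooth w" and "\<And>x. norm x > R \<Longrightarrow> w x = 0"
  shows "w \<in> test_functions"
proof -
  have "{x. w x \<noteq> 0} \<subseteq> cball 0 R" using assms(2) by force
  then have "bounded {x. w x \<noteq> 0}" using bounded_cball bounded_subset by blast
  then show ?thesis using assms(1) by (simp add: test_functions_def compact_closure)
qed

lemma test_function_smooth: "w \<in> test_functions \<Longrightarrow> smooth w"
  by (simp add: test_functions_def)

lemma test_function_support:
  assumes "w \<in> test_functions"
  obtains R where "R > 0" "\<And>x. norm x > R \<Longrightarrow> w x = 0"
proof -
  have "bounded (closure {x. w x \<noteq> 0})"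
    using assms by (simp add: test_functions_def compact_imp_bounded)
  then obtain R where R: "R > 0" "\<And>x. x \<in> closure {x. w x \<noteq> 0} \<Longrightarrow> norm x \<le> R"
    using bounded_pos by metis
  show ?thesis
  proof (rule that[OF R(1)])
    fix x :: 'a assume "norm x > R"
    then have "x \<notin> {x. w x \<noteq> 0}" using R(2)[of x] closure_subset[of "{x. w x \<noteq> 0}"] by auto
    then show "w x = 0" by simp
  qed
qed

lemma grad_inner:
  assumes "smooth f"
  shows "frechet_derivative f (at x) h = grad f x \<bullet> h"
proof -
  have lin: "linear (frechet_derivative f (at x))"
    using smooth_differentiable[OF assms] linear_frechet_derivative by blast
  have "frechet_derivative f (at x) h = frechet_derivative f (at x) (\<Sum>b\<in>Basis. (h \<bullet> b) *\<^sub>R b)"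
    by (simp add: euclidean_representation)
  also have "\<dots> = (\<Sum>b\<in>Basis. (h \<bullet> b) * frechet_derivative f (at x) b)"
    by (simp add: linear_sum[OF lin] linear_cmul[OF lin])
  also have "\<dots> = grad f x \<bullet> h"
    by (simp add: grad_def inner_sum_left inner_commute[of h] mult.commute)
  finally show ?thesis .
qed

lemma smooth_has_derivative_grad:
  assumes "smooth f"
  shows "(f has_derivative (\<lambda>h. grad f x \<bullet> h)) (at x)"
proof -
  have "frechet_derivative f (at x) = (\<lambda>h. grad f x \<bullet> h)"
    by (rule ext) (rule grad_inner[OF assms])
  then show ?thesis using smooth_has_derivative[OF assms, of x] by simp
qed

lemma grad_eqI:
  assumes "(f has_derivative (\<lambda>h. g \<bullet> h)) (at x)"
  shows "grad f x = g"
  by (simp add: grad_def euclidean_representation flip: frechet_derivative_at[OF assms])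

lemma smooth_continuous: "smooth f \<Longrightarrow> continuous_on A f"
  by (meson differentiable_imp_continuous_within continuous_at_imp_continuous_on smooth_differentiable)

lemma grad_Basis: "b \<in> Basis \<Longrightarrow> grad f x \<bullet> b = frechet_derivative f (at x) b"
  by (simp add: grad_def)

lemma smooth_grad_inner: "smooth f \<Longrightarrow> b \<in> Basis \<Longrightarrow> smooth (\<lambda>x. grad f x \<bullet> b)"
  by (simp add: grad_Basis smooth_partial)

lemma continuous_grad:
  assumes "smooth f" shows "continuous_on A (grad f)"
  unfolding grad_def
  by (intro continuous_intros smooth_continuous smooth_partial assms) auto

lemma grad_eq_0_outside:
  assumes "\<And>x. norm x > R \<Longrightarrow> w x = 0" "norm x > R"
  shows "grad w x = 0"
proof -
  have op: "open {x::'a. norm x > R}" by (intro open_Collect_less continuous_intros)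
  have "((\<lambda>x. 0) has_derivative (\<lambda>h. 0 \<bullet> h)) (at x)" by simp
  then have "(w has_derivative (\<lambda>h. 0 \<bullet> h)) (at x)"
    by (rule has_derivative_transform_within_open[OF _ op]) (use assms in auto)
  then show ?thesis by (rule grad_eqI)
qed

lemma test_functions_mult:
  assumes "smooth f" "w \<in> test_functions"
  shows "(\<lambda>x. f x * w x) \<in> test_functions"
proof -
  obtain R where "\<And>x. norm x > R \<Longrightarrow> w x = 0" using test_function_support[OF assms(2)] by blast
  then show ?thesis
    by (intro test_functionsI[where R=R]) (auto intro: smooth_mult assms(1) test_function_smooth[OF assms(2)])
qed

lemma test_functions_partial:
  assumes "w \<in> test_functions" "b \<in> Basis"
  shows "(\<lambda>x. grad w x \<bullet> b) \<in> test_functions"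
proof -
  obtain R where "\<And>x. norm x > R \<Longrightarrow> w x = 0" using test_function_support[OF assms(1)] by blast
  then show ?thesis
    by (intro test_functionsI[where R=R])
      (auto simp: grad_eq_0_outside[of R] intro: smooth_grad_inner test_function_smooth[OF assms(1)] assms(2))
qed

lemma bump_test_function: "bump \<in> test_functions"
  by (rule test_functionsI[OF smooth_bump, of 1]) (simp add: bump_eq_0)

text \<open>Makes the set of radial competitors nonempty, as a lower bound for a real infimum
  demands.\<close>

lemma radial_bump: "radial bump"
  by (auto simp: radial_def bump_def dot_square_norm)

lemma test_function_affine:
  assumes "f \<in> test_functions" "a \<noteq> 0"
  shows "(\<lambda>x. f (z + a *\<^sub>R x)) \<in> test_functions"
proof -
  obtain R where R: "R > 0" "\<And>x. norm x > R \<Longrightarrow> f x = 0" using test_function_support[OF assms(1)] by blast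
  show ?thesis
  proof (rule test_functionsI[where R="(R + norm z) / \<bar>a\<bar>"])
    show "smooth (\<lambda>x. f (z + a *\<^sub>R x))" by (rule smooth_affine[OF test_function_smooth[OF assms(1)]])
    fix x :: 'a assume "norm x > (R + norm z) / \<bar>a\<bar>"
    then have "norm (a *\<^sub>R x) > R + norm z" using assms(2) by (simp add: field_simps)
    then have "norm (z + a *\<^sub>R x) > R"
      using norm_triangle_ineq4[of "z + a *\<^sub>R x" z] by simp
    then show "f (z + a *\<^sub>R x) = 0" by (rule R(2))
  qed
qed

lemma grad_affine:
  assumes "smooth f"
  shows "grad (\<lambda>x. f (z + a *\<^sub>R x)) x = a *\<^sub>R grad f (z + a *\<^sub>R x)"
proof (rule grad_eqI)
  have "((\<lambda>x. z + a *\<^sub>R x) has_derivative (\<lambda>v. a *\<^sub>R v)) (at x)"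
    by (auto intro!: derivative_eq_intros)
  from has_derivative_compose[OF this smooth_has_derivative_grad[OF assms]]
  show "((\<lambda>x. f (z + a *\<^sub>R x)) has_derivative (\<lambda>h. a *\<^sub>R grad f (z + a *\<^sub>R x) \<bullet> h)) (at x)"
    by simp
qed

lemma grad_mult:
  assumes "smooth f" "smooth h"
  shows "grad (\<lambda>x. f x * h x) x = f x *\<^sub>R grad h x + h x *\<^sub>R grad f x"
proof (rule grad_eqI)
  from has_derivative_mult[OF smooth_has_derivative_grad[OF assms(1)] smooth_has_derivative_grad[OF assms(2)], of x]
  show "((\<lambda>x. f x * h x) has_derivative (\<lambda>v. (f x *\<^sub>R grad h x + h x *\<^sub>R grad f x) \<bullet> v)) (at x)"
    by (rule has_derivative_eq_rhs) (auto simp: inner_add_left algebra_simps)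
qed

subsection \<open>Convolution with test functions\<close>

lemma lborel_reflect: "distr lborel lborel (\<lambda>y::'a::euclidean_space. x - y) = lborel"
proof -
  have "(lborel :: 'a measure) = density (distr lborel borel (\<lambda>y::'a. x + (-1) *\<^sub>R y)) (\<lambda>_. \<bar>-1::real\<bar> ^ DIM('a))"
    by (rule lborel_affine) simp
  also have "\<dots> = distr lborel lborel (\<lambda>y::'a. x - y)"
    by (simp add: density_1 cong: distr_cong)
  finally show ?thesis by simp
qed

lemma integral_reflect_lborel:
  fixes h :: "'a::euclidean_space \<Rightarrow> 'b::euclidean_space"
  assumes "h \<in> borel_measurable lborel"
  shows "(LINT y|lborel. h (x - y)) = (LINT y|lborel. h y)"
  using integral_distr[of "\<lambda>y. x - y" lborel lborel h] assms by (simp add: lborel_reflect)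

lemma nn_integral_reflect_lborel:
  fixes h :: "'a::euclidean_space \<Rightarrow> ennreal"
  assumes "h \<in> borel_measurable lborel"
  shows "(\<integral>\<^sup>+y. h (x - y) \<partial>lborel) = (\<integral>\<^sup>+y. h y \<partial>lborel)"
  using nn_integral_distr[of "\<lambda>y. x - y" lborel lborel h] assms by (simp add: lborel_reflect)

lemma bounded_compact_support:
  fixes c :: "'a::euclidean_space \<Rightarrow> 'b::euclidean_space"
  assumes "continuous_on UNIV c" "\<And>x. norm x > R \<Longrightarrow> c x = 0"
  obtains B where "B > 0" "\<And>x. norm (c x) \<le> B"
proof -
  have "compact (c ` cball 0 R)"
    by (intro compact_continuous_image continuous_on_subset[OF assms(1)]) auto
  then obtain B where B: "B > 0" "\<And>y. y \<in> c ` cball 0 R \<Longrightarrow> norm y \<le> B"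
    using compact_imp_bounded bounded_pos by metis
  have "norm (c x) \<le> B" for x
    using B assms(2)[of x] by (cases "norm x \<le> R") auto
  then show ?thesis using that B(1) by blast
qed

lemma locally_integrable_scaleR:
  fixes c :: "'a::euclidean_space \<Rightarrow> real" and f :: "'a \<Rightarrow> 'b::euclidean_space"
  assumes f: "locally_integrable f" and c: "continuous_on UNIV c" "\<And>x. norm x > R \<Longrightarrow> c x = 0"
  shows "integrable lborel (\<lambda>x. c x *\<^sub>R f x)"
proof -
  obtain B where B: "B > 0" "\<And>x. norm (c x) \<le> B" using bounded_compact_support[OF c] by metis
  have int: "integrable lborel (\<lambda>x. indicator (cball 0 R) x *\<^sub>R f x)"
    using f unfolding locally_integrable_def set_integrable_def by simp
  have [measurable]: "c \<in> borel_measurable borel" using c(1) by (rule borel_measurable_continuous_onI)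
  have "integrable lborel (\<lambda>x. c x *\<^sub>R (indicator (cball 0 R) x *\<^sub>R f x))"
  proof (rule Bochner_Integration.integrable_bound)
    show "integrable lborel (\<lambda>x. B *\<^sub>R (indicator (cball 0 R) x *\<^sub>R f x))"
      by (intro integrable_scaleR_right int)
    show "(\<lambda>x. c x *\<^sub>R (indicator (cball 0 R) x *\<^sub>R f x)) \<in> borel_measurable lborel"
      using borel_measurable_integrable[OF int] by measurable
    show "AE x in lborel. norm (c x *\<^sub>R (indicator (cball 0 R) x *\<^sub>R f x))
        \<le> norm (B *\<^sub>R (indicator (cball 0 R) x *\<^sub>R f x))"
      using B by (intro AE_I2) (auto simp: indicator_def intro!: mult_right_mono)
  qed
  moreover have "(\<lambda>x. c x *\<^sub>R (indicator (cball 0 R) x *\<^sub>R f x)) = (\<lambda>x. c x *\<^sub>R f x)"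
  proof
    show "c x *\<^sub>R (indicator (cball 0 R) x *\<^sub>R f x) = c x *\<^sub>R f x" for x
      using c(2)[of x] by (cases "norm x \<le> R") (auto simp: indicator_def)
  qed
  ultimately show ?thesis by metis
qed

lemma locally_integrable_mult:
  fixes c :: "'a::euclidean_space \<Rightarrow> real" and f :: "'a \<Rightarrow> real"
  assumes "locally_integrable f" "continuous_on UNIV c" "\<And>x. norm x > R \<Longrightarrow> c x = 0"
  shows "integrable lborel (\<lambda>x. f x * c x)"
  using locally_integrable_scaleR[OF assms] by (simp add: mult.commute)

lemma locally_integrable_inner:
  assumes "locally_integrable f"
  shows "locally_integrable (\<lambda>x. f x \<bullet> b)"
  unfolding locally_integrable_def set_integrable_def
proof (intro allI impI)
  fix K :: "'a set" assume "compact K"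
  then have "integrable lborel (\<lambda>x. indicator K x *\<^sub>R f x)"
    using assms by (auto simp: locally_integrable_def set_integrable_def)
  from integrable_inner_left[OF this, of b]
  show "integrable lborel (\<lambda>x. indicator K x *\<^sub>R (f x \<bullet> b))" by simp
qed

lemma locally_integrable_scaleR_vector:
  fixes c :: "'a::euclidean_space \<Rightarrow> 'b::euclidean_space" and f :: "'a \<Rightarrow> real"
  assumes f: "locally_integrable f" and c: "continuous_on UNIV c" "\<And>x. norm x > R \<Longrightarrow> c x = 0"
  shows "integrable lborel (\<lambda>x. f x *\<^sub>R c x)"
proof -
  have "integrable lborel (\<lambda>x. \<Sum>b\<in>Basis. (f x * (c x \<bullet> b)) *\<^sub>R b)"
    by (intro Bochner_Integration.integrable_sum integrable_scaleR_left locally_integrable_mult[OF f, of _ R])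
      (use c in \<open>auto intro!: continuous_intros\<close>)
  also have "(\<lambda>x. \<Sum>b\<in>Basis. (f x * (c x \<bullet> b)) *\<^sub>R b) = (\<lambda>x. f x *\<^sub>R c x)"
    by (auto simp: euclidean_representation simp flip: scaleR_scaleR scaleR_sum_right)
  finally show ?thesis .
qed

lemma locally_integrable_measurable:
  fixes f :: "'a::euclidean_space \<Rightarrow> 'b::euclidean_space"
  assumes "locally_integrable f"
  shows "f \<in> borel_measurable lborel"
proof (rule borel_measurable_LIMSEQ_metric)
  show "(\<lambda>x. indicator (cball 0 (real k)) x *\<^sub>R f x) \<in> borel_measurable lborel" for k
    using assms by (intro borel_measurable_integrable) (auto simp: locally_integrable_def set_integrable_def)
  fix x
  have "eventually (\<lambda>k. indicator (cball 0 (real k)) x *\<^sub>R f x = f x) sequentially"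
    using eventually_ge_at_top[of "nat \<lceil>norm x\<rceil>"]
    by eventually_elim (auto simp: indicator_def nat_ceiling_le_eq)
  then show "(\<lambda>k. indicator (cball 0 (real k)) x *\<^sub>R f x) \<longlonglongrightarrow> f x"
    by (rule tendsto_eventually)
qed

lemma uniform_compact_support:
  fixes c :: "'a::euclidean_space \<Rightarrow> 'b::euclidean_space"
  assumes c: "continuous_on UNIV c" "\<And>x. norm x > R \<Longrightarrow> c x = 0" and "e > 0"
  obtains d where "d > 0" "\<And>x y. norm (x - y) < d \<Longrightarrow> norm (c x - c y) < e"
proof -
  have "uniformly_continuous_on (cball 0 (R + 1)) c"
    by (intro compact_uniformly_continuous continuous_on_subset[OF c(1)]) auto
  then obtain d where d: "d > 0" "\<And>x y. x \<in> cball 0 (R + 1) \<Longrightarrow> y \<in> cball 0 (R + 1) \<Longrightarrow>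
      dist y x < d \<Longrightarrow> dist (c y) (c x) < e"
    using \<open>e > 0\<close> unfolding uniformly_continuous_on_def by metis
  \<comment> \<open>With distance below 1, either both points lie in the ball of radius
    \<open>R + 1\<close>, where \<open>c\<close> is uniformly continuous, or both values
    vanish.\<close>
  have "norm (c x - c y) < e" if "norm (x - y) < min d 1" for x y
  proof (cases "norm x \<le> R \<or> norm y \<le> R")
    case True
    then have "x \<in> cball 0 (R + 1)" "y \<in> cball 0 (R + 1)"
      using that norm_triangle_ineq2[of x y] norm_triangle_ineq3[of y x] by (auto simp: norm_minus_commute)
    then show ?thesis using d(2)[of y x] that by (simp add: dist_norm)
  next
    case False
    then show ?thesis using c(2)[of x] c(2)[of y] \<open>e > 0\<close> by simp
  qed
  then show ?thesis using that[of "min d 1"] d(1) by simp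
qed

text \<open>The radius \<open>d\<close> does not depend on \<open>z\<close>: the gradient has
  compact support, hence is uniformly continuous. This uniformity allows differentiation under the
  convolution integral.\<close>

lemma test_function_taylor:
  assumes \<phi>: "\<phi> \<in> test_functions" and "e > 0"
  obtains d where "d > 0"
    "\<And>z h. norm h < d \<Longrightarrow> \<bar>\<phi> (z + h) - \<phi> z - grad \<phi> z \<bullet> h\<bar> \<le> e * norm h"
proof -
  obtain R where R: "\<And>x. norm x > R \<Longrightarrow> \<phi> x = 0" using test_function_support[OF \<phi>] by blast
  have sm: "smooth \<phi>" using test_function_smooth[OF \<phi>] .
  obtain d where d: "d > 0" "\<And>x y. norm (x - y) < d \<Longrightarrow> norm (grad \<phi> x - grad \<phi> y) < e"
    using uniform_compact_support[OF continuous_grad[OF sm] _ \<open>e > 0\<close>, of R] grad_eq_0_outside[of R \<phi>] R by metis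
  show ?thesis
  proof (rule that[OF d(1)])
    fix z h :: 'a assume h: "norm h < d"
    define F where "F = (\<lambda>s. \<phi> (z + s) - grad \<phi> z \<bullet> s)"
    have "norm (F h - F 0) \<le> e * norm (h - 0)"
    proof (rule differentiable_bound[where S="ball 0 d"])
      fix s :: 'a assume s: "s \<in> ball 0 d"
      have "((\<lambda>s. z + s) has_derivative (\<lambda>v. v)) (at s within ball 0 d)"
        by (auto intro!: derivative_eq_intros)
      from has_derivative_compose[OF this smooth_has_derivative_grad[OF sm]]
      have "((\<lambda>s. \<phi> (z + s)) has_derivative (\<lambda>v. grad \<phi> (z + s) \<bullet> v)) (at s within ball 0 d)" by simp
      then show "(F has_derivative (\<lambda>v. (grad \<phi> (z + s) - grad \<phi> z) \<bullet> v)) (at s within ball 0 d)"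
        unfolding F_def inner_diff_left by (auto intro!: derivative_eq_intros)
      have "norm (grad \<phi> (z + s) - grad \<phi> z) \<le> e"
        using d(2)[of "z + s" z] s by auto
      then show "onorm (\<lambda>v. (grad \<phi> (z + s) - grad \<phi> z) \<bullet> v) \<le> e"
        by (intro onorm_le) (metis Cauchy_Schwarz_ineq2 mult_right_mono norm_ge_zero order_trans real_norm_def)
    qed (use h d(1) in auto)
    then show "\<bar>\<phi> (z + h) - \<phi> z - grad \<phi> z \<bullet> h\<bar> \<le> e * norm h"
      by (simp add: F_def algebra_simps)
  qed
qed

definition convolution :: "('a::euclidean_space \<Rightarrow> real) \<Rightarrow> ('a \<Rightarrow> real) \<Rightarrow> 'a \<Rightarrow> real" where
  "convolution f \<phi> x = (LINT y|lborel. f y * \<phi> (x - y))"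

lemma reflect_support:
  fixes x y :: "'a::real_normed_vector"
  assumes "norm x + R < norm y"
  shows "R < norm (x - y)"
  using assms norm_triangle_ineq2[of y x] by (simp add: norm_minus_commute)

lemma convolution_integrable:
  assumes "locally_integrable f" "\<phi> \<in> test_functions"
  shows "integrable lborel (\<lambda>y. f y * \<phi> (x - y))"
proof -
  obtain R where R: "\<And>x. norm x > R \<Longrightarrow> \<phi> x = 0" using test_function_support[OF assms(2)] by blast
  show ?thesis
    by (rule locally_integrable_mult[OF assms(1), of _ "norm x + R"])
      (auto intro!: continuous_intros continuous_on_compose2[OF smooth_continuous[OF test_function_smooth[OF assms(2)]]]
        reflect_support R)
qed

lemma convolution_grad_integrable:
  assumes "locally_integrable f" "\<phi> \<in> test_functions"
  shows "integrable lborel (\<lambda>y. f y *\<^sub>R grad \<phi> (x - y))"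
proof -
  obtain R where R: "\<And>x. norm x > R \<Longrightarrow> \<phi> x = 0" using test_function_support[OF assms(2)] by blast
  show ?thesis
    by (rule locally_integrable_scaleR_vector[OF assms(1), of _ "norm x + R"])
      (auto intro!: continuous_intros continuous_on_compose2[OF continuous_grad[OF test_function_smooth[OF assms(2)]]]
        reflect_support R grad_eq_0_outside[of R \<phi>])
qed

lemma convolution_has_derivative:
  assumes f: "locally_integrable f" and \<phi>: "\<phi> \<in> test_functions"
  shows "(convolution f \<phi> has_derivative (\<lambda>h. (LINT y|lborel. f y *\<^sub>R grad \<phi> (x - y)) \<bullet> h)) (at x)"
  unfolding has_derivative_at_alt
proof (intro conjI allI impI)
  show "bounded_linear (\<lambda>h. (LINT y|lborel. f y *\<^sub>R grad \<phi> (x - y)) \<bullet> h)"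
    by (rule bounded_linear_inner_right)
  obtain R where R: "R > 0" "\<And>x. norm x > R \<Longrightarrow> \<phi> x = 0" using test_function_support[OF \<phi>] by blast
  \<comment> \<open>For \<open>norm h < 1\<close> the remainder at \<open>y\<close> vanishes unless
    \<open>y\<close> lies within \<open>R + 1\<close> of \<open>x\<close>, so \<open>A\<close>
    measures all of \<open>f\<close> that matters; \<open>A + 1\<close> below avoids a division by
    zero.\<close>
  define A where "A = (LINT y|lborel. indicator (cball x (R + 1)) y * \<bar>f y\<bar>)"
  have intA: "integrable lborel (\<lambda>y. indicator (cball x (R + 1)) y * \<bar>f y\<bar>)"
  proof -
    have "integrable lborel (\<lambda>y. \<bar>indicator (cball x (R + 1)) y *\<^sub>R f y\<bar>)"
      using f unfolding locally_integrable_def set_integrable_def by (intro integrable_abs) simp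
    then show ?thesis by (simp add: abs_mult)
  qed
  have A: "A \<ge> 0" unfolding A_def by simp
  fix e :: real assume "e > 0"
  define e1 where "e1 = e / (A + 1)"
  have e1: "e1 > 0" "A * e1 \<le> e" using \<open>e > 0\<close> A by (auto simp: e1_def field_simps)
  obtain d where d: "d > 0" "\<And>z h. norm h < d \<Longrightarrow> \<bar>\<phi> (z + h) - \<phi> z - grad \<phi> z \<bullet> h\<bar> \<le> e1 * norm h"
    using test_function_taylor[OF \<phi> e1(1)] by blast
  show "\<exists>d>0. \<forall>y. norm (y - x) < d \<longrightarrow>
      norm (convolution f \<phi> y - convolution f \<phi> x - (LINT y|lborel. f y *\<^sub>R grad \<phi> (x - y)) \<bullet> (y - x))
        \<le> e * norm (y - x)"
  proof (intro exI[of _ "min d 1"] conjI allI impI)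
    show "min d 1 > 0" using d(1) by simp
    fix x' assume x': "norm (x' - x) < min d 1"
    define h where "h = x' - x"
    have h: "norm h < d" "norm h < 1" using x' by (auto simp: h_def)
    note int = convolution_integrable[OF f \<phi>, of x'] convolution_integrable[OF f \<phi>, of x]
      convolution_grad_integrable[OF f \<phi>, of x]
    have int3: "integrable lborel (\<lambda>y. (f y *\<^sub>R grad \<phi> (x - y)) \<bullet> h)"
      by (rule integrable_inner_left) (rule int(3))
    have "convolution f \<phi> x' - convolution f \<phi> x - (LINT y|lborel. f y *\<^sub>R grad \<phi> (x - y)) \<bullet> h
       = (LINT y|lborel. f y * \<phi> (x' - y) - f y * \<phi> (x - y) - (f y *\<^sub>R grad \<phi> (x - y)) \<bullet> h)"
      unfolding convolution_def integral_inner_left[OF int(3), symmetric]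
      using int int3 by (simp del: inner_scaleR_left)
    also have "norm \<dots> \<le> (LINT y|lborel. e1 * norm h * (indicator (cball x (R + 1)) y * \<bar>f y\<bar>))"
    proof (rule Bochner_Integration.integral_norm_bound_integral)
      show "integrable lborel (\<lambda>y. f y * \<phi> (x' - y) - f y * \<phi> (x - y) - (f y *\<^sub>R grad \<phi> (x - y)) \<bullet> h)"
        using int int3 by simp
      show "integrable lborel (\<lambda>y. e1 * norm h * (indicator (cball x (R + 1)) y * \<bar>f y\<bar>))"
        using intA by simp
      fix y
      let ?D = "\<phi> (x - y + h) - \<phi> (x - y) - grad \<phi> (x - y) \<bullet> h"
      have eq: "f y * \<phi> (x' - y) - f y * \<phi> (x - y) - (f y *\<^sub>R grad \<phi> (x - y)) \<bullet> h = f y * ?D"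
        by (simp add: h_def algebra_simps)
      show "norm (f y * \<phi> (x' - y) - f y * \<phi> (x - y) - (f y *\<^sub>R grad \<phi> (x - y)) \<bullet> h)
          \<le> e1 * norm h * (indicator (cball x (R + 1)) y * \<bar>f y\<bar>)"
      proof (cases "y \<in> cball x (R + 1)")
        case True
        then show ?thesis unfolding eq
          using mult_left_mono[OF d(2)[OF h(1), of "x - y"], of "\<bar>f y\<bar>"] by (simp add: abs_mult mult_ac)
      next
        case False
        then have "norm (x - y) > R + 1" by (simp add: dist_norm)
        moreover from this have "norm (x - y + h) > R"
          using h(2) norm_triangle_ineq4[of "x - y + h" h] by simp
        ultimately have "?D = 0" using R by (simp add: grad_eq_0_outside[of R \<phi>])
        then show ?thesis unfolding eq using False by simp
      qed
    qed
    also have "\<dots> = (A * e1) * norm h" by (simp add: A_def)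
    also have "\<dots> \<le> e * norm h" by (rule mult_right_mono[OF e1(2)]) simp
    finally show "norm (convolution f \<phi> x' - convolution f \<phi> x
        - (LINT y|lborel. f y *\<^sub>R grad \<phi> (x - y)) \<bullet> (x' - x)) \<le> e * norm (x' - x)"
      by (simp add: h_def)
  qed
qed

lemma grad_convolution:
  "locally_integrable f \<Longrightarrow> \<phi> \<in> test_functions \<Longrightarrow>
    grad (convolution f \<phi>) x = (LINT y|lborel. f y *\<^sub>R grad \<phi> (x - y))"
  by (intro grad_eqI convolution_has_derivative)

text \<open>Every derivative falls on the kernel, so the convolutions of the fixed \<open>f\<close>
  with arbitrary test functions form a stable class.\<close>

lemma smooth_convolution:
  assumes f: "locally_integrable f" and \<phi>: "\<phi> \<in> test_functions"
  shows "smooth (convolution f \<phi>)"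
proof (rule smooth_coinduct_deriv[where A="{convolution f \<phi> | \<phi>. \<phi> \<in> test_functions}"])
  show "convolution f \<phi> \<in> {convolution f \<phi> | \<phi>. \<phi> \<in> test_functions}" using \<phi> by blast
  fix g assume "g \<in> {convolution f \<phi> | \<phi>. \<phi> \<in> test_functions}"
  then obtain \<psi> where \<psi>: "g = convolution f \<psi>" "\<psi> \<in> test_functions" by blast
  show "\<exists>g'. (\<forall>x. (g has_derivative g' x) (at x)) \<and>
      (\<forall>b\<in>Basis. (\<lambda>x. g' x b) \<in> {convolution f \<phi> | \<phi>. \<phi> \<in> test_functions})"
  proof (intro exI[of _ "\<lambda>x h. (LINT y|lborel. f y *\<^sub>R grad \<psi> (x - y)) \<bullet> h"] conjI allI ballI)
    show "(g has_derivative (\<lambda>h. (LINT y|lborel. f y *\<^sub>R grad \<psi> (x - y)) \<bullet> h)) (at x)" for x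
      unfolding \<psi>(1) by (rule convolution_has_derivative[OF f \<psi>(2)])
    fix b :: 'a assume b: "b \<in> Basis"
    have "(\<lambda>x. (LINT y|lborel. f y *\<^sub>R grad \<psi> (x - y)) \<bullet> b) = convolution f (\<lambda>x. grad \<psi> x \<bullet> b)"
    proof
      fix x
      show "(LINT y|lborel. f y *\<^sub>R grad \<psi> (x - y)) \<bullet> b = convolution f (\<lambda>x. grad \<psi> x \<bullet> b) x"
        unfolding convolution_def
        using integral_inner_left[of b lborel "\<lambda>y. f y *\<^sub>R grad \<psi> (x - y)"]
          convolution_grad_integrable[OF f \<psi>(2)] by simp
    qed
    then show "(\<lambda>x. (LINT y|lborel. f y *\<^sub>R grad \<psi> (x - y)) \<bullet> b) \<in> {convolution f \<phi> | \<phi>. \<phi> \<in> test_functions}"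
      using test_functions_partial[OF \<psi>(2) b] by auto
  qed
qed

text \<open>As a function of \<open>y\<close> the reflected kernel is a test function, and the sign
  from reflecting it cancels the sign in the definition of a weak gradient.\<close>

lemma grad_convolution_weak:
  assumes w: "has_weak_gradient f g" and \<phi>: "\<phi> \<in> test_functions"
  shows "grad (convolution f \<phi>) x = (LINT y|lborel. \<phi> (x - y) *\<^sub>R g y)"
proof -
  have f: "locally_integrable f" using w by (simp add: has_weak_gradient_def)
  have t: "(\<lambda>y. \<phi> (x + (-1) *\<^sub>R y)) \<in> test_functions" by (rule test_function_affine[OF \<phi>]) simp
  have "(LINT y|lborel. f y *\<^sub>R grad (\<lambda>y. \<phi> (x + (-1) *\<^sub>R y)) y)
      = - (LINT y|lborel. \<phi> (x + (-1) *\<^sub>R y) *\<^sub>R g y)"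
    using w t unfolding has_weak_gradient_def by blast
  then show ?thesis
    unfolding grad_convolution[OF f \<phi>]
    by (simp add: grad_affine[OF test_function_smooth[OF \<phi>], of x "-1", simplified])
qed

lemma locally_integrable_const: "locally_integrable (\<lambda>x::'a::euclidean_space. c::real)"
  unfolding locally_integrable_def set_integrable_def
  by (intro allI impI borel_integrable_compact) auto

text \<open>The convolution of \<phi> with the constant 1 is a constant function, and its gradient
  is the integral of \<open>grad \<phi>\<close>.\<close>

lemma integral_partial_eq_0:
  assumes \<phi>: "\<phi> \<in> test_functions" and "b \<in> Basis"
  shows "(LINT x|lborel. grad \<phi> x \<bullet> b) = 0"
proof -
  have meas: "\<phi> \<in> borel_measurable borel"
    by (intro borel_measurable_continuous_onI smooth_continuous test_function_smooth \<phi>)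
  have measg: "grad \<phi> \<in> borel_measurable borel"
    by (intro borel_measurable_continuous_onI continuous_grad test_function_smooth \<phi>)
  have "convolution (\<lambda>x. 1) \<phi> = (\<lambda>x. LINT y|lborel. \<phi> y)"
    unfolding convolution_def using integral_reflect_lborel[of \<phi>] meas by simp
  then have "grad (convolution (\<lambda>x. 1) \<phi>) 0 = 0"
    by (intro grad_eqI) simp
  then have "(LINT y|lborel. grad \<phi> (0 - y)) = 0"
    using grad_convolution[OF locally_integrable_const[of 1] \<phi>, of 0] by simp
  then have *: "(LINT y|lborel. grad \<phi> y) = 0"
    using integral_reflect_lborel[of "grad \<phi>" 0] measg by simp
  have "integrable lborel (\<lambda>y. 1 *\<^sub>R grad \<phi> y)"
  proof -
    obtain R where R: "\<And>x. norm x > R \<Longrightarrow> \<phi> x = 0" using test_function_support[OF \<phi>] by blast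
    show ?thesis
      by (rule locally_integrable_scaleR_vector[OF locally_integrable_const, of _ R])
        (auto intro: continuous_grad test_function_smooth \<phi> grad_eq_0_outside[of R \<phi>] R)
  qed
  then show ?thesis using integral_inner_left[of b lborel "grad \<phi>"] * by simp
qed

subsection \<open>Mollification\<close>

lemma integrable_indicator_cball:
  "integrable lborel (indicator (cball (z::'a::euclidean_space) r) :: 'a \<Rightarrow> real)"
  by (intro integrable_real_indicator) (use emeasure_lborel_cball_finite[of z r] in \<open>simp_all\<close>)

text \<open>Clamping the values and cutting off at infinity costs little in L1 and yields a bounded
  function of bounded support. Applied to continuous functions that converge to \<open>f\<close>
  almost everywhere, the same two operations provide the dominating function.\<close>

lemma integrable_continuous_approx:
  fixes f :: "'a::euclidean_space \<Rightarrow> real"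
  assumes f: "integrable lborel f" and "e > 0"
  obtains g R where "continuous_on UNIV g" "\<And>x. norm x > R \<Longrightarrow> g x = 0"
    "(LINT x|lborel. \<bar>f x - g x\<bar>) < e"
proof -
  define cl where "cl = (\<lambda>(j::nat) t::real. max (- real j) (min (real j) t))"
  define co where "co = (\<lambda>(j::nat) x::'a. max 0 (min 1 (real j + 1 - norm x)))"
  have cl_cont: "continuous_on UNIV (cl j)" for j unfolding cl_def by (intro continuous_intros)
  have co_cont: "continuous_on UNIV (co j)" for j unfolding co_def by (intro continuous_intros)
  have cl_le: "\<bar>cl j t\<bar> \<le> real j" "\<bar>cl j t\<bar> \<le> \<bar>t\<bar>" for j t unfolding cl_def by auto
  have co_le: "0 \<le> co j x" "co j x \<le> 1" for j x unfolding co_def by auto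
  have co_out: "co j x = 0" if "\<not> norm x \<le> real j + 1" for j x using that unfolding co_def by auto
  have [measurable]: "f \<in> borel_measurable borel" using f by auto
  have [measurable]: "cl j \<in> borel_measurable borel" "co j \<in> borel_measurable borel" for j
    using cl_cont co_cont by (auto intro: borel_measurable_continuous_onI)
  have "(\<lambda>j. LINT x|lborel. \<bar>f x - cl j (f x) * co j x\<bar>) \<longlonglongrightarrow> (LINT x|(lborel::'a measure). 0)"
  proof (rule integral_dominated_convergence)
    show "integrable lborel (\<lambda>x. 2 * \<bar>f x\<bar>)" using f by simp
    show "AE x in lborel. (\<lambda>j. \<bar>f x - cl j (f x) * co j x\<bar>) \<longlonglongrightarrow> 0"
    proof (rule AE_I2)
      fix x
      have "eventually (\<lambda>j. \<bar>f x - cl j (f x) * co j x\<bar> = 0) sequentially"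
        using eventually_ge_at_top[of "nat \<lceil>max \<bar>f x\<bar> (norm x)\<rceil>"]
        by eventually_elim (auto simp: cl_def co_def nat_ceiling_le_eq)
      then show "(\<lambda>j. \<bar>f x - cl j (f x) * co j x\<bar>) \<longlonglongrightarrow> 0" by (rule tendsto_eventually)
    qed
    show "AE x in lborel. norm \<bar>f x - cl j (f x) * co j x\<bar> \<le> 2 * \<bar>f x\<bar>" for j
    proof (rule AE_I2)
      fix x
      have "\<bar>cl j (f x) * co j x\<bar> \<le> \<bar>f x\<bar> * 1"
        unfolding abs_mult using cl_le co_le[of j x] by (intro mult_mono) auto
      then show "norm \<bar>f x - cl j (f x) * co j x\<bar> \<le> 2 * \<bar>f x\<bar>" by simp
    qed
  qed auto
  then have "eventually (\<lambda>j. (LINT x|lborel. \<bar>f x - cl j (f x) * co j x\<bar>) < e / 2) sequentially"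
    using \<open>e > 0\<close> by (intro order_tendstoD(2)[of _ 0]) auto
  then obtain j where j: "(LINT x|lborel. \<bar>f x - cl j (f x) * co j x\<bar>) < e / 2"
    by (meson eventually_sequentially order_refl)
  \<comment> \<open>Lebesgue measurability of \<open>f\<close> provides continuous functions
    converging to it off a negligible set.\<close>
  have "f \<in> borel_measurable (lebesgue_on UNIV)" 
    by (intro measurable_restrict_space1 measurable_completion) simp
  then have "f measurable_on UNIV" by (simp add: measurable_on_iff_borel_measurable)
  then obtain N g where N: "negligible N" and g: "\<And>n. continuous_on UNIV (g n)"
    "\<And>x. x \<notin> N \<Longrightarrow> (\<lambda>n. g n x) \<longlonglongrightarrow> f x"
    unfolding measurable_on_def by auto
  have [measurable]: "g n \<in> borel_measurable borel" for n using g(1) by (intro borel_measurable_continuous_onI)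
  have AE: "AE x in lborel. x \<notin> N"
    using N by (metis AE_not_in AE_completion_iff negligible_iff_null_sets)
  have intco: "integrable lborel (\<lambda>x::'a. indicator (cball 0 (real j + 1)) x * (2 * real j))"
    by (rule integrable_mult_left[OF integrable_indicator_cball])
  have "(\<lambda>n. LINT x|lborel. \<bar>cl j (f x) * co j x - cl j (g n x) * co j x\<bar>) \<longlonglongrightarrow> (LINT x|(lborel::'a measure). 0)"
  proof (rule integral_dominated_convergence[OF _ _ intco])
    show "AE x in lborel. (\<lambda>n. \<bar>cl j (f x) * co j x - cl j (g n x) * co j x\<bar>) \<longlonglongrightarrow> 0"
      using AE
    proof eventually_elim
      case (elim x)
      have "(\<lambda>n. cl j (g n x)) \<longlonglongrightarrow> cl j (f x)"
        using g(2)[OF elim] cl_cont[of j] continuous_on_tendsto_compose[of UNIV "cl j"] by auto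
      then have "(\<lambda>n. \<bar>cl j (f x) * co j x - cl j (g n x) * co j x\<bar>) \<longlonglongrightarrow> \<bar>cl j (f x) * co j x - cl j (f x) * co j x\<bar>"
        by (intro tendsto_intros)
      then show ?case by simp
    qed
    show "AE x in lborel. norm \<bar>cl j (f x) * co j x - cl j (g n x) * co j x\<bar>
        \<le> indicator (cball 0 (real j + 1)) x * (2 * real j)" for n
    proof (rule AE_I2)
      fix x
      have "\<bar>cl j (f x) - cl j (g n x)\<bar> * co j x \<le> (2 * real j) * co j x"
        using co_le[of j x] cl_le(1)[of j "f x"] cl_le(1)[of j "g n x"] by (intro mult_right_mono) auto
      also have "\<dots> \<le> indicator (cball 0 (real j + 1)) x * (2 * real j)"
        using mult_left_mono[OF co_le(2)[of j x], of "2 * real j"] co_out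
        by (cases "norm x \<le> real j + 1") auto
      finally show "norm \<bar>cl j (f x) * co j x - cl j (g n x) * co j x\<bar>
        \<le> indicator (cball 0 (real j + 1)) x * (2 * real j)"
        using co_le[of j x] by (simp add: abs_mult flip: left_diff_distrib)
    qed
  qed auto
  then have "eventually (\<lambda>n. (LINT x|lborel. \<bar>cl j (f x) * co j x - cl j (g n x) * co j x\<bar>) < e / 2) sequentially"
    using \<open>e > 0\<close> by (intro order_tendstoD(2)[of _ 0]) auto
  then obtain n where n: "(LINT x|lborel. \<bar>cl j (f x) * co j x - cl j (g n x) * co j x\<bar>) < e / 2"
    by (meson eventually_sequentially order_refl)
  have bd: "integrable lborel (\<lambda>x. cl j (h x) * co j x)" if [measurable]: "h \<in> borel_measurable borel" for h
  proof (rule Bochner_Integration.integrable_bound[OF intco])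
    show "AE x in lborel. norm (cl j (h x) * co j x) \<le> norm (indicator (cball 0 (real j + 1)) x * (2 * real j))"
    proof (rule AE_I2)
      fix x
      have "\<bar>cl j (h x)\<bar> * co j x \<le> (2 * real j) * co j x"
        using co_le[of j x] cl_le(1)[of j "h x"] by (intro mult_right_mono) auto
      also have "\<dots> \<le> indicator (cball 0 (real j + 1)) x * (2 * real j)"
        using mult_left_mono[OF co_le(2)[of j x], of "2 * real j"] co_out
        by (cases "norm x \<le> real j + 1") auto
      finally show "norm (cl j (h x) * co j x) \<le> norm (indicator (cball 0 (real j + 1)) x * (2 * real j))"
        using co_le[of j x] by (simp add: abs_mult)
    qed
  qed simp
  show ?thesis
  proof (rule that[of "\<lambda>x. cl j (g n x) * co j x" "real j + 1"])
    show "continuous_on UNIV (\<lambda>x. cl j (g n x) * co j x)"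
      by (intro continuous_intros co_cont continuous_on_compose2[OF cl_cont g(1)]) auto
    show "cl j (g n x) * co j x = 0" if "real j + 1 < norm x" for x using that by (simp add: co_def)
    have "(LINT x|lborel. \<bar>f x - cl j (g n x) * co j x\<bar>) \<le>
        (LINT x|lborel. \<bar>f x - cl j (f x) * co j x\<bar> + \<bar>cl j (f x) * co j x - cl j (g n x) * co j x\<bar>)"
      by (intro integral_mono Bochner_Integration.integrable_add integrable_abs Bochner_Integration.integrable_diff f bd) auto
    also have "\<dots> = (LINT x|lborel. \<bar>f x - cl j (f x) * co j x\<bar>) + (LINT x|lborel. \<bar>cl j (f x) * co j x - cl j (g n x) * co j x\<bar>)"
      by (intro Bochner_Integration.integral_add integrable_abs Bochner_Integration.integrable_diff f bd) auto
    also have "\<dots> < e" using j n by simp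
    finally show "(LINT x|lborel. \<bar>f x - cl j (g n x) * co j x\<bar>) < e" .
  qed
qed

lemma integrable_locally_integrable:
  "integrable lborel f \<Longrightarrow> locally_integrable f"
  unfolding locally_integrable_def set_integrable_def
  by (auto intro!: integrable_mult_indicator compact_imp_closed borel_closed)

text \<open>Tonelli and translation invariance. The contraction lets L1 convergence be checked on
  the dense class of continuous functions of compact support.\<close>

lemma nn_integral_convolution_le:
  assumes f: "integrable lborel f" and \<rho>: "\<rho> \<in> test_functions" "\<And>x. \<rho> x \<ge> 0" "(\<integral>\<^sup>+x. ennreal (\<rho> x) \<partial>lborel) = 1"
  shows "(\<integral>\<^sup>+x. ennreal \<bar>convolution f \<rho> x\<bar> \<partial>lborel) \<le> (\<integral>\<^sup>+x. ennreal \<bar>f x\<bar> \<partial>lborel)"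
proof -
  have [measurable]: "f \<in> borel_measurable borel" using f by auto
  have [measurable]: "\<rho> \<in> borel_measurable borel"
    by (intro borel_measurable_continuous_onI smooth_continuous test_function_smooth \<rho>)
  have "(\<integral>\<^sup>+x. ennreal \<bar>convolution f \<rho> x\<bar> \<partial>lborel) \<le> (\<integral>\<^sup>+x. (\<integral>\<^sup>+y. ennreal (\<bar>f y\<bar> * \<rho> (x - y)) \<partial>lborel) \<partial>lborel)"
  proof (rule nn_integral_mono)
    fix x
    have "ennreal \<bar>convolution f \<rho> x\<bar> \<le> (\<integral>\<^sup>+y. ennreal (norm (f y * \<rho> (x - y))) \<partial>lborel)"
      unfolding convolution_def
      using integral_norm_bound_ennreal[OF convolution_integrable[OF integrable_locally_integrable[OF f] \<rho>(1), of x]] by simp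
    then show "ennreal \<bar>convolution f \<rho> x\<bar> \<le> (\<integral>\<^sup>+y. ennreal (\<bar>f y\<bar> * \<rho> (x - y)) \<partial>lborel)"
      using \<rho>(2) by (simp add: abs_mult)
  qed
  also have "\<dots> = (\<integral>\<^sup>+y. (\<integral>\<^sup>+x. ennreal (\<bar>f y\<bar> * \<rho> (x - y)) \<partial>lborel) \<partial>lborel)"
    by (rule lborel_pair.Fubini') measurable
  also have "\<dots> = (\<integral>\<^sup>+y. ennreal \<bar>f y\<bar> * (\<integral>\<^sup>+x. ennreal (\<rho> (x - y)) \<partial>lborel) \<partial>lborel)"
    by (intro nn_integral_cong) (simp add: ennreal_mult \<rho>(2) nn_integral_cmult)
  also have "\<dots> = (\<integral>\<^sup>+y. ennreal \<bar>f y\<bar> \<partial>lborel)"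
  proof (intro nn_integral_cong)
    fix y :: 'a
    have "(\<integral>\<^sup>+x. ennreal (\<rho> (x - y)) \<partial>lborel) = (\<integral>\<^sup>+x. ennreal (\<rho> ((0 - x) - y)) \<partial>lborel)"
      using nn_integral_reflect_lborel[of "\<lambda>x. ennreal (\<rho> (x - y))" 0] by simp
    also have "\<dots> = (\<integral>\<^sup>+x. ennreal (\<rho> ((- y) - x)) \<partial>lborel)" by (simp add: minus_diff_commute)
    also have "\<dots> = 1" using nn_integral_reflect_lborel[of "\<lambda>x. ennreal (\<rho> x)" "- y"] \<rho>(3) by simp
    finally show "ennreal \<bar>f y\<bar> * (\<integral>\<^sup>+x. ennreal (\<rho> (x - y)) \<partial>lborel) = ennreal \<bar>f y\<bar>" by simp
  qed
  finally show ?thesis .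
qed

section \<open>Mollifiers of mass one\<close>

definition bump_mass :: "'a::euclidean_space itself \<Rightarrow> nat \<Rightarrow> real" where
  "bump_mass _ k = (LINT x|lborel. bump (real (Suc k) *\<^sub>R (x :: 'a)))"

definition mollifier :: "nat \<Rightarrow> 'a::euclidean_space \<Rightarrow> real" where
  "mollifier k x = bump (real (Suc k) *\<^sub>R x) / bump_mass TYPE('a) k"

lemma bump_scaled_test: "(\<lambda>x. bump (real (Suc k) *\<^sub>R x)) \<in> test_functions"
  using test_function_affine[OF bump_test_function, of "real (Suc k)" 0] by simp

lemma test_function_integrable: "\<phi> \<in> test_functions \<Longrightarrow> integrable lborel \<phi>"
  using convolution_integrable[OF locally_integrable_const[of 1] test_function_affine[of \<phi> "-1" 0], of 0] by simp

lemma bump_mass_pos: "bump_mass TYPE('a::euclidean_space) k > 0"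
proof -
  let ?b = "\<lambda>x::'a. bump (real (Suc k) *\<^sub>R x)"
  have int: "integrable lborel ?b" by (rule test_function_integrable[OF bump_scaled_test])
  have "bump_mass TYPE('a) k \<noteq> 0"
  proof
    assume "bump_mass TYPE('a) k = 0"
    then have "AE x in lborel. ?b x = 0"
      using integral_nonneg_eq_0_iff_AE[OF int] bump_nonneg by (auto simp: bump_mass_def)
    moreover have "?b x > 0" if "x \<in> ball 0 (1 / real (Suc k))" for x
      using that by (intro bump_pos) (simp add: field_simps del: of_nat_Suc)
    ultimately have "AE x in lborel. x \<notin> ball (0::'a) (1 / real (Suc k))"
      by (auto elim!: eventually_mono) (metis less_irrefl)
    then have "emeasure lborel (ball (0::'a) (1 / real (Suc k))) = 0"
      by (subst (asm) AE_iff_null_sets[symmetric]) auto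
    moreover have "unit_ball_vol (real DIM('a)) * (1 / real (Suc k)) ^ DIM('a) > 0"
      by (intro mult_pos_pos unit_ball_vol_pos zero_less_power) auto
    ultimately show False by (simp add: emeasure_ball ennreal_eq_0_iff del: of_nat_Suc)
  qed
  moreover have "bump_mass TYPE('a) k \<ge> 0" unfolding bump_mass_def by (simp add: bump_nonneg)
  ultimately show ?thesis by simp
qed

lemma mollifier_test: "mollifier k \<in> test_functions"
  using test_functions_mult[OF smooth_const bump_scaled_test, of "1 / bump_mass TYPE('a) k"]
  by (simp add: mollifier_def[abs_def])

lemma mollifier_nonneg: "mollifier k x \<ge> 0"
  using bump_mass_pos[where 'a='a] by (simp add: mollifier_def bump_nonneg less_imp_le)

lemma mollifier_support: "norm x \<ge> 1 / real (Suc k) \<Longrightarrow> mollifier k x = 0"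
  by (simp add: mollifier_def bump_eq_0 field_simps del: of_nat_Suc)

lemma mollifier_integral: "(LINT x|lborel. mollifier k (x::'a::euclidean_space)) = 1"
  using bump_mass_pos[where 'a='a, of k] by (simp add: mollifier_def bump_mass_def)

lemma mollifier_measurable [measurable]: "mollifier k \<in> borel_measurable borel"
  by (intro borel_measurable_continuous_onI smooth_continuous test_function_smooth mollifier_test)

lemma mollifier_integral_shift: "(LINT y|lborel. mollifier k (x - y)) = 1"
  using integral_reflect_lborel[of "mollifier k" x] by (simp add: mollifier_integral)

lemma mollifier_integrable_shift: "integrable lborel (\<lambda>y. mollifier k (x - y))"
  using convolution_integrable[OF locally_integrable_const[of 1] mollifier_test, of k x] by simp

lemma mollifier_nn_integral: "(\<integral>\<^sup>+x. ennreal (mollifier k x) \<partial>lborel) = 1"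
  by (subst nn_integral_eq_integral)
    (auto simp: mollifier_integral mollifier_nonneg test_function_integrable[OF mollifier_test])

lemma convolution_continuous_approx:
  fixes g :: "'a::euclidean_space \<Rightarrow> real"
  assumes g: "continuous_on UNIV g" "\<And>x. norm x > R \<Longrightarrow> g x = 0"
  shows "(\<lambda>k. LINT x|lborel. \<bar>convolution g (mollifier k) x - g x\<bar>) \<longlonglongrightarrow> 0"
proof (rule LIMSEQ_I)
  fix e :: real assume "e > 0"
  have lg: "locally_integrable g"
    unfolding locally_integrable_def set_integrable_def
    by (intro allI impI borel_integrable_compact continuous_on_subset[OF g(1)]) auto
  define V where "V = measure lborel (cball (0::'a) (R + 1))"
  have V: "V \<ge> 0" unfolding V_def by simp
  define e1 where "e1 = e / (V + 1) / 2"
  have e1: "e1 > 0" "e1 * V < e"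
  proof -
    show "e1 > 0" using \<open>e > 0\<close> V by (simp add: e1_def)
    have "e1 * V \<le> e / 2" using V \<open>e > 0\<close> by (simp add: e1_def field_simps)
    then show "e1 * V < e" using \<open>e > 0\<close> by simp
  qed
  obtain d where d: "d > 0" "\<And>x y. norm (x - y) < d \<Longrightarrow> norm (g x - g y) < e1"
    using uniform_compact_support[OF g e1(1)] by metis
  obtain k0 where k0: "1 / real (Suc k0) < d" using d(1) by (metis nat_approx_posE)
  show "\<exists>k0. \<forall>k\<ge>k0. norm ((LINT x|lborel. \<bar>convolution g (mollifier k) x - g x\<bar>) - 0) < e"
  proof (intro exI allI impI)
    fix k assume k: "k \<ge> k0"
    have kd: "1 / real (Suc k) < d"
      using k k0 by (smt (verit) frac_le of_nat_0_less_iff of_nat_mono Suc_le_mono zero_less_Suc)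
    have pt: "\<bar>convolution g (mollifier k) x - g x\<bar> \<le> indicator (cball 0 (R + 1)) x * e1" for x
    proof -
      have i1: "integrable lborel (\<lambda>y. g y * mollifier k (x - y))"
        by (rule convolution_integrable[OF lg mollifier_test])
      have i2: "integrable lborel (\<lambda>y. g x * mollifier k (x - y))"
        by (intro integrable_mult_right mollifier_integrable_shift)
      have "convolution g (mollifier k) x - g x = (LINT y|lborel. g y * mollifier k (x - y) - g x * mollifier k (x - y))"
        using i1 i2 by (simp add: convolution_def mollifier_integral_shift)
      also have "norm \<dots> \<le> (LINT y|lborel. indicator (cball 0 (R + 1)) x * e1 * mollifier k (x - y))"
      proof (rule Bochner_Integration.integral_norm_bound_integral)
        show "integrable lborel (\<lambda>y. indicator (cball 0 (R + 1)) x * e1 * mollifier k (x - y))"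
          by (intro integrable_mult_right mollifier_integrable_shift)
        fix y
        show "norm (g y * mollifier k (x - y) - g x * mollifier k (x - y)) \<le> indicator (cball 0 (R + 1)) x * e1 * mollifier k (x - y)"
        proof (cases "norm (x - y) < 1 / real (Suc k)")
          case True
          have "\<bar>g y - g x\<bar> \<le> indicator (cball 0 (R + 1)) x * e1"
          proof (cases "norm x \<le> R + 1")
            case True
            then show ?thesis using d(2)[of y x] \<open>norm (x - y) < 1 / real (Suc k)\<close> kd
              by (simp add: norm_minus_commute)
          next
            case False
            have "1 / real (Suc k) \<le> 1" by simp
            then have "norm (x - y) < 1" using True by linarith
            then have "norm y > R" using False norm_triangle_ineq2[of x y] by linarith
            then show ?thesis using False g(2) by simp
          qed
          then have "\<bar>g y - g x\<bar> * mollifier k (x - y) \<le> indicator (cball 0 (R + 1)) x * e1 * mollifier k (x - y)"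
            by (rule mult_right_mono) (rule mollifier_nonneg)
          then show ?thesis using mollifier_nonneg[of k "x - y"] by (simp add: abs_mult flip: left_diff_distrib)
        qed (simp add: mollifier_support)
      qed (use i1 i2 in simp)
      also have "\<dots> = indicator (cball 0 (R + 1)) x * e1" by (simp add: mollifier_integral_shift)
      finally show ?thesis by simp
    qed
    have "(LINT x|lborel. \<bar>convolution g (mollifier k) x - g x\<bar>) \<le> (LINT x|lborel. indicator (cball (0::'a) (R + 1)) x * e1)"
      by (rule integral_mono'[OF integrable_mult_left[OF integrable_indicator_cball] pt]) (use e1 in auto)
    also have "\<dots> = e1 * V" by (simp add: V_def)
    also have "\<dots> < e" by (rule e1(2))
    finally show "norm ((LINT x|lborel. \<bar>convolution g (mollifier k) x - g x\<bar>) - 0) < e" by simp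
  qed
qed

lemma convolution_measurable:
  "locally_integrable f \<Longrightarrow> \<phi> \<in> test_functions \<Longrightarrow> convolution f \<phi> \<in> borel_measurable borel"
  by (intro borel_measurable_continuous_onI smooth_continuous smooth_convolution)

lemma convolution_integrable_lborel:
  fixes f :: "'a::euclidean_space \<Rightarrow> real"
  assumes "integrable lborel f"
  shows "integrable lborel (convolution f (mollifier k))"
    and "(LINT x|lborel. \<bar>convolution f (mollifier k) x\<bar>) \<le> (LINT x|lborel. \<bar>f x\<bar>)"
proof -
  note le = nn_integral_convolution_le[OF assms mollifier_test mollifier_nonneg mollifier_nn_integral, of k]
  have fin: "(\<integral>\<^sup>+x. ennreal \<bar>f x\<bar> \<partial>lborel) < \<infinity>" using assms by (simp add: integrable_iff_bounded)
  show 1: "integrable lborel (convolution f (mollifier k))"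
    unfolding integrable_iff_bounded
    using convolution_measurable[OF integrable_locally_integrable[OF assms] mollifier_test] le fin
    by (auto intro: le_less_trans)
  show "(LINT x|lborel. \<bar>convolution f (mollifier k) x\<bar>) \<le> (LINT x|lborel. \<bar>f x\<bar>)"
    using le assms 1 by (simp add: nn_integral_eq_integral)
qed

lemma convolution_L1_approx:
  fixes f :: "'a::euclidean_space \<Rightarrow> real"
  assumes f: "integrable lborel f"
  shows "(\<lambda>k. LINT x|lborel. \<bar>convolution f (mollifier k) x - f x\<bar>) \<longlonglongrightarrow> 0"
proof (rule LIMSEQ_I)
  fix e :: real assume "e > 0"
  obtain g R where g: "continuous_on UNIV g" "\<And>x. norm x > R \<Longrightarrow> g x = 0" "(LINT x|lborel. \<bar>f x - g x\<bar>) < e / 3"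
    using integrable_continuous_approx[OF f, of "e / 3"] \<open>e > 0\<close> by (metis divide_pos_pos zero_less_numeral)
  have ig: "integrable lborel g"
    using locally_integrable_mult[OF locally_integrable_const[of 1] g(1,2)] by simp
  have ifg: "integrable lborel (\<lambda>x. f x - g x)" using f ig by simp
  obtain k0 where k0: "\<And>k. k \<ge> k0 \<Longrightarrow> (LINT x|lborel. \<bar>convolution g (mollifier k) x - g x\<bar>) < e / 3"
    using LIMSEQ_D[OF convolution_continuous_approx[OF g(1,2)], where r="e / 3"] \<open>e > 0\<close>
    by (auto simp: abs_less_iff)
  show "\<exists>k0. \<forall>k\<ge>k0. norm ((LINT x|lborel. \<bar>convolution f (mollifier k) x - f x\<bar>) - 0) < e"
  proof (intro exI allI impI)
    fix k assume "k \<ge> k0"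
    have eq: "convolution f (mollifier k) x = convolution (\<lambda>x. f x - g x) (mollifier k) x + convolution g (mollifier k) x" for x
      unfolding convolution_def left_diff_distrib
      using convolution_integrable[OF integrable_locally_integrable[OF f] mollifier_test, of k x]
        convolution_integrable[OF integrable_locally_integrable[OF ig] mollifier_test, of k x]
      by simp
    note ints = convolution_integrable_lborel(1)[OF ifg, of k] convolution_integrable_lborel(1)[OF ig, of k]
      convolution_integrable_lborel(1)[OF f, of k]
    have "(LINT x|lborel. \<bar>convolution f (mollifier k) x - f x\<bar>) \<le>
       (LINT x|lborel. \<bar>convolution (\<lambda>x. f x - g x) (mollifier k) x\<bar> + \<bar>convolution g (mollifier k) x - g x\<bar> + \<bar>f x - g x\<bar>)"
      by (intro integral_mono Bochner_Integration.integrable_add integrable_abs Bochner_Integration.integrable_diff ints ifg f ig)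
        (use eq in auto)
    also have "\<dots> = (LINT x|lborel. \<bar>convolution (\<lambda>x. f x - g x) (mollifier k) x\<bar>) +
        (LINT x|lborel. \<bar>convolution g (mollifier k) x - g x\<bar>) + (LINT x|lborel. \<bar>f x - g x\<bar>)"
      using ints ifg ig by simp
    also have "\<dots> < e / 3 + e / 3 + e / 3"
      using convolution_integrable_lborel(2)[OF ifg, of k] g(3) k0[OF \<open>k \<ge> k0\<close>] by linarith
    finally show "norm ((LINT x|lborel. \<bar>convolution f (mollifier k) x - f x\<bar>) - 0) < e" by simp
  qed
qed

lemma convolution_local_approx:
  fixes f :: "'a::euclidean_space \<Rightarrow> real"
  assumes f: "locally_integrable f"
  shows "(\<lambda>k. LINT x|lborel. indicator (cball 0 R) x * \<bar>convolution f (mollifier k) x - f x\<bar>) \<longlonglongrightarrow> 0"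
proof -
  \<comment> \<open>The kernel lives in the unit ball, so on \<open>cball 0 R\<close> the
    convolution sees \<open>f\<close> only in \<open>cball 0 (R + 1)\<close>.\<close>
  define f1 where "f1 = (\<lambda>x. indicator (cball 0 (R + 1)) x * f x)"
  have f1: "integrable lborel f1"
    using f unfolding locally_integrable_def set_integrable_def f1_def by auto
  have eq: "convolution f (mollifier k) x = convolution f1 (mollifier k) x" if "norm x \<le> R" for k x
    unfolding convolution_def
  proof (intro Bochner_Integration.integral_cong refl)
    fix y
    show "f y * mollifier k (x - y) = f1 y * mollifier k (x - y)"
    proof (cases "norm y \<le> R + 1")
      case False
      then have "norm (x - y) \<ge> 1" using that norm_triangle_ineq2[of y x] by (simp add: norm_minus_commute)
      moreover have "1 / real (Suc k) \<le> 1" by simp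
      ultimately have "mollifier k (x - y) = 0"
        by (intro mollifier_support) linarith
      then show ?thesis by simp
    qed (simp add: f1_def)
  qed
  show ?thesis
  proof (rule tendsto_sandwich[OF _ _ tendsto_const convolution_L1_approx[OF f1]])
    show "\<forall>\<^sub>F k in sequentially. 0 \<le> (LINT x|lborel. indicator (cball 0 R) x * \<bar>convolution f (mollifier k) x - f x\<bar>)"
      by (intro always_eventually allI Bochner_Integration.integral_nonneg) auto
    show "\<forall>\<^sub>F k in sequentially. (LINT x|lborel. indicator (cball 0 R) x * \<bar>convolution f (mollifier k) x - f x\<bar>)
        \<le> (LINT x|lborel. \<bar>convolution f1 (mollifier k) x - f1 x\<bar>)"
    proof (intro always_eventually allI integral_mono')
      show "integrable lborel (\<lambda>x. \<bar>convolution f1 (mollifier k) x - f1 x\<bar>)" for k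
        using convolution_integrable_lborel(1)[OF f1] f1 by simp
      show "indicator (cball 0 R) x * \<bar>convolution f (mollifier k) x - f x\<bar> \<le> \<bar>convolution f1 (mollifier k) x - f1 x\<bar>" for k x
        by (auto simp: indicator_def eq f1_def)
    qed auto
  qed
qed

text \<open>Jensen's inequality for the probability measure \<open>mollifier k (x - y) dy\<close>:
  the variance of \<open>f\<close> is nonnegative.\<close>

lemma convolution_square_le:
  assumes f: "locally_integrable f" and f2: "locally_integrable (\<lambda>x. (f x)\<^sup>2)"
  shows "(convolution f (mollifier k) x)\<^sup>2 \<le> convolution (\<lambda>x. (f x)\<^sup>2) (mollifier k) x"
proof -
  define a where "a = convolution f (mollifier k) x"
  note i = convolution_integrable[OF f mollifier_test, of k x] convolution_integrable[OF f2 mollifier_test, of k x]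
    mollifier_integrable_shift[of k x]
  have "0 \<le> (LINT y|lborel. (f y - a)\<^sup>2 * mollifier k (x - y))"
    by (intro Bochner_Integration.integral_nonneg) (simp add: mollifier_nonneg)
  also have "\<dots> = (LINT y|lborel. (f y)\<^sup>2 * mollifier k (x - y) - 2 * a * (f y * mollifier k (x - y)) + a\<^sup>2 * mollifier k (x - y))"
    by (simp add: power2_diff algebra_simps)
  also have "\<dots> = convolution (\<lambda>x. (f x)\<^sup>2) (mollifier k) x - 2 * a * a + a\<^sup>2"
    using i by (simp add: convolution_def a_def mollifier_integral_shift)
  finally show ?thesis by (simp add: a_def power2_eq_square)
qed

subsection \<open>Radial mass transport\<close>

definition primitive :: "(real \<Rightarrow> real) \<Rightarrow> real \<Rightarrow> real" where
  "primitive g t = integral {0..t} g"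

context
  fixes g :: "real \<Rightarrow> real"
  assumes cont: "continuous_on {0..} g"
begin

lemma primitive_integrable: "0 \<le> a \<Longrightarrow> g integrable_on {a..b}"
  by (intro integrable_continuous_real continuous_on_subset[OF cont]) auto

lemma primitive_has_derivative:
  assumes "t > 0" shows "(primitive g has_real_derivative g t) (at t)"
proof -
  have "(primitive g has_real_derivative g t) (at t within {0..t+1})"
    unfolding primitive_def[abs_def]
    by (rule integral_has_real_derivative) (use assms in \<open>auto intro: continuous_on_subset[OF cont]\<close>)
  moreover have "at t within {0..t+1} = at t"
    by (rule at_within_interior) (use assms in auto)
  ultimately show ?thesis by simp
qed

lemma primitive_continuous: "continuous_on {0..} (primitive g)"
proof -
  have "continuous (at t within {0..}) (primitive g)" if "t \<ge> 0" for t
  proof -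
    have "(primitive g has_real_derivative g t) (at t within {0..t+1})"
      unfolding primitive_def[abs_def]
      by (rule integral_has_real_derivative) (use that in \<open>auto intro: continuous_on_subset[OF cont]\<close>)
    then have "continuous (at t within {0..t+1}) (primitive g)"
      by (rule DERIV_continuous)
    moreover have "at t within {0..t+1} = at t within {0..}"
      by (rule at_within_nhd[of _ "{..<t+1}"]) auto
    ultimately show ?thesis by simp
  qed
  then show ?thesis by (simp add: continuous_on_eq_continuous_within)
qed

lemma primitive_diff: "0 \<le> a \<Longrightarrow> a \<le> b \<Longrightarrow> primitive g b - primitive g a = integral {a..b} g"
  unfolding primitive_def using Henstock_Kurzweil_Integration.integral_combine[of 0 a b g] primitive_integrable[of 0 b] by simp

lemma primitive_mono:
  assumes "\<And>x. x > 0 \<Longrightarrow> g x \<ge> 0" "0 \<le> a" "a \<le> b"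
  shows "primitive g a \<le> primitive g b"
proof (rule DERIV_nonneg_imp_increasing_open[OF assms(3)])
  show "\<exists>y. (primitive g has_real_derivative y) (at x) \<and> 0 \<le> y" if "a < x" "x < b" for x
    using primitive_has_derivative[of x] assms that by force
  show "continuous_on {a..b} (primitive g)" using assms(2) by (intro continuous_on_subset[OF primitive_continuous]) auto
qed

lemma primitive_strict_mono:
  assumes nn: "\<And>x. x > 0 \<Longrightarrow> g x \<ge> 0" and "0 \<le> a" "a < c" "c \<le> b" "g c > 0"
  shows "primitive g a < primitive g b"
proof -
  \<comment> \<open>The sign of \<open>g\<close> is assumed for positive arguments; at 0 it follows
    by continuity.\<close>
  have nn': "g x \<ge> 0" if "x \<in> {a..c}" for x
  proof (cases "x > 0")
    case False
    then have x: "x = 0" "a = 0" using that assms(2) by auto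
    have "(g \<longlongrightarrow> g 0) (at 0 within {0..})" using cont by (simp add: continuous_on_def)
    then have "(g \<longlongrightarrow> g 0) (at_right 0)" by (rule tendsto_within_subset) auto
    moreover have "eventually (\<lambda>x. g x \<ge> 0) (at_right 0)"
      using nn by (auto simp: eventually_at_right_field intro!: exI[of _ 1])
    ultimately have "g 0 \<ge> 0" by (intro tendsto_lowerbound) auto
    then show ?thesis using x by simp
  qed (use nn in auto)
  have "integral {a..c} g \<noteq> 0"
    using integral_eq_0_iff[of a c g] nn' assms continuous_on_subset[OF cont, of "{a..c}"] by auto
  then have "integral {a..c} g > 0"
    using Henstock_Kurzweil_Integration.integral_nonneg[OF primitive_integrable[of a c]] nn' assms(2) by force
  then show ?thesis
    using primitive_diff[of a c] primitive_mono[OF nn, of c b] assms by auto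
qed

end

lemma primitive_0 [simp]: "primitive g 0 = 0"
  by (simp add: primitive_def)

text \<open>Since \<open>p + 1 > 1\<close>, this differentiates
  \<open>\<bar>h\<bar> powr (p + 1)\<close> also where \<open>h\<close> changes sign.\<close>

lemma abs_powr_has_derivative:
  fixes x a :: real
  assumes "a > 1"
  shows "((\<lambda>x. \<bar>x\<bar> powr a) has_real_derivative (a * \<bar>x\<bar> powr (a - 1) * sgn x)) (at x)"
proof -
  consider "x > 0" | "x < 0" | "x = 0" by linarith
  then show ?thesis
  proof cases
    case 1
    have "((\<lambda>x. x powr a) has_real_derivative (a * \<bar>x\<bar> powr (a - 1) * sgn x)) (at x)"
      using has_real_derivative_powr[OF 1, of a] 1 by simp
    then show ?thesis
      by (rule has_field_derivative_transform_within_open[where S="{0<..}"]) (use 1 in auto)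
  next
    case 2
    have "((\<lambda>x. (- x) powr a) has_real_derivative (a * \<bar>x\<bar> powr (a - 1) * sgn x)) (at x)"
      using 2 by (auto intro!: derivative_eq_intros)
    then show ?thesis
      by (rule has_field_derivative_transform_within_open[where S="{..<0}"]) (use 2 in auto)
  next
    case 3
    have "((\<lambda>h::real. \<bar>h\<bar> powr (a - 1)) \<longlongrightarrow> \<bar>0\<bar> powr (a - 1)) (at 0)"
      by (intro tendsto_powr' tendsto_intros) (use assms in auto)
    then have "((\<lambda>h::real. \<bar>h\<bar> powr (a - 1)) \<longlongrightarrow> 0) (at 0)" by simp
    moreover have "eventually (\<lambda>h::real. norm (\<bar>h\<bar> powr a / h) \<le> norm (\<bar>h\<bar> powr (a - 1)) * 1) (at 0)"
      by (auto simp: eventually_at_filter powr_diff intro!: always_eventually)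
    ultimately have "((\<lambda>h::real. \<bar>h\<bar> powr a / h) \<longlongrightarrow> 0) (at 0)"
      by (rule tendsto_0_le)
    then show ?thesis using 3 assms by (simp add: DERIV_def)
  qed
qed

text \<open>The bound \<open>ln z \<le> z - 1\<close> is applied at x / S, y / S and 1 / S and
  averaged with the weights; the right sides cancel because S is the weighted mean of x, y and
  1.\<close>

lemma weighted_amgm3:
  fixes x y u v w :: real
  assumes "x > 0" "y > 0" "u \<ge> 0" "v \<ge> 0" "w > 0" "u + v + w = 1"
  shows "x powr u * y powr v \<le> u * x + v * y + w"
proof -
  define S where "S = u * x + v * y + w"
  have S: "S > 0" unfolding S_def using assms by (simp add: add_nonneg_pos)
  have "u * ln (x / S) \<le> u * (x / S - 1)" "v * ln (y / S) \<le> v * (y / S - 1)" "w * ln (1 / S) \<le> w * (1 / S - 1)"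
    using assms S by (auto intro!: mult_left_mono ln_le_minus_one)
  then have "u * ln (x / S) + v * ln (y / S) + w * ln (1 / S) \<le> (u * x + v * y + w) / S - (u + v + w)"
    by (simp add: algebra_simps add_divide_distrib)
  also have "\<dots> = 0" using S assms(6) by (simp add: S_def[symmetric])
  finally have "u * ln x + v * ln y \<le> (u + v + w) * ln S"
    using assms(1,2) S by (simp add: ln_div algebra_simps)
  then have "exp (u * ln x + v * ln y) \<le> exp (ln S)" using assms(6) by simp
  then show ?thesis using S assms by (simp add: powr_def exp_add S_def[symmetric])
qed

lemma continuous_on_powr_nonneg:
  "a > 0 \<Longrightarrow> continuous_on {0..} (\<lambda>z::real. z powr a)"
  by (intro continuous_on_powr' continuous_intros) auto

text \<open>In the application \<sigma> = 1 - \<gamma>/2 and \<alpha> = d - \<gamma>, so that n =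
  \<alpha>/\<sigma> is the dimension of the overview and \<nu> = n (1 - m). The radial measure with
  the weight is r^(\<alpha> - 1) dr; the one without it is r^(\<alpha> + 1 - 2 \<sigma>) dr, the
  exponent being d - 1.\<close>

locale radial_transport =
  fixes m \<sigma> \<alpha> C p \<nu> :: real
  assumes m: "1 / 2 < m" "m < 1" and \<sigma>: "0 < \<sigma>" "\<sigma> \<le> \<alpha>" and \<alpha>: "1 < \<alpha>" and dim: "2 * \<sigma> < \<alpha> + 1"
    and C: "0 < C"
    and p_def: "p = 1 / (2 * m - 1)" and \<nu>_def: "\<nu> = (1 - m) * \<alpha> / \<sigma>" and \<nu>: "\<nu> < 1"
begin

lemma p_facts: "p > 1" "p * (2 * m) = p + 1"
  using m by (auto simp: p_def field_simps)

text \<open>In the variable \<open>r powr \<sigma>\<close> and dimension n, the map T has the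
  derivative \<open>A1\<close> in the radial direction and \<open>A2\<close> in n - 1 tangential
  ones. The weights u = 1 - m and v = (1 - m) (n - 1) make \<open>A1 powr u * A2 powr v\<close> the
  power 1 - m of its Jacobian, which conservation of mass, the definition of T', evaluates. The
  arguments \<open>a\<close>, \<open>s\<close>, \<open>e\<close> stand for
  \<open>\<bar>h r\<bar>\<close>, \<open>sgn (h r)\<close>, \<open>h' r\<close>, and the last
  bracket is the derivative of \<open>a powr (p + 1) * r powr (\<alpha> - \<sigma>) * T powr
  \<sigma>\<close>.\<close>

lemma transport_pointwise:
  fixes r T a s e \<mu> :: real
  assumes r: "r > 0" and T: "T > 0" and a: "a \<ge> 0" and s: "\<bar>s\<bar> \<le> 1" and \<mu>: "\<mu> > 0"
  defines "f \<equiv> a powr (2 * p)"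
    and "B \<equiv> (C + T powr (2 * \<sigma>)) powr (1 / (m - 1))"
  defines "T' \<equiv> f * r powr (\<alpha> - 1) / (B * T powr (\<alpha> - 1))"
  shows "\<mu> powr \<nu> * (C + (1 - m) * T powr (2 * \<sigma>)) * (f * r powr (\<alpha> - 1))
    \<le> (1 - \<nu>) * (a powr (p + 1) * r powr (\<alpha> - 1))
      + m * (1 - m)\<^sup>2 / (\<sigma>\<^sup>2 * (2 * m - 1)\<^sup>2) * \<mu> powr (2 - \<nu>) * (e\<^sup>2 * r powr (\<alpha> + 1 - 2 * \<sigma>))
      + (1 - m) * \<mu> / \<sigma> * (((p + 1) * a powr p * s * e) * (r powr (\<alpha> - \<sigma>) * T powr \<sigma>)
          + a powr (p + 1) * ((\<alpha> - \<sigma>) * r powr (\<alpha> - \<sigma> - 1) * T powr \<sigma> + r powr (\<alpha> - \<sigma>) * (\<sigma> * T powr (\<sigma> - 1) * T')))"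
proof (cases "a = 0")
  case True
  have "m * (1 - m)\<^sup>2 / (\<sigma>\<^sup>2 * (2 * m - 1)\<^sup>2) * \<mu> powr (2 - \<nu>) * (e\<^sup>2 * r powr (\<alpha> + 1 - 2 * \<sigma>)) \<ge> 0"
    using m by (intro mult_nonneg_nonneg divide_nonneg_nonneg) auto
  then show ?thesis using True by (simp add: f_def)
next
  case False
  then have a: "a > 0" using a by simp
  \<comment> \<open>Every positive quantity is written as an exponential, so that identities between
    products of powers become linear identities between exponents.\<close>
  define c where "c = ln (C + T powr (2 * \<sigma>))"
  define la where "la = ln a"
  define lr where "lr = ln r"
  define lT where "lT = ln T"
  define l\<mu> where "l\<mu> = ln \<mu>"
  have ea: "a powr x = exp (x * la)" and er: "r powr x = exp (x * lr)" and eT: "T powr x = exp (x * lT)"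
    and e\<mu>: "\<mu> powr x = exp (x * l\<mu>)" for x
    using a r T \<mu> by (auto simp: powr_def la_def lr_def lT_def l\<mu>_def)
  have pos: "C + T powr (2 * \<sigma>) > 0" using C by (simp add: add_pos_nonneg)
  have ec: "C + T powr (2 * \<sigma>) = exp c" using pos by (simp add: c_def)
  have eB: "B = exp (c / (m - 1))" using pos by (simp add: B_def powr_def c_def)
  have eT': "T' = exp (2 * p * la + (\<alpha> - 1) * lr - c / (m - 1) - (\<alpha> - 1) * lT)"
    unfolding T'_def f_def ea er eT eB by (simp add: exp_add exp_diff)
  define A1 where "A1 = T' * exp ((\<sigma> - 1) * (lT - lr))"
  define A2 where "A2 = exp (\<sigma> * (lT - lr))"
  define u where "u = 1 - m"
  define v where "v = (1 - m) * (\<alpha> - \<sigma>) / \<sigma>"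
  have uv: "u \<ge> 0" "v \<ge> 0" "u + v = \<nu>"
    using m \<sigma> by (simp_all add: u_def v_def) (simp add: \<nu>_def field_simps)
  have "(\<mu> * A1) powr u * (\<mu> * A2) powr v \<le> u * (\<mu> * A1) + v * (\<mu> * A2) + (1 - \<nu>)"
    by (rule weighted_amgm3) (use uv \<nu> \<mu> in \<open>auto simp: A1_def A2_def eT'\<close>)
  moreover have "(\<mu> * A1) powr u * (\<mu> * A2) powr v = \<mu> powr \<nu> * exp (2 * p * la * (1 - m) + c)"
  proof -
    have "(\<mu> * A1) powr u * (\<mu> * A2) powr v = \<mu> powr (u + v) * (A1 powr u * A2 powr v)"
      using \<mu> by (simp add: powr_mult powr_add A1_def A2_def eT')
    moreover have "A1 powr u * A2 powr v = exp (2 * p * la * (1 - m) + c)"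
    proof -
      have v: "v * \<sigma> = (1 - m) * (\<alpha> - \<sigma>)" using \<sigma> by (simp add: v_def)
      have cm: "c / (m - 1) * (1 - m) = - c" using m by (simp add: field_simps)
      have "u * (2 * p * la + (\<alpha> - 1) * lr - c / (m - 1) - (\<alpha> - 1) * lT + (\<sigma> - 1) * (lT - lr)) + (v * \<sigma>) * (lT - lr)
          = 2 * p * la * (1 - m) - c / (m - 1) * (1 - m)"
        unfolding v u_def by (simp add: algebra_simps)
      also have "\<dots> = 2 * p * la * (1 - m) + c" unfolding cm by simp
      finally show ?thesis
        unfolding A1_def A2_def eT' by (simp add: powr_def exp_add[symmetric] mult.assoc)
    qed
    ultimately show ?thesis using uv by simp
  qed
  ultimately have i: "\<mu> powr \<nu> * exp (2 * p * la * (1 - m) + c) \<le> u * (\<mu> * A1) + v * (\<mu> * A2) + (1 - \<nu>)" by simp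
  \<comment> \<open>Multiplying by \<open>a powr (p + 1) * r powr (\<alpha> - 1)\<close> restores
    the mass density, because 2 p (1 - m) + p + 1 = 2 p.\<close>
  define W where "W = exp ((p + 1) * la + (\<alpha> - 1) * lr)"
  have pm: "2 * p * la * m = (p + 1) * la" using p_facts(2) by (metis mult.assoc mult.commute)
  have i': "\<mu> powr \<nu> * exp (2 * p * la * (1 - m) + c) * W \<le> (u * (\<mu> * A1) + v * (\<mu> * A2) + (1 - \<nu>)) * W"
    using i by (rule mult_right_mono) (simp add: W_def)
  have E1: "exp (2 * p * la * (1 - m) + c) * W = (C + T powr (2 * \<sigma>)) * (f * r powr (\<alpha> - 1))"
  proof -
    have "2 * p * la * (1 - m) + c + ((p + 1) * la + (\<alpha> - 1) * lr) = c + (2 * p * la + (\<alpha> - 1) * lr)"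
      unfolding pm[symmetric] by (simp add: algebra_simps)
    then show ?thesis unfolding W_def ec f_def ea er by (simp add: exp_add[symmetric])
  qed
  have E2: "v * A2 * W = (1 - m) / \<sigma> * (a powr (p + 1) * ((\<alpha> - \<sigma>) * r powr (\<alpha> - \<sigma> - 1) * T powr \<sigma>))"
  proof -
    have "A2 * W = exp ((p + 1) * la) * exp ((\<alpha> - \<sigma> - 1) * lr) * exp (\<sigma> * lT)"
      unfolding A2_def W_def by (simp add: exp_add[symmetric] algebra_simps)
    then show ?thesis unfolding v_def ea er eT by (simp add: mult_ac)
  qed
  have E3: "u * A1 * W = (1 - m) / \<sigma> * (a powr (p + 1) * (r powr (\<alpha> - \<sigma>) * (\<sigma> * T powr (\<sigma> - 1) * T')))"
  proof -
    have "exp ((\<sigma> - 1) * (lT - lr)) * W = exp ((p + 1) * la) * exp ((\<alpha> - \<sigma>) * lr) * exp ((\<sigma> - 1) * lT)"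
      unfolding W_def by (simp add: exp_add[symmetric] algebra_simps)
    then have "A1 * W = exp ((p + 1) * la) * exp ((\<alpha> - \<sigma>) * lr) * exp ((\<sigma> - 1) * lT) * T'"
      unfolding A1_def by (simp add: mult_ac)
    then show ?thesis unfolding u_def ea er eT using \<sigma> by (simp add: mult_ac)
  qed
  have E4: "(1 - \<nu>) * W = (1 - \<nu>) * (a powr (p + 1) * r powr (\<alpha> - 1))"
    by (simp add: W_def ea er exp_add)
  have ii: "\<mu> powr \<nu> * ((C + T powr (2 * \<sigma>)) * (f * r powr (\<alpha> - 1)))
    \<le> \<mu> * ((1 - m) / \<sigma> * (a powr (p + 1) * (r powr (\<alpha> - \<sigma>) * (\<sigma> * T powr (\<sigma> - 1) * T'))))
      + \<mu> * ((1 - m) / \<sigma> * (a powr (p + 1) * ((\<alpha> - \<sigma>) * r powr (\<alpha> - \<sigma> - 1) * T powr \<sigma>)))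
      + (1 - \<nu>) * (a powr (p + 1) * r powr (\<alpha> - 1))"
    unfolding E1[symmetric] E2[symmetric] E3[symmetric] E4[symmetric]
    using i' by (simp only: distrib_right distrib_left mult_ac)
  \<comment> \<open>Young's inequality for the term with the slope \<open>e\<close>. This \<kappa>
    gives the square of V exactly the factor \<open>m * \<mu> powr \<nu>\<close>, the share that
    turns C + T^(2 \<sigma>) into C + (1 - m) T^(2 \<sigma>).\<close>
  define \<kappa> where "\<kappa> = (1 - m) * \<mu> powr (1 - \<nu>) / (\<sigma> * (2 * m - 1))"
  have \<kappa>: "\<kappa> > 0" using m \<sigma> \<mu> by (simp add: \<kappa>_def)
  define U where "U = e * exp ((\<alpha> + 1 - 2 * \<sigma>) / 2 * lr)"
  define V where "V = exp (p * la + \<sigma> * lT + (\<alpha> - 1) / 2 * lr)"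
  have UV: "a powr p * e * (r powr (\<alpha> - \<sigma>) * T powr \<sigma>) = U * V"
  proof -
    have "(\<alpha> + 1 - 2 * \<sigma>) / 2 * lr + (p * la + \<sigma> * lT + (\<alpha> - 1) / 2 * lr)
        = p * la + ((\<alpha> - \<sigma>) * lr + \<sigma> * lT)"
      by (simp add: field_simps)
    then have "U * V = e * exp (p * la + ((\<alpha> - \<sigma>) * lr + \<sigma> * lT))"
      unfolding U_def V_def mult.assoc exp_add[symmetric] by simp
    then show ?thesis unfolding ea er eT by (simp add: exp_add mult_ac)
  qed
  have UU: "U\<^sup>2 = e\<^sup>2 * r powr (\<alpha> + 1 - 2 * \<sigma>)"
    unfolding U_def er power_mult_distrib by (simp add: exp_double[symmetric])
  have VV: "V\<^sup>2 = T powr (2 * \<sigma>) * (f * r powr (\<alpha> - 1))"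
  proof -
    have "2 * (p * la + \<sigma> * lT + (\<alpha> - 1) / 2 * lr) = 2 * \<sigma> * lT + (2 * p * la + (\<alpha> - 1) * lr)"
      by (simp add: field_simps)
    then show ?thesis unfolding V_def f_def ea er eT exp_double[symmetric] by (simp only: exp_add)
  qed
  have "0 \<le> (\<kappa> * U + s * V)\<^sup>2" by simp
  then have "- (2 * \<kappa> * (s * (U * V))) \<le> \<kappa>\<^sup>2 * U\<^sup>2 + s\<^sup>2 * V\<^sup>2" by (simp add: power2_eq_square algebra_simps)
  also have "s\<^sup>2 \<le> 1" using s by (simp add: abs_square_le_1)
  then have "s\<^sup>2 * V\<^sup>2 \<le> 1 * V\<^sup>2" by (intro mult_right_mono) auto
  finally have y1: "- (2 * \<kappa> * (s * (U * V))) \<le> \<kappa>\<^sup>2 * U\<^sup>2 + V\<^sup>2" by simp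
  define q where "q = (1 - m) * \<mu> / \<sigma> * (p + 1) / (2 * \<kappa>)"
  have q: "q = m * \<mu> powr \<nu>"
  proof -
    have pp: "p + 1 = 2 * m / (2 * m - 1)" using m by (simp add: p_def field_simps)
    have "\<mu> = \<mu> powr (1 - \<nu>) * \<mu> powr \<nu>" using \<mu> by (simp flip: powr_add)
    then have "q = (1 - m) * (\<mu> powr (1 - \<nu>) * \<mu> powr \<nu>) / \<sigma> * (2 * m / (2 * m - 1)) / (2 * \<kappa>)"
      unfolding q_def pp by simp
    also have "\<dots> = m * \<mu> powr \<nu>"
    proof -
      have "a * (P * Q) / s * (2 * m / y) / (2 * (a * P / (s * y))) = m * Q"
        if "a \<noteq> 0" "P \<noteq> 0" "s \<noteq> 0" "y \<noteq> 0" for a P Q s y :: real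
        using that by (simp add: field_simps)
      then show ?thesis unfolding \<kappa>_def using m \<sigma> \<mu> by simp
    qed
    finally show ?thesis .
  qed
  have q\<kappa>: "q * \<kappa>\<^sup>2 = m * (1 - m)\<^sup>2 / (\<sigma>\<^sup>2 * (2 * m - 1)\<^sup>2) * \<mu> powr (2 - \<nu>)"
  proof -
    have "\<mu> powr \<nu> * (\<mu> powr (1 - \<nu>))\<^sup>2 = \<mu> powr (2 - \<nu>)"
      using \<mu> by (simp add: power2_eq_square flip: powr_add)
    then show ?thesis unfolding q \<kappa>_def by (simp add: power_divide power_mult_distrib mult_ac)
  qed
  have "q * (- (2 * \<kappa> * (s * (U * V)))) \<le> q * (\<kappa>\<^sup>2 * U\<^sup>2 + V\<^sup>2)"
    using y1 by (rule mult_left_mono) (use q m in auto)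
  moreover have "q * (2 * \<kappa> * (s * (U * V))) = (1 - m) * \<mu> / \<sigma> * ((p + 1) * (s * (U * V)))"
    unfolding q_def using \<kappa> by simp
  ultimately have iii: "- ((1 - m) * \<mu> / \<sigma> * ((p + 1) * (s * (U * V)))) \<le> (q * \<kappa>\<^sup>2) * U\<^sup>2 + q * V\<^sup>2"
    by (simp add: algebra_simps)
  have iv: "(p + 1) * a powr p * s * e * (r powr (\<alpha> - \<sigma>) * T powr \<sigma>) = (p + 1) * (s * (U * V))"
    unfolding UV[symmetric] by (simp add: mult_ac)
  have sum: "mn * (C + (1 - m) * t) * F \<le> E + K + c * (Z + w * (X1 + X2))"
    if "mn * ((C + t) * F) \<le> c * (w * X2) + c * (w * X1) + E" "- (c * Z) \<le> K + m * mn * (t * F)"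
    for mn t F E K c Z w X1 X2 :: real
    using that by (simp add: algebra_simps)
  have c: "\<mu> * ((1 - m) / \<sigma> * x) = (1 - m) * \<mu> / \<sigma> * x" for x by simp
  have "(q * \<kappa>\<^sup>2) * U\<^sup>2 + q * V\<^sup>2 = m * (1 - m)\<^sup>2 / (\<sigma>\<^sup>2 * (2 * m - 1)\<^sup>2) * \<mu> powr (2 - \<nu>) * (e\<^sup>2 * r powr (\<alpha> + 1 - 2 * \<sigma>))
      + m * \<mu> powr \<nu> * (T powr (2 * \<sigma>) * (f * r powr (\<alpha> - 1)))"
    unfolding q\<kappa> UU VV unfolding q ..
  then show ?thesis
    unfolding iv by (intro sum ii[unfolded c]) (use iii in simp)
qed

section \<open>Mass and second moment of the profile on the half line\<close>

definition profile :: "real \<Rightarrow> real" where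
  "profile z = (C + z powr (2 * \<sigma>)) powr (1 / (m - 1))"

definition target :: "real \<Rightarrow> real" where
  "target z = profile z * z powr (\<alpha> - 1)"

lemma base_pos: "C + z powr (2 * \<sigma>) > 0"
  using C by (simp add: add_pos_nonneg)

lemma profile_pos: "profile z > 0"
  using base_pos[of z] by (simp add: profile_def)

lemma continuous_on_profile: "continuous_on {0..} profile"
  unfolding profile_def[abs_def]
  using base_pos \<sigma> by (intro continuous_on_powr continuous_intros continuous_on_powr_nonneg) (auto simp: less_imp_neq[symmetric])

lemma continuous_on_target: "continuous_on {0..} target"
  unfolding target_def[abs_def]
  using \<alpha> by (intro continuous_intros continuous_on_profile continuous_on_powr_nonneg) auto

lemma target_pos: "z > 0 \<Longrightarrow> target z > 0"
  using profile_pos by (simp add: target_def)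

definition weighted_target :: "real \<Rightarrow> real" where
  "weighted_target z = z powr (2 * \<sigma>) * target z"

text \<open>What remains of \<open>(C + z powr (2 * \<sigma>)) * target z\<close> after Young's
  inequality has spent the share \<open>m * z powr (2 * \<sigma>)\<close>.\<close>

definition action :: "real \<Rightarrow> real" where
  "action z = (C + (1 - m) * z powr (2 * \<sigma>)) * target z"

lemma continuous_on_weighted_target: "continuous_on {0..} weighted_target"
  unfolding weighted_target_def[abs_def]
  using \<sigma> by (intro continuous_intros continuous_on_target continuous_on_powr_nonneg) auto

lemma continuous_on_action: "continuous_on {0..} action"
  unfolding action_def[abs_def]
  using \<sigma> by (intro continuous_intros continuous_on_target continuous_on_powr_nonneg) auto

lemma action_nonneg: "z > 0 \<Longrightarrow> action z \<ge> 0"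
  unfolding action_def using C m target_pos[of z] by (intro mult_nonneg_nonneg add_nonneg_nonneg) auto

lemma primitive_action:
  assumes "t \<ge> 0"
  shows "primitive action t = C * primitive target t + (1 - m) * primitive weighted_target t"
proof -
  have "action = (\<lambda>z. C * target z + (1 - m) * weighted_target z)"
    by (auto simp: action_def weighted_target_def algebra_simps)
  moreover have "(\<lambda>z. C * target z) integrable_on {0..t}"
    by (intro primitive_integrable continuous_on_mult_left continuous_on_target order_refl)
  moreover have "(\<lambda>z. (1 - m) * weighted_target z) integrable_on {0..t}"
    by (intro primitive_integrable continuous_on_mult_left continuous_on_weighted_target order_refl)
  ultimately show ?thesis
    unfolding primitive_def by (simp add: Henstock_Kurzweil_Integration.integral_add)
qed

text \<open>The decay exponent of \<open>z powr \<alpha> * profile z powr m\<close> at infinity. Its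
  positivity makes the second moment finite and removes the boundary term there.\<close>

definition moment_gap :: real where
  "moment_gap = 2 * \<sigma> * m / (1 - m) - \<alpha>"

lemma moment_gap_pos: "moment_gap > 0"
proof -
  have "\<alpha> * (1 - m) < \<sigma>" using \<nu> \<sigma> by (simp add: \<nu>_def field_simps)
  also have "\<sigma> < 2 * \<sigma> * m" using m \<sigma> by simp
  finally show ?thesis using m by (simp add: moment_gap_def field_simps)
qed

text \<open>Integrates the derivative of \<open>z\<^sup>\<alpha> profile(z)\<^sup>m\<close>.\<close>

lemma profile_identity:
  assumes "t \<ge> 0"
  shows "t powr \<alpha> * profile t powr m = \<alpha> * C * primitive target t - moment_gap * primitive weighted_target t"
proof (cases "t = 0")
  case False
  define H where "H = (\<lambda>t. t powr \<alpha> * profile t powr m - \<alpha> * C * primitive target t + moment_gap * primitive weighted_target t)"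
  have "H 0 = H t"
  proof (rule DERIV_isconst2[of 0 t H t, symmetric])
    show "0 < t" using False assms by simp
    have "continuous_on {0..} (\<lambda>t. t powr \<alpha> * profile t powr m)"
    proof (rule continuous_on_mult)
      show "continuous_on {0..} (\<lambda>t. profile t powr m)"
        by (rule continuous_on_powr[OF continuous_on_profile continuous_on_const]) (metis less_irrefl profile_pos)
    qed (use \<alpha> in \<open>auto intro: continuous_on_powr_nonneg\<close>)
    then have "continuous_on {0..} H" unfolding H_def
      by (intro continuous_on_add continuous_on_diff continuous_on_mult_left primitive_continuous
        continuous_on_target continuous_on_weighted_target)
    then show "continuous_on {0..t} H" by (rule continuous_on_subset) auto
    fix z assume z: "0 < z" "z < t"
    have pm: "profile z powr m = (C + z powr (2 * \<sigma>)) powr (m / (m - 1))" for z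
      by (simp add: profile_def powr_powr)
    have "((\<lambda>z. z powr \<alpha> * profile z powr m) has_real_derivative
        (\<alpha> * z powr (\<alpha> - 1) * (C + z powr (2 * \<sigma>)) powr (m / (m - 1))
          + z powr \<alpha> * (m / (m - 1) * (C + z powr (2 * \<sigma>)) powr (m / (m - 1) - 1) * (2 * \<sigma> * z powr (2 * \<sigma> - 1))))) (at z)"
      unfolding pm using z base_pos[of z] by (auto intro!: derivative_eq_intros)
    moreover have "\<alpha> * z powr (\<alpha> - 1) * (C + z powr (2 * \<sigma>)) powr (m / (m - 1))
          + z powr \<alpha> * (m / (m - 1) * (C + z powr (2 * \<sigma>)) powr (m / (m - 1) - 1) * (2 * \<sigma> * z powr (2 * \<sigma> - 1)))
        = \<alpha> * C * target z - moment_gap * weighted_target z"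
    proof -
      have e1: "m / (m - 1) - 1 = 1 / (m - 1)" using m by (simp add: field_simps)
      have "m / (m - 1) = 1 / (m - 1) + 1" using m by (simp add: field_simps)
      then have e2: "(C + z powr (2 * \<sigma>)) powr (m / (m - 1)) = profile z * (C + z powr (2 * \<sigma>))"
        using base_pos[of z] by (simp add: profile_def powr_add)
      have e3: "z powr \<alpha> = z * z powr (\<alpha> - 1)" "z powr (2 * \<sigma>) = z * z powr (2 * \<sigma> - 1)"
        using z by (simp_all add: powr_diff)
      have e4: "m / (m - 1) = - (m / (1 - m))" using m by (simp add: field_simps)
      show ?thesis
        unfolding e1 unfolding e2 profile_def[symmetric] unfolding target_def weighted_target_def moment_gap_def e3 e4
        by (simp add: algebra_simps)
    qed
    ultimately have "((\<lambda>z. z powr \<alpha> * profile z powr m) has_real_derivative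
        (\<alpha> * C * target z - moment_gap * weighted_target z)) (at z)" by simp
    from DERIV_add[OF DERIV_diff[OF this DERIV_cmult[OF primitive_has_derivative[OF continuous_on_target z(1)], of "\<alpha> * C"]]
        DERIV_cmult[OF primitive_has_derivative[OF continuous_on_weighted_target z(1)], of moment_gap]]
    show "(H has_real_derivative 0) (at z)"
      unfolding H_def by simp
  qed (use assms in auto)
  then show ?thesis by (simp add: H_def)
qed simp

lemma primitive_target_mono: "0 \<le> a \<Longrightarrow> a \<le> b \<Longrightarrow> primitive target a \<le> primitive target b"
  by (intro primitive_mono continuous_on_target) (auto intro: less_imp_le target_pos)

lemma primitive_target_strict_mono: "0 \<le> a \<Longrightarrow> a < b \<Longrightarrow> primitive target a < primitive target b"
  by (rule primitive_strict_mono[OF continuous_on_target, of a b]) (auto intro: less_imp_le target_pos)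

text \<open>The left side of \<open>profile_identity\<close> is nonnegative. The bound is uniform in
  \<open>t\<close>; it controls the action by the mass, and the tail of the target.\<close>

lemma weighted_target_le:
  assumes "t \<ge> 0"
  shows "primitive weighted_target t \<le> \<alpha> * C / moment_gap * primitive target t"
proof -
  have "0 \<le> t powr \<alpha> * profile t powr m" by simp
  then show ?thesis using profile_identity[OF assms] moment_gap_pos by (simp add: field_simps)
qed

lemma profile_powr_tendsto_0: "((\<lambda>t. t powr \<alpha> * profile t powr m) \<longlongrightarrow> 0) at_top"
proof (rule tendsto_sandwich[OF _ _ tendsto_const])
  show "((\<lambda>t. t powr (- moment_gap)) \<longlongrightarrow> 0) at_top"
    using moment_gap_pos by (intro tendsto_neg_powr filterlim_ident) auto
  show "eventually (\<lambda>t. t powr \<alpha> * profile t powr m \<le> t powr (- moment_gap)) at_top"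
    using eventually_gt_at_top[of 0]
  proof eventually_elim
    case (elim t)
    have e: "m / (m - 1) \<le> 0" using m by (simp add: divide_nonneg_neg)
    have "profile t powr m = (C + t powr (2 * \<sigma>)) powr (m / (m - 1))"
      by (simp add: profile_def powr_powr)
    also have "\<dots> \<le> (t powr (2 * \<sigma>)) powr (m / (m - 1))"
      using e C elim by (intro powr_mono2') auto
    finally have "t powr \<alpha> * profile t powr m \<le> t powr \<alpha> * t powr (2 * \<sigma> * (m / (m - 1)))"
      by (intro mult_left_mono) (auto simp: powr_powr)
    also have "\<dots> = t powr (- moment_gap)"
    proof -
      have "\<alpha> + 2 * \<sigma> * (m / (m - 1)) = - moment_gap" using m by (simp add: moment_gap_def field_simps)
      then show ?thesis using elim by (simp flip: powr_add)
    qed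
    finally show ?case .
  qed
qed (auto intro: always_eventually)

section \<open>A compactly supported function on the half line and its densities\<close>

context
  fixes h h' :: "real \<Rightarrow> real" and R :: real
  assumes h: "\<And>r. (h has_real_derivative h' r) (at r)"
    and h': "continuous_on UNIV h'"
    and R: "R > 0" "\<And>r. r > R \<Longrightarrow> h r = 0"
begin

definition source :: "real \<Rightarrow> real" where
  "source r = \<bar>h r\<bar> powr (2 * p) * r powr (\<alpha> - 1)"

definition power_density :: "real \<Rightarrow> real" where
  "power_density r = \<bar>h r\<bar> powr (p + 1) * r powr (\<alpha> - 1)"

definition slope_density :: "real \<Rightarrow> real" where
  "slope_density r = (h' r)\<^sup>2 * r powr (\<alpha> + 1 - 2 * \<sigma>)"

lemma continuous_on_h: "continuous_on A h"
  using h DERIV_isCont continuous_at_imp_continuous_on by blast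

lemma continuous_on_abs_h_powr: "a > 0 \<Longrightarrow> continuous_on A (\<lambda>r. \<bar>h r\<bar> powr a)"
  by (intro continuous_on_powr' continuous_intros continuous_on_h) auto

lemma continuous_on_source: "continuous_on {0..} source"
  unfolding source_def[abs_def] using \<alpha> p_facts
  by (intro continuous_on_mult continuous_on_abs_h_powr continuous_on_powr_nonneg) auto

lemma continuous_on_power_density: "continuous_on {0..} power_density"
  unfolding power_density_def[abs_def] using \<alpha> p_facts
  by (intro continuous_on_mult continuous_on_abs_h_powr continuous_on_powr_nonneg) auto

lemma continuous_on_slope_density: "continuous_on {0..} slope_density"
  unfolding slope_density_def[abs_def] using dim
  by (intro continuous_intros continuous_on_powr_nonneg continuous_on_subset[OF h']) auto

lemma source_nonneg: "source r \<ge> 0"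
  by (simp add: source_def)

lemma source_pos: "r > 0 \<Longrightarrow> h r \<noteq> 0 \<Longrightarrow> source r > 0"
  by (simp add: source_def)

lemma primitive_source_mono: "0 \<le> a \<Longrightarrow> a \<le> b \<Longrightarrow> primitive source a \<le> primitive source b"
  by (intro primitive_mono continuous_on_source source_nonneg)

lemma h_eq_0_at_R: "h R = 0"
proof -
  have "(h \<longlongrightarrow> h R) (at_right R)"
    using continuous_on_h[of UNIV] by (auto simp: continuous_on_def intro: tendsto_within_subset)
  moreover have "(h \<longlongrightarrow> 0) (at_right R)"
    by (rule tendsto_eventually) (use R(2) in \<open>auto simp: eventually_at_right_field intro!: exI[of _ "R + 1"]\<close>)
  ultimately show ?thesis using tendsto_unique trivial_limit_at_right_real by blast
qed

lemma primitive_source_beyond: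
  assumes "r0 \<ge> 0" "\<And>s. s > r0 \<Longrightarrow> s \<le> r \<Longrightarrow> h s = 0" "r \<ge> r0"
  shows "primitive source r = primitive source r0"
proof -
  have "integral {r0..r} source = integral {r0..r} (\<lambda>x. 0)"
    by (rule integral_spike[of "{r0}"]) (use assms in \<open>auto simp: source_def\<close>)
  then show ?thesis using primitive_diff[OF continuous_on_source, of r0 r] assms by simp
qed

text \<open>As \<open>h\<close> is Lipschitz, \<open>|h|\<close> stays above \<open>|h r| / 2\<close> on an interval of length comparable to \<open>|h r|\<close>.\<close>

lemma source_tail:
  obtains c where "c > 0"
    "\<And>r. 0 < r \<Longrightarrow> r < R \<Longrightarrow> c * (\<bar>h r\<bar> powr (2 * p + 1) * r powr (\<alpha> - 1)) \<le> primitive source R - primitive source r"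
proof -
  have "compact (h' ` {0..R})"
    by (intro compact_continuous_image continuous_on_subset[OF h']) auto
  then obtain L where L: "L > 0" "\<And>r. r \<in> {0..R} \<Longrightarrow> \<bar>h' r\<bar> \<le> L"
    using compact_imp_bounded bounded_pos by (metis image_eqI real_norm_def)
  have lip: "\<bar>h s - h r\<bar> \<le> L * \<bar>s - r\<bar>" if "r \<in> {0..R}" "s \<in> {0..R}" for r s
    using field_differentiable_bound[of "{0..R}" h h' L s r] L(2) that h
    by (auto intro: has_field_derivative_at_within)
  define c where "c = (1 / 2) powr (2 * p) / (2 * L)"
  show ?thesis
  proof (rule that[of c])
    show "c > 0" using L by (simp add: c_def)
    fix r assume r: "0 < r" "r < R"
    define a where "a = \<bar>h r\<bar>"
    \<comment> \<open>Within distance a / (2 L) the Lipschitz bound costs at most half of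
      \<open>a\<close>; the interval does not leave {..R} because \<open>h\<close> vanishes at
      R.\<close>
    define s where "s = r + a / (2 * L)"
    have a: "a \<ge> 0" by (simp add: a_def)
    have "a \<le> L * (R - r)" using lip[of r R] r h_eq_0_at_R R(1) by (simp add: a_def)
    then have "a / L \<le> R - r" using L by (simp add: field_simps)
    moreover have "a / (2 * L) \<le> a / L" using L a by (simp add: field_simps)
    ultimately have s: "s \<le> R" "s \<ge> r" using L a by (auto simp: s_def)
    have "(a / 2) powr (2 * p) * r powr (\<alpha> - 1) * (s - r) = integral {r..s} (\<lambda>x. (a / 2) powr (2 * p) * r powr (\<alpha> - 1))"
      using s by simp
    also have "\<dots> \<le> integral {r..s} source"
    proof (rule integral_le)
      show "source integrable_on {r..s}" using primitive_integrable[OF continuous_on_source] r by simp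
      fix x assume x: "x \<in> {r..s}"
      have "\<bar>h x - h r\<bar> \<le> L * (x - r)" using lip[of r x] x r s by auto
      also have "\<dots> \<le> L * (a / (2 * L))" using x L by (intro mult_left_mono) (auto simp: s_def)
      also have "\<dots> = a / 2" using L by simp
      finally have "a / 2 \<le> \<bar>h x\<bar>" unfolding a_def by linarith
      then show "(a / 2) powr (2 * p) * r powr (\<alpha> - 1) \<le> source x"
        unfolding source_def using x r a \<alpha> p_facts by (intro mult_mono powr_mono2) auto
    qed auto
    also have "\<dots> = primitive source s - primitive source r"
      using primitive_diff[OF continuous_on_source, of r s] r s by simp
    also have "\<dots> \<le> primitive source R - primitive source r"
      using primitive_source_mono[of s R] s r by simp
    also have "(a / 2) powr (2 * p) * r powr (\<alpha> - 1) * (s - r) = c * (a powr (2 * p + 1) * r powr (\<alpha> - 1))"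
      using L a by (simp add: s_def c_def powr_divide powr_add)
    finally show "c * (\<bar>h r\<bar> powr (2 * p + 1) * r powr (\<alpha> - 1)) \<le> primitive source R - primitive source r"
      by (simp add: a_def)
  qed
qed

section \<open>The monotone map between densities of equal mass\<close>

context
  assumes mass: "(primitive target \<longlongrightarrow> primitive source R) at_top"
begin

abbreviation (input) mass_total ("N") where "N \<equiv> primitive source R"

lemma primitive_target_less: "t \<ge> 0 \<Longrightarrow> primitive target t < N"
proof -
  assume t: "t \<ge> 0"
  have "primitive target (t + 1) \<le> N"
    by (rule tendsto_lowerbound[OF mass])
      (use t in \<open>auto intro!: eventually_mono[OF eventually_ge_at_top[of "t + 1"]] primitive_target_mono\<close>)
  then show ?thesis using primitive_target_strict_mono[of t "t + 1"] t by simp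
qed

lemma N_pos: "N > 0"
  using primitive_target_less[of 0] by simp

text \<open>The quantile function of \<open>target\<close>, meaningful for 0 \<le> y < N, as the
  mass up to a finite \<open>t\<close> never reaches N. The map T of the overview is
  \<open>transport\<close> composed with \<open>primitive source\<close>.\<close>

definition transport :: "real \<Rightarrow> real" where
  "transport y = (THE t. t \<ge> 0 \<and> primitive target t = y)"

lemma transport_eq: "t \<ge> 0 \<Longrightarrow> transport (primitive target t) = t"
  unfolding transport_def
proof (rule the_equality)
  fix t' assume "t \<ge> 0" "0 \<le> t' \<and> primitive target t' = primitive target t"
  then show "t' = t"
    using primitive_target_strict_mono[of t t'] primitive_target_strict_mono[of t' t]
    by (cases t t' rule: linorder_cases) auto
qed simp

lemma transport_exists:
  assumes "0 \<le> y" "y < N"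
  obtains t where "t \<ge> 0" "primitive target t = y"
proof -
  have "eventually (\<lambda>t. primitive target t > y) at_top"
    using order_tendstoD(1)[OF mass assms(2)] .
  then obtain b where b: "b \<ge> 0" "primitive target b > y"
    by (metis eventually_at_top_linorder max.cobounded1 max.cobounded2)
  have "\<exists>x\<ge>0. x \<le> b \<and> primitive target x = y"
    by (rule IVT') (use assms b in \<open>auto intro!: continuous_on_subset[OF primitive_continuous[OF continuous_on_target]]\<close>)
  then show ?thesis using that by blast
qed

lemma primitive_transport:
  assumes "0 \<le> y" "y < N"
  shows "transport y \<ge> 0" "primitive target (transport y) = y"
  using transport_exists[OF assms] transport_eq by metis+

lemma transport_pos: "0 < y \<Longrightarrow> y < N \<Longrightarrow> transport y > 0"
  using primitive_transport[of y] by (cases "transport y = 0") auto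

lemma transport_has_derivative:
  assumes "0 < y" "y < N"
  shows "(transport has_real_derivative inverse (target (transport y))) (at y)"
proof (rule DERIV_inverse_function[where f="primitive target" and a=0 and b=N])
  let ?t = "transport y"
  have t: "?t > 0" using transport_pos[OF assms] .
  show "(primitive target has_real_derivative target ?t) (at ?t)"
    by (rule primitive_has_derivative[OF continuous_on_target t])
  show "target ?t \<noteq> 0" using target_pos[OF t] by simp
  have "isCont transport (primitive target ?t)"
  proof (rule isCont_inverse_function[where f="primitive target" and x="?t" and d="?t / 2"])
    show "0 < ?t / 2" using t by simp
    fix z assume "\<bar>z - ?t\<bar> \<le> ?t / 2"
    then have z: "z > 0" using t by linarith
    then show "transport (primitive target z) = z" by (intro transport_eq) simp
    show "isCont (primitive target) z"
      using primitive_has_derivative[OF continuous_on_target z] DERIV_isCont by blast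
  qed
  then show "isCont transport y" using primitive_transport[of y] assms by simp
qed (use assms primitive_transport in auto)

text \<open>Monotonicity in \<open>r\<close> of the difference of the two sides, with the integrals taken over
  \<open>{0..r}\<close> and over \<open>{0..T(r)}\<close>, replaces the change of variables \<open>t = T(r)\<close> and the integration by parts.\<close>

lemma transport_inequality:
  assumes \<mu>: "\<mu> > 0" and t0: "t0 \<ge> 0"
  shows "\<mu> powr \<nu> * primitive action t0
    \<le> (1 - \<nu>) * primitive power_density R
      + m * (1 - m)\<^sup>2 / (\<sigma>\<^sup>2 * (2 * m - 1)\<^sup>2) * \<mu> powr (2 - \<nu>) * primitive slope_density R"
proof -
  define k where "k = m * (1 - m)\<^sup>2 / (\<sigma>\<^sup>2 * (2 * m - 1)\<^sup>2) * \<mu> powr (2 - \<nu>)"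
  have k: "k \<ge> 0" using m by (auto simp: k_def)
  \<comment> \<open>Strictly between the infimum r0 and the supremum r1 of this set the source mass
    lies strictly between 0 and N, so T is defined, positive and differentiable there, even at zeros
    of \<open>h\<close>.\<close>
  define A where "A = {r. 0 < r \<and> h r \<noteq> 0}"
  have A_le: "r < R" if "r \<in> A" for r
    using that R(2)[of r] h_eq_0_at_R unfolding A_def by (cases "r = R"; force)
  have "A \<noteq> {}"
  proof
    assume "A = {}"
    then have "N = primitive source 0"
      by (intro primitive_source_beyond) (use R in \<open>auto simp: A_def\<close>)
    then show False using N_pos by simp
  qed
  have bdd: "bdd_above A" "bdd_below A"
    using A_le by (auto intro!: bdd_aboveI[of _ R] bdd_belowI[of _ 0] less_imp_le simp: A_def)
  define r0 where "r0 = Inf A"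
  define r1 where "r1 = Sup A"
  have r0: "r0 \<ge> 0" unfolding r0_def by (rule cInf_greatest[OF \<open>A \<noteq> {}\<close>]) (auto simp: A_def)
  have r1: "r1 \<le> R" unfolding r1_def by (rule cSup_least[OF \<open>A \<noteq> {}\<close>]) (auto intro: less_imp_le A_le)
  have below: "h s = 0" if "0 < s" "s < r0" for s
    using that cInf_lower[OF _ bdd(2), of s] unfolding A_def r0_def by force
  have above: "h s = 0" if "s > r1" for s
  proof -
    have "s > 0" using that r0 cInf_le_cSup[OF \<open>A \<noteq> {}\<close> bdd] by (simp add: r0_def r1_def)
    then show ?thesis using that cSup_upper[OF _ bdd(1), of s] unfolding A_def r1_def by force
  qed
  have r01: "r0 < r1"
  proof -
    obtain a where a: "a \<in> A" using \<open>A \<noteq> {}\<close> by blast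
    have "eventually (\<lambda>x. h x \<noteq> 0) (at a)"
      using a DERIV_isCont[OF h, of a] tendsto_imp_eventually_ne[of h "h a" "at a" 0] by (auto simp: A_def isCont_def)
    moreover have "eventually (\<lambda>x. 0 < x) (at a)"
      using a order_tendstoD(1)[OF tendsto_ident_at, of 0 a] by (auto simp: A_def)
    ultimately have "eventually (\<lambda>x. x \<in> A) (at_right a)"
      by (auto simp: A_def eventually_at_split elim: eventually_elim2)
    then obtain b where "b \<in> A" "b > a"
      by (metis eventually_at_right_field gt_ex dense)
    then show ?thesis using cInf_lower[OF a bdd(2)] cSup_upper[OF _ bdd(1), of b] by (simp add: r0_def r1_def)
  qed
  have hr1: "h r1 = 0"
  proof -
    have "(h \<longlongrightarrow> h r1) (at_right r1)"
      using continuous_on_h[of UNIV] by (auto simp: continuous_on_def intro: tendsto_within_subset)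
    moreover have "(h \<longlongrightarrow> 0) (at_right r1)"
      by (rule tendsto_eventually) (use above in \<open>auto simp: eventually_at_right_field intro!: exI[of _ "r1 + 1"]\<close>)
    ultimately show ?thesis using tendsto_unique trivial_limit_at_right_real by blast
  qed
  have Fr1: "primitive source r1 = N"
    by (rule primitive_source_beyond[symmetric]) (use above r0 r01 r1 in auto)
  have Fr0: "primitive source r0 = 0"
  proof -
    have "integral {0..r0} source = integral {0..r0} (\<lambda>x. 0)"
      by (rule integral_spike[of "{0, r0}"]) (use below in \<open>auto simp: source_def\<close>)
    then show ?thesis by (simp add: primitive_def)
  qed
  have Fpos: "0 < primitive source r" "primitive source r < N" if r: "r0 < r" "r < r1" for r
  proof -
    obtain a where a: "a \<in> A" "a < r" using r(1) cInf_lessD[OF \<open>A \<noteq> {}\<close>, of r] unfolding r0_def by blast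
    show "0 < primitive source r"
      using primitive_strict_mono[OF continuous_on_source, of 0 a r] a source_pos[of a] source_nonneg by (simp add: A_def)
    obtain b where b: "b \<in> A" "r < b" using r(2) less_cSupD[OF \<open>A \<noteq> {}\<close>, of r] unfolding r1_def by blast
    show "primitive source r < N"
      using primitive_strict_mono[OF continuous_on_source, of r b R] b source_pos[of b] source_nonneg r r0 A_le[OF b(1)]
      by (simp add: A_def)
  qed
  define T where "T = (\<lambda>r. transport (primitive source r))"
  have T: "T r > 0" "primitive target (T r) = primitive source r" if "r0 < r" "r < r1" for r
    using transport_pos primitive_transport Fpos[OF that] by (auto simp: T_def less_imp_le)
  \<comment> \<open>The boundary term of the integration by parts. It is nonnegative, which suffices
    at r0; at r1 it has to be shown to vanish.\<close>
  define \<Phi> where "\<Phi> = (\<lambda>r. \<bar>h r\<bar> powr (p + 1) * (r powr (\<alpha> - \<sigma>) * T r powr \<sigma>))"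
  define D where "D = (\<lambda>r. (1 - \<nu>) * primitive power_density r + k * primitive slope_density r
    + (1 - m) * \<mu> / \<sigma> * \<Phi> r - \<mu> powr \<nu> * primitive action (T r))"
  have D_deriv: "\<exists>y. (D has_real_derivative y) (at r) \<and> y \<ge> 0" if r: "r0 < r" "r < r1" for r
  proof -
    have rpos: "r > 0" using r r0 by simp
    note Tr = T[OF r]
    define T' where "T' = source r / target (T r)"
    have dT: "(T has_real_derivative T') (at r)"
      unfolding T_def
      using DERIV_chain2[OF transport_has_derivative[OF Fpos[OF r]] primitive_has_derivative[OF continuous_on_source rpos]]
      by (simp add: T'_def T_def divide_inverse mult.commute)
    have dh: "((\<lambda>r. \<bar>h r\<bar> powr (p + 1)) has_real_derivative ((p + 1) * \<bar>h r\<bar> powr p * sgn (h r)) * h' r) (at r)"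
      using DERIV_chain2[OF abs_powr_has_derivative[of "p + 1" "h r"] h[of r]] p_facts by simp
    have d1: "((\<lambda>r. r powr (\<alpha> - \<sigma>)) has_real_derivative (\<alpha> - \<sigma>) * r powr (\<alpha> - \<sigma> - 1)) (at r)"
      by (rule has_real_derivative_powr[OF rpos])
    have d2: "((\<lambda>r. T r powr \<sigma>) has_real_derivative (\<sigma> * T r powr (\<sigma> - 1)) * T') (at r)"
      by (rule DERIV_chain2[OF has_real_derivative_powr[OF Tr(1)] dT])
    have d\<Phi>: "(\<Phi> has_real_derivative (((p + 1) * \<bar>h r\<bar> powr p * sgn (h r) * h' r) * (r powr (\<alpha> - \<sigma>) * T r powr \<sigma>)
          + \<bar>h r\<bar> powr (p + 1) * ((\<alpha> - \<sigma>) * r powr (\<alpha> - \<sigma> - 1) * T r powr \<sigma> + r powr (\<alpha> - \<sigma>) * (\<sigma> * T r powr (\<sigma> - 1) * T')))) (at r)"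
      unfolding \<Phi>_def
      by (rule DERIV_cong[OF DERIV_mult[OF dh DERIV_mult[OF d1 d2]]]) (simp add: algebra_simps)
    have dP: "((\<lambda>r. primitive action (T r)) has_real_derivative action (T r) * T') (at r)"
      by (rule DERIV_chain2[OF primitive_has_derivative[OF continuous_on_action Tr(1)] dT])
    have aT: "action (T r) * T' = (C + (1 - m) * T r powr (2 * \<sigma>)) * source r"
      using target_pos[OF Tr(1)] by (simp add: action_def T'_def)
    let ?y = "(1 - \<nu>) * power_density r + k * slope_density r
      + (1 - m) * \<mu> / \<sigma> * (((p + 1) * \<bar>h r\<bar> powr p * sgn (h r) * h' r) * (r powr (\<alpha> - \<sigma>) * T r powr \<sigma>)
          + \<bar>h r\<bar> powr (p + 1) * ((\<alpha> - \<sigma>) * r powr (\<alpha> - \<sigma> - 1) * T r powr \<sigma> + r powr (\<alpha> - \<sigma>) * (\<sigma> * T r powr (\<sigma> - 1) * T')))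
      - \<mu> powr \<nu> * (action (T r) * T')"
    have "(D has_real_derivative ?y) (at r)"
      unfolding D_def
      by (intro DERIV_add DERIV_diff DERIV_cmult d\<Phi> dP primitive_has_derivative continuous_on_power_density
        continuous_on_slope_density rpos)
    moreover have "?y \<ge> 0"
      unfolding aT k_def
      using transport_pointwise[OF rpos Tr(1), of "\<bar>h r\<bar>" "sgn (h r)" \<mu> "h' r"] \<mu>
      by (simp add: T'_def target_def profile_def source_def power_density_def slope_density_def mult.assoc abs_sgn_eq)
    ultimately show ?thesis by blast
  qed
  have D_mono: "D r' \<le> D r" if "r0 < r'" "r' \<le> r" "r < r1" for r r'
    by (rule DERIV_nonneg_imp_nondecreasing[OF that(2)]) (use D_deriv that in force)
  have pnn: "primitive power_density r \<ge> 0" "primitive slope_density r \<ge> 0" if "r \<ge> 0" for r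
    using primitive_mono[OF continuous_on_power_density, of 0 r] primitive_mono[OF continuous_on_slope_density, of 0 r] that
    by (auto simp: power_density_def slope_density_def)
  have P_le: "primitive action t \<le> (C + (1 - m) * (\<alpha> * C / moment_gap)) * primitive target t" if "t \<ge> 0" for t
    unfolding primitive_action[OF that] using mult_left_mono[OF weighted_target_le[OF that], of "1 - m"] m
    by (simp add: algebra_simps)
  have D_nonneg: "D r \<ge> 0" if r: "r0 < r" "r < r1" for r
  proof -
    \<comment> \<open>Near r0 only the action term of \<open>D\<close> has the wrong sign, and
      \<open>c\<close> times the source mass, which tends to 0, controls it.\<close>
    define c where "c = C + (1 - m) * (\<alpha> * C / moment_gap)"
    have "((\<lambda>r'. - (\<mu> powr \<nu> * (c * primitive source r'))) \<longlongrightarrow> - (\<mu> powr \<nu> * (c * primitive source r0))) (at r0 within {0..})"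
      using primitive_continuous[OF continuous_on_source] r0 by (intro tendsto_intros) (auto simp: continuous_on_def)
    then have lim: "((\<lambda>r'. - (\<mu> powr \<nu> * (c * primitive source r'))) \<longlongrightarrow> 0) (at_right r0)"
      using r0 Fr0 by (auto intro: tendsto_within_subset)
    show ?thesis
    proof (rule tendsto_upperbound[OF lim])
      have "eventually (\<lambda>r'. r0 < r' \<and> r' < r) (at_right r0)"
        using r by (auto simp: eventually_at_right_field)
      then show "eventually (\<lambda>r'. - (\<mu> powr \<nu> * (c * primitive source r')) \<le> D r) (at_right r0)"
      proof eventually_elim
        case (elim r')
        have r': "r0 < r'" "r' < r1" using elim r by auto
        have "\<Phi> r' \<ge> 0" by (simp add: \<Phi>_def)
        then have "(1 - m) * \<mu> / \<sigma> * \<Phi> r' \<ge> 0" using m \<mu> \<sigma> by simp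
        moreover have "(1 - \<nu>) * primitive power_density r' \<ge> 0" "k * primitive slope_density r' \<ge> 0"
          using pnn[of r'] k \<nu> r' r0 by auto
        moreover have "\<mu> powr \<nu> * primitive action (T r') \<le> \<mu> powr \<nu> * (c * primitive source r')"
          using P_le[of "T r'"] T[OF r'] by (intro mult_left_mono) (auto simp: c_def)
        ultimately have "- (\<mu> powr \<nu> * (c * primitive source r')) \<le> D r'" unfolding D_def by linarith
        also have "D r' \<le> D r" using D_mono[of r' r] elim r by simp
        finally show ?case .
      qed
    qed simp
  qed
  obtain c where c: "c > 0"
    "\<And>r. 0 < r \<Longrightarrow> r < R \<Longrightarrow> c * (\<bar>h r\<bar> powr (2 * p + 1) * r powr (\<alpha> - 1)) \<le> N - primitive source r"
    using source_tail by blast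
  \<comment> \<open>Chebyshev's inequality: the target mass beyond \<open>t\<close>, times
    \<open>t powr (2 * \<sigma>)\<close>, is at most the second moment, for which K is a
    bound.\<close>
  define K where "K = \<alpha> * C / moment_gap * N"
  have tail: "(N - primitive target t) * t powr (2 * \<sigma>) \<le> K" if t: "t > 0" for t
  proof (rule tendsto_upperbound)
    show "((\<lambda>s. (primitive target s - primitive target t) * t powr (2 * \<sigma>)) \<longlongrightarrow> (N - primitive target t) * t powr (2 * \<sigma>)) at_top"
      by (intro tendsto_intros mass)
    show "eventually (\<lambda>s. (primitive target s - primitive target t) * t powr (2 * \<sigma>) \<le> K) at_top"
      using eventually_ge_at_top[of t]
    proof eventually_elim
      case (elim s)
      have "(primitive target s - primitive target t) * t powr (2 * \<sigma>) = integral {t..s} (\<lambda>z. target z * t powr (2 * \<sigma>))"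
        using primitive_diff[OF continuous_on_target, of t s] t elim by simp
      also have "\<dots> \<le> integral {t..s} weighted_target"
      proof (rule integral_le)
        show "(\<lambda>z. target z * t powr (2 * \<sigma>)) integrable_on {t..s}"
          using t by (intro primitive_integrable continuous_on_mult_right continuous_on_target) simp
        show "weighted_target integrable_on {t..s}"
          using primitive_integrable[OF continuous_on_weighted_target, of t s] t by simp
        fix z assume "z \<in> {t..s}"
        then show "target z * t powr (2 * \<sigma>) \<le> weighted_target z"
          unfolding weighted_target_def using t \<sigma> target_pos[of z]
          by (subst mult.commute, intro mult_right_mono powr_mono2) auto
      qed
      also have "\<dots> = primitive weighted_target s - primitive weighted_target t"
        using primitive_diff[OF continuous_on_weighted_target, of t s] t elim by simp
      also have "\<dots> \<le> primitive weighted_target s"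
        using primitive_mono[OF continuous_on_weighted_target, of 0 t] t target_pos
        by (auto simp: weighted_target_def less_imp_le)
      also have "\<dots> \<le> \<alpha> * C / moment_gap * primitive target s"
        using weighted_target_le[of s] t elim by simp
      also have "\<dots> \<le> K" unfolding K_def
        using primitive_target_less[of s] t elim \<alpha> C moment_gap_pos by (intro mult_left_mono) auto
      finally show ?case .
    qed
  qed simp
  define K' where "K' = K / c * R powr (\<alpha> + 1 - 2 * \<sigma>)"
  \<comment> \<open>The square of \<Phi> contains a factor that \<open>source_tail\<close> bounds by
    the remaining mass, and \<open>T powr (2 * \<sigma>)\<close>, whose product with that mass is at
    most K. One factor \<open>\<bar>h r\<bar>\<close> is left over, and it tends to 0 at r1.\<close>
  have \<Phi>_le: "\<Phi> r \<le> sqrt (\<bar>h r\<bar> * K')" if r: "r0 < r" "r < r1" for r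
  proof (rule real_le_rsqrt)
    have rpos: "0 < r" "r < R" using r r0 r1 by auto
    have Tr: "T r > 0" "primitive target (T r) = primitive source r" using T[OF r] by auto
    have K: "K \<ge> 0" using \<alpha> C moment_gap_pos N_pos by (simp add: K_def)
    let ?a = "\<bar>h r\<bar>"
    have "(\<Phi> r)\<^sup>2 = ?a * (?a powr (2 * p + 1) * r powr (\<alpha> - 1)) * (r powr (\<alpha> + 1 - 2 * \<sigma>) * T r powr (2 * \<sigma>))"
    proof (cases "h r = 0")
      case False
      have s: "(x powr y)\<^sup>2 = x powr (2 * y)" if "x > 0" for x y :: real
        using that by (simp add: power2_eq_square flip: powr_add)
      have "?a powr (2 * (p + 1)) = ?a * ?a powr (2 * p + 1)"
        using False by (simp add: powr_mult_base algebra_simps)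
      moreover have "r powr (2 * (\<alpha> - \<sigma>)) = r powr (\<alpha> - 1) * r powr (\<alpha> + 1 - 2 * \<sigma>)"
        using rpos by (simp flip: powr_add)
      ultimately show ?thesis
        unfolding \<Phi>_def power_mult_distrib using False rpos Tr by (simp add: s)
    qed (simp add: \<Phi>_def)
    also have "\<dots> \<le> ?a * ((N - primitive source r) / c) * (R powr (\<alpha> + 1 - 2 * \<sigma>) * T r powr (2 * \<sigma>))"
    proof (intro mult_mono mult_left_mono mult_right_mono powr_mono2)
      show "?a powr (2 * p + 1) * r powr (\<alpha> - 1) \<le> (N - primitive source r) / c"
        using c(2)[OF rpos] c(1) by (simp add: field_simps)
      show "0 \<le> ?a * ((N - primitive source r) / c)" using Fpos[OF r] c(1) by simp
    qed (use rpos dim \<sigma> Tr in auto)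
    also have "\<dots> = ?a * ((N - primitive target (T r)) * T r powr (2 * \<sigma>)) * (R powr (\<alpha> + 1 - 2 * \<sigma>) / c)"
      using Tr by simp
    also have "\<dots> \<le> ?a * K * (R powr (\<alpha> + 1 - 2 * \<sigma>) / c)"
      using tail[OF Tr(1)] c(1) by (intro mult_right_mono mult_left_mono) auto
    also have "\<dots> = ?a * K'" by (simp add: K'_def)
    finally show "(\<Phi> r)\<^sup>2 \<le> ?a * K'" .
  qed
  let ?E = "(1 - \<nu>) * primitive power_density R + k * primitive slope_density R"
  have fin: "\<mu> powr \<nu> * primitive action (T r) \<le> ?E + (1 - m) * \<mu> / \<sigma> * sqrt (\<bar>h r\<bar> * K')"
    if r: "r0 < r" "r < r1" for r
  proof -
    have "primitive power_density r \<le> primitive power_density R" "primitive slope_density r \<le> primitive slope_density R"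
      using r r0 r1 by (auto intro!: primitive_mono continuous_on_power_density continuous_on_slope_density
        simp: power_density_def slope_density_def)
    then have "(1 - \<nu>) * primitive power_density r \<le> (1 - \<nu>) * primitive power_density R"
      "k * primitive slope_density r \<le> k * primitive slope_density R"
      using \<nu> k by (auto intro!: mult_left_mono)
    moreover have "(1 - m) * \<mu> / \<sigma> * \<Phi> r \<le> (1 - m) * \<mu> / \<sigma> * sqrt (\<bar>h r\<bar> * K')"
      using m \<mu> \<sigma> by (intro mult_left_mono \<Phi>_le r) auto
    ultimately show ?thesis using D_nonneg[OF r] unfolding D_def by linarith
  qed
  have "((\<lambda>r. ?E + (1 - m) * \<mu> / \<sigma> * sqrt (\<bar>h r\<bar> * K')) \<longlongrightarrow> ?E + (1 - m) * \<mu> / \<sigma> * sqrt (\<bar>h r1\<bar> * K')) (at_left r1)"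
    using continuous_on_h[of UNIV] by (intro tendsto_intros) (auto simp: continuous_on_def intro: tendsto_within_subset)
  then have lim: "((\<lambda>r. ?E + (1 - m) * \<mu> / \<sigma> * sqrt (\<bar>h r\<bar> * K')) \<longlongrightarrow> ?E) (at_left r1)"
    using hr1 by simp
  have "\<mu> powr \<nu> * primitive action t0 \<le> ?E"
  proof (rule tendsto_lowerbound[OF lim])
    have "(primitive source \<longlongrightarrow> primitive source r1) (at r1 within {0..})"
      using primitive_continuous[OF continuous_on_source] r0 r01 by (auto simp: continuous_on_def)
    then have "(primitive source \<longlongrightarrow> N) (at r1 within {0..<r1})"
      using Fr1 by (auto intro: tendsto_within_subset)
    moreover have "at r1 within {0..<r1} = at_left r1"
      using r0 r01 by (intro at_within_nhd[of _ "{0<..}"]) auto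
    ultimately have "(primitive source \<longlongrightarrow> N) (at_left r1)" by simp
    then have "eventually (\<lambda>r. primitive source r > primitive target t0) (at_left r1)"
      using primitive_target_less[OF t0] by (rule order_tendstoD(1))
    moreover have "eventually (\<lambda>r. r0 < r \<and> r < r1) (at_left r1)"
      using r01 by (auto simp: eventually_at_left_field)
    ultimately show "eventually (\<lambda>r. \<mu> powr \<nu> * primitive action t0 \<le> ?E + (1 - m) * \<mu> / \<sigma> * sqrt (\<bar>h r\<bar> * K')) (at_left r1)"
    proof eventually_elim
      case (elim r)
      \<comment> \<open>Close to r1 the source mass up to \<open>r\<close> exceeds the target mass
        up to t0, so \<open>T r\<close> has passed t0.\<close>
      have "t0 \<le> T r"
      proof (rule ccontr)
        assume "\<not> t0 \<le> T r"
        then have "primitive target (T r) \<le> primitive target t0"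
          using T[of r] elim by (intro primitive_target_mono) auto
        then show False using T[of r] elim by simp
      qed
      then have "primitive action t0 \<le> primitive action (T r)"
        by (intro primitive_mono continuous_on_action action_nonneg t0)
      then have "\<mu> powr \<nu> * primitive action t0 \<le> \<mu> powr \<nu> * primitive action (T r)"
        by (rule mult_left_mono) simp
      also note fin[of r]
      finally show ?case using elim by simp
    qed
  qed simp
  then show ?thesis by (simp add: k_def)
qed

end

end

end

subsection \<open>Polar coordinates\<close>

definition sphere_area :: "'a::euclidean_space itself \<Rightarrow> real" where
  "sphere_area _ = real DIM('a) * unit_ball_vol (real DIM('a))"

lemma sphere_area_pos: "sphere_area TYPE('a::euclidean_space) > 0"
  by (simp add: sphere_area_def)

text \<open>Measures that agree on the half lines {..a} agree; there both sides are the volume of a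
  ball, the right one by the fundamental theorem of calculus.\<close>

lemma distr_norm_lborel:
  "distr lborel borel (norm :: 'a::euclidean_space \<Rightarrow> real)
    = density lborel (\<lambda>r. ennreal (indicator {0<..} r * (sphere_area TYPE('a) * r ^ (DIM('a) - 1))))"
  (is "?M = ?N")
proof (rule measure_eqI_generator_eq[where E="range atMost" and \<Omega>=UNIV and A="\<lambda>n::nat. {..real n}"])
  show "Int_stable (range atMost :: real set set)"
  proof (rule Int_stableI)
    fix A B :: "real set" assume "A \<in> range atMost" "B \<in> range atMost"
    then obtain a b where "A = {..a}" "B = {..b}" by auto
    then have "A \<inter> B = {..min a b}" by auto
    then show "A \<inter> B \<in> range atMost" by blast
  qed
  show eq: "emeasure ?M X = emeasure ?N X" if X: "X \<in> range atMost" for X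
  proof -
    obtain a where X: "X = {..a}" using X by blast
    have M: "emeasure ?M X = emeasure lborel (cball (0::'a) a)"
      unfolding X by (subst emeasure_distr) (auto simp: vimage_def cball_def)
    have N: "emeasure ?N X = (\<integral>\<^sup>+r. ennreal (indicator {0<..} r * (sphere_area TYPE('a) * r ^ (DIM('a) - 1))) * indicator {..a} r \<partial>lborel)"
      unfolding X by (rule emeasure_density) auto
    show ?thesis
    proof (cases "a \<ge> 0")
      case True
      have "emeasure ?N X = (\<integral>\<^sup>+r. ennreal (sphere_area TYPE('a) * r ^ (DIM('a) - 1)) * indicator {0..a} r \<partial>lborel)"
        unfolding N
      proof (rule nn_integral_cong_AE)
        have "AE r in lborel. r \<noteq> (0::real)" by (rule AE_lborel_singleton)
        then show "AE r in lborel. ennreal (indicator {0<..} r * (sphere_area TYPE('a) * r ^ (DIM('a) - 1))) * indicator {..a} r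
            = ennreal (sphere_area TYPE('a) * r ^ (DIM('a) - 1)) * indicator {0..a} r"
          by eventually_elim (auto simp: indicator_def)
      qed
      also have "\<dots> = ennreal (unit_ball_vol (real DIM('a)) * a ^ DIM('a) - unit_ball_vol (real DIM('a)) * 0 ^ DIM('a))"
      proof (rule nn_integral_FTC_Icc[where F="\<lambda>x. unit_ball_vol (real DIM('a)) * x ^ DIM('a)"])
        fix x :: real assume x: "x \<in> {0..a}"
        show "((\<lambda>x. unit_ball_vol (real DIM('a)) * x ^ DIM('a)) has_real_derivative sphere_area TYPE('a) * x ^ (DIM('a) - 1)) (at x)"
          by (auto intro!: derivative_eq_intros simp: sphere_area_def)
        show "0 \<le> sphere_area TYPE('a) * x ^ (DIM('a) - 1)"
          using sphere_area_pos[where 'a='a] x by simp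
      qed (use True in auto)
      also have "\<dots> = emeasure lborel (cball (0::'a) a)" using True by (simp add: emeasure_cball)
      finally show ?thesis using M by simp
    next
      case False
      then have "emeasure ?N X = (\<integral>\<^sup>+r. 0 \<partial>(lborel::real measure))"
        unfolding N by (intro nn_integral_cong) (auto simp: indicator_def)
      then show ?thesis using M False by simp
    qed
  qed
  show "sets ?M = sigma_sets UNIV (range atMost)" "sets ?N = sigma_sets UNIV (range atMost)"
    by (simp_all, (subst borel_eq_atMost, simp)+)
  show "emeasure ?M {..real n} \<noteq> \<infinity>" for n :: nat
  proof -
    have "emeasure ?M {..real n} = emeasure lborel (cball (0::'a) (real n))"
      by (subst emeasure_distr) (auto simp: vimage_def cball_def)
    then show ?thesis by (simp add: emeasure_cball)
  qed
  have "\<exists>n. x \<le> real n" for x :: real by (rule real_arch_simple)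
  then show "(\<Union>n. {..real n}) = UNIV" by auto
qed auto

text \<open>The function \<phi> is \<open>g\<close> times the Jacobian for r > 0 only, so that a
  weight singular at the origin can be merged with r^(d - 1) into a function continuous on {0..}, as
  the lemmas on improper integrals below ask.\<close>

lemma radial_integral_eq:
  fixes g \<phi> :: "real \<Rightarrow> real"
  assumes [measurable]: "g \<in> borel_measurable borel"
    and \<phi>: "\<And>r. r > 0 \<Longrightarrow> g r * r ^ (DIM('a) - 1) = \<phi> r"
  shows "integrable lborel (\<lambda>x::'a::euclidean_space. g (norm x)) \<longleftrightarrow> integrable lborel (\<lambda>r. indicator {0<..} r * \<phi> r)"
    and "(LINT x|lborel. g (norm (x::'a))) = sphere_area TYPE('a) * (LINT r|lborel. indicator {0<..} r * \<phi> r)"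
proof -
  let ?w = "\<lambda>r. indicator {0<..} r * (sphere_area TYPE('a) * r ^ (DIM('a) - 1))"
  have w: "AE r in lborel. 0 \<le> ?w r" using sphere_area_pos[where 'a='a] by (auto simp: indicator_def)
  have eq: "?w r *\<^sub>R g r = sphere_area TYPE('a) * (indicator {0<..} r * \<phi> r)" for r
    by (cases "r > 0") (simp_all add: \<phi>[symmetric] mult_ac)
  have "integrable lborel (\<lambda>x::'a. g (norm x)) \<longleftrightarrow> integrable (distr lborel borel (norm :: 'a \<Rightarrow> real)) g"
    by (rule integrable_distr_eq[symmetric]) auto
  also have "\<dots> \<longleftrightarrow> integrable lborel (\<lambda>r. ?w r *\<^sub>R g r)"
    unfolding distr_norm_lborel by (rule integrable_density) (use w in auto)
  also have "\<dots> \<longleftrightarrow> integrable lborel (\<lambda>r. indicator {0<..} r * \<phi> r)"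
    unfolding eq using sphere_area_pos[where 'a='a] by simp
  finally show "integrable lborel (\<lambda>x::'a. g (norm x)) \<longleftrightarrow> integrable lborel (\<lambda>r. indicator {0<..} r * \<phi> r)" .
  have "(LINT x|lborel. g (norm (x::'a))) = integral\<^sup>L (distr lborel borel (norm :: 'a \<Rightarrow> real)) g"
    by (rule integral_distr[symmetric]) auto
  also have "\<dots> = (LINT r|lborel. ?w r *\<^sub>R g r)"
    unfolding distr_norm_lborel by (rule integral_density) (use w in auto)
  also have "\<dots> = sphere_area TYPE('a) * (LINT r|lborel. indicator {0<..} r * \<phi> r)"
    unfolding eq by simp
  finally show "(LINT x|lborel. g (norm (x::'a))) = sphere_area TYPE('a) * (LINT r|lborel. indicator {0<..} r * \<phi> r)" .
qed

lemma primitive_lborel: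
  assumes "continuous_on {0..} \<phi>"
  shows "integrable lborel (\<lambda>r. indicator {0<..t} r * \<phi> r)"
    "(LINT r|lborel. indicator {0<..t} r * \<phi> r) = primitive \<phi> t"
proof -
  have i: "set_integrable lborel {0..t} \<phi>"
    unfolding set_integrable_def
    by (intro borel_integrable_compact continuous_on_subset[OF assms]) auto
  have ae: "AE r in lborel. indicator {0..t} r *\<^sub>R \<phi> r = indicator {0<..t} r * \<phi> r"
    using AE_lborel_singleton[of 0] by eventually_elim (auto simp: indicator_def)
  have meas: "(\<lambda>r. indicator {0<..t} r * \<phi> r) \<in> borel_measurable lborel"
  proof -
    have "(\<lambda>r. indicator {0<..t} r * (indicator {0..t} r *\<^sub>R \<phi> r)) \<in> borel_measurable lborel"
      using i[unfolded set_integrable_def] by measurable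
    also have "(\<lambda>r. indicator {0<..t} r * (indicator {0..t} r *\<^sub>R \<phi> r)) = (\<lambda>r. indicator {0<..t} r * \<phi> r)"
      by (auto simp: indicator_def)
    finally show ?thesis .
  qed
  show "integrable lborel (\<lambda>r. indicator {0<..t} r * \<phi> r)"
    using integrable_cong_AE[OF _ meas ae] i unfolding set_integrable_def by auto
  show "(LINT r|lborel. indicator {0<..t} r * \<phi> r) = primitive \<phi> t"
    using integral_cong_AE[OF _ meas ae] set_borel_integral_eq_integral(2)[OF i] i
    unfolding set_integrable_def set_lebesgue_integral_def primitive_def by auto
qed

lemma indicator_mono_limit:
  assumes "\<And>r. r > 0 \<Longrightarrow> \<phi> r \<ge> 0"
  shows "mono (\<lambda>n. indicator {0<..real n} r * (\<phi> r :: real))"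
    and "(\<lambda>n. indicator {0<..real n} r * \<phi> r) \<longlonglongrightarrow> indicator {0<..} r * \<phi> r"
proof -
  show "mono (\<lambda>n. indicator {0<..real n} r * (\<phi> r :: real))"
    using assms[of r] by (intro monoI) (auto simp: indicator_def)
  have "eventually (\<lambda>n. indicator {0<..real n} r * \<phi> r = indicator {0<..} r * \<phi> r) sequentially"
    using eventually_ge_at_top[of "nat \<lceil>r\<rceil>"]
    by eventually_elim (auto simp: indicator_def nat_ceiling_le_eq)
  then show "(\<lambda>n. indicator {0<..real n} r * \<phi> r) \<longlonglongrightarrow> indicator {0<..} r * \<phi> r"
    by (rule tendsto_eventually)
qed

text \<open>Monotone convergence along integer radii turns an improper integral into a Lebesgue
  integral, integrability included.\<close>

lemma radial_integral_limit:
  fixes g \<phi> :: "real \<Rightarrow> real"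
  assumes g: "g \<in> borel_measurable borel"
    and \<phi>: "\<And>r. r > 0 \<Longrightarrow> g r * r ^ (DIM('a) - 1) = \<phi> r" "continuous_on {0..} \<phi>" "\<And>r. r > 0 \<Longrightarrow> \<phi> r \<ge> 0"
    and lim: "(primitive \<phi> \<longlongrightarrow> L) at_top"
  shows "integrable lborel (\<lambda>x::'a::euclidean_space. g (norm x))"
    "(LINT x|lborel. g (norm (x::'a))) = sphere_area TYPE('a) * L"
proof -
  have "(\<lambda>n. primitive \<phi> (real n)) \<longlonglongrightarrow> L"
    by (rule filterlim_compose[OF lim filterlim_real_sequentially])
  then have l: "(\<lambda>n. LINT r|lborel. indicator {0<..real n} r * \<phi> r) \<longlonglongrightarrow> L"
    by (simp add: primitive_lborel(2)[OF \<phi>(2)])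
  note ml = indicator_mono_limit[of \<phi>, OF \<phi>(3)]
  have meas: "(\<lambda>r. indicator {0<..} r * \<phi> r) \<in> borel_measurable lborel"
    by (rule borel_measurable_LIMSEQ_real[OF ml(2)])
      (use primitive_lborel(1)[OF \<phi>(2)] in auto)
  have nn: "AE r in lborel. 0 \<le> indicator {0<..real n} r * \<phi> r" for n
    using \<phi>(3) by (auto simp: indicator_def)
  have "integrable lborel (\<lambda>r. indicator {0<..} r * \<phi> r)" "(LINT r|lborel. indicator {0<..} r * \<phi> r) = L"
    using integral_monotone_convergence_nonneg[OF primitive_lborel(1)[OF \<phi>(2)] AE_I2[OF ml(1)] nn AE_I2[OF ml(2)] l meas]
    by blast+
  then show "integrable lborel (\<lambda>x::'a. g (norm x))"
    "(LINT x|lborel. g (norm (x::'a))) = sphere_area TYPE('a) * L"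
    using radial_integral_eq[OF g \<phi>(1)] by simp_all
qed

lemma radial_integral_limit_converse:
  fixes g \<phi> :: "real \<Rightarrow> real"
  assumes g: "g \<in> borel_measurable borel"
    and \<phi>: "\<And>r. r > 0 \<Longrightarrow> g r * r ^ (DIM('a) - 1) = \<phi> r" "continuous_on {0..} \<phi>" "\<And>r. r > 0 \<Longrightarrow> \<phi> r \<ge> 0"
    and int: "integrable lborel (\<lambda>x::'a::euclidean_space. g (norm x))"
  shows "(primitive \<phi> \<longlongrightarrow> (LINT x|lborel. g (norm (x::'a))) / sphere_area TYPE('a)) at_top"
proof -
  have i: "integrable lborel (\<lambda>r. indicator {0<..} r * \<phi> r)"
    using int radial_integral_eq(1)[OF g \<phi>(1)] by simp
  have L: "(LINT x|lborel. g (norm (x::'a))) / sphere_area TYPE('a) = (LINT r|lborel. indicator {0<..} r * \<phi> r)"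
    using radial_integral_eq(2)[OF g \<phi>(1)] sphere_area_pos[where 'a='a] by simp
  have "((\<lambda>t. LINT r|lborel. indicator {0<..t} r * \<phi> r) \<longlongrightarrow> (LINT r|lborel. indicator {0<..} r * \<phi> r)) at_top"
  proof (rule integral_dominated_convergence_at_top[OF _ _ i])
    show "\<forall>\<^sub>F t in at_top. AE r in lborel. norm (indicator {0<..t} r * \<phi> r) \<le> indicator {0<..} r * \<phi> r"
      using \<phi>(3) by (auto simp: indicator_def)
    show "AE r in lborel. ((\<lambda>t. indicator {0<..t} r * \<phi> r) \<longlongrightarrow> indicator {0<..} r * \<phi> r) at_top"
    proof (rule AE_I2, rule tendsto_eventually)
      fix r :: real
      show "\<forall>\<^sub>F t in at_top. indicator {0<..t} r * \<phi> r = indicator {0<..} r * \<phi> r"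
        using eventually_ge_at_top[of r] by eventually_elim (auto simp: indicator_def)
    qed
    show "(\<lambda>r. indicator {0<..t} r * \<phi> r) \<in> borel_measurable lborel" for t
      using primitive_lborel(1)[OF \<phi>(2)] by auto
  qed (use i in auto)
  then show ?thesis unfolding L by (simp add: primitive_lborel(2)[OF \<phi>(2)])
qed

lemma radial_integral_compact:
  fixes g \<phi> :: "real \<Rightarrow> real"
  assumes g: "g \<in> borel_measurable borel"
    and \<phi>: "\<And>r. r > 0 \<Longrightarrow> g r * r ^ (DIM('a) - 1) = \<phi> r" "continuous_on {0..} \<phi>" "\<And>r. r > 0 \<Longrightarrow> \<phi> r \<ge> 0"
    and R: "R > 0" "\<And>r. r > R \<Longrightarrow> g r = 0"
  shows "integrable lborel (\<lambda>x::'a::euclidean_space. g (norm x))"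
    "(LINT x|lborel. g (norm (x::'a))) = sphere_area TYPE('a) * primitive \<phi> R"
proof -
  have "primitive \<phi> t = primitive \<phi> R" if "t \<ge> R" for t
  proof -
    have "integral {R..t} \<phi> = integral {R..t} (\<lambda>x. 0)"
      by (rule integral_spike[of "{R}"]) (use R \<phi>(1)[symmetric] in auto)
    then show ?thesis using primitive_diff[OF \<phi>(2), of R t] that R by simp
  qed
  then have "(primitive \<phi> \<longlongrightarrow> primitive \<phi> R) at_top"
    by (rule tendsto_eventually[OF eventually_mono[OF eventually_ge_at_top[of R]]])
  from radial_integral_limit[OF g \<phi> this]
  show "integrable lborel (\<lambda>x::'a. g (norm x))"
    "(LINT x|lborel. g (norm (x::'a))) = sphere_area TYPE('a) * primitive \<phi> R" by simp_all
qed

lemma locally_integrable_norm_powr: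
  assumes "g < real DIM('a::euclidean_space)"
  shows "locally_integrable (\<lambda>x::'a. norm x powr (- g))"
  unfolding locally_integrable_def
proof (intro allI impI)
  fix K :: "'a set" assume K: "compact K"
  then obtain R where R: "R > 0" "\<And>x. x \<in> K \<Longrightarrow> norm x \<le> R"
    using compact_imp_bounded bounded_pos by metis
  define c where "c = (\<lambda>r. max 0 (min 1 (R + 1 - r)))"
  \<comment> \<open>In polar coordinates the condition g < d becomes \<beta> > -1, the integrability
    of \<open>r powr \<beta>\<close> at 0.\<close>
  define \<beta> where "\<beta> = real DIM('a) - 1 - g"
  have "\<beta> > -1" using assms by (simp add: \<beta>_def)
  have meas [measurable]: "c \<in> borel_measurable borel"
    unfolding c_def by measurable
  have i: "integrable lborel (\<lambda>r. indicator {0<..} r * (c r * r powr \<beta>))"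
  proof (rule Bochner_Integration.integrable_bound)
    have "((\<lambda>r. r powr \<beta>) has_integral ((R + 1) powr (\<beta> + 1) / (\<beta> + 1))) {0..R+1}"
      using has_integral_powr_from_0[of \<beta> "R + 1"] \<open>\<beta> > -1\<close> R by simp
    then have "(\<lambda>r. r powr \<beta>) absolutely_integrable_on {0..R+1}"
      by (intro nonnegative_absolutely_integrable_1) (auto intro: has_integral_integrable)
    then show "integrable lborel (\<lambda>r. indicator {0..R+1} r *\<^sub>R r powr \<beta>)"
      unfolding set_integrable_def by (subst (asm) integrable_completion) auto
    show "AE r in lborel. norm (indicator {0<..} r * (c r * r powr \<beta>)) \<le> norm (indicator {0..R+1} r *\<^sub>R r powr \<beta>)"
      by (auto simp: indicator_def c_def abs_mult intro!: mult_left_le_one_le)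
  qed measurable
  have "integrable lborel (\<lambda>x::'a. c (norm x) * norm x powr (- g))"
  proof (subst radial_integral_eq(1)[where g="\<lambda>r. c r * r powr (- g)" and \<phi>="\<lambda>r. c r * r powr \<beta>"])
    fix r :: real assume "r > 0"
    then show "c r * r powr (- g) * r ^ (DIM('a) - 1) = c r * r powr \<beta>"
      by (simp add: \<beta>_def powr_realpow[symmetric] powr_add[symmetric] of_nat_diff)
  qed (use i in auto)
  then show "set_integrable lborel K (\<lambda>x. norm x powr (- g))"
    unfolding set_integrable_def
  proof (rule Bochner_Integration.integrable_bound)
    show "(\<lambda>x. indicator K x *\<^sub>R norm x powr (- g)) \<in> borel_measurable lborel"
      using compact_imp_closed[OF K] by (intro borel_measurable_scaleR) auto
    show "AE x in lborel. norm (indicator K x *\<^sub>R norm x powr (- g)) \<le> norm (c (norm x) * norm x powr (- g))"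
      using R(2) by (intro AE_I2) (auto simp: indicator_def c_def)
  qed
qed

subsection \<open>The Caffarelli-Kohn-Nirenberg inequality\<close>

locale weighted_ckn =
  fixes m \<gamma> C p :: real and ty :: "'a::euclidean_space itself"
  assumes dim3: "DIM('a) \<ge> 3"
    and m: "1 - 1 / real DIM('a) < m" "m < 1"
    and p_eq: "p = 1 / (2 * m - 1)"
    and \<gamma>: "0 < \<gamma>" "\<gamma> < real DIM('a) - (real DIM('a) - 2) * p"
    and C: "0 < C"
begin

definition d :: real where "d = real DIM('a)"
definition \<alpha> :: real where "\<alpha> = d - \<gamma>"
definition \<sigma> :: real where "\<sigma> = (2 - \<gamma>) / 2"
definition \<nu> :: real where "\<nu> = (1 - m) * \<alpha> / \<sigma>"

lemma d3: "d \<ge> 3" using dim3 by (simp add: d_def)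

lemma m23: "m > 2 / 3"
proof -
  have "1 / d \<le> 1 / 3" using d3 by (intro divide_left_mono) auto
  then show ?thesis using m(1) unfolding d_def by linarith
qed

lemma p1: "p > 1" using m m23 by (simp add: p_eq field_simps)

lemma \<gamma>2: "\<gamma> < 2"
proof -
  have "(d - 2) * 1 \<le> (d - 2) * p" using d3 p1 by (intro mult_left_mono) auto
  then show ?thesis using \<gamma> by (simp add: d_def)
qed

lemma two_\<sigma>: "2 * \<sigma> = 2 - \<gamma>" by (simp add: \<sigma>_def)

lemma \<sigma>_pos: "\<sigma> > 0" using \<gamma>2 by (simp add: \<sigma>_def)

text \<open>This is the upper bound on \<gamma>: with p = 1 / (2 m - 1), the inequality (d - 2) p <
  d - \<gamma> says 2 (1 - m) (d - \<gamma>) < 2 - \<gamma>.\<close>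

lemma \<nu>_less_1: "\<nu> < 1"
proof -
  have "(d - 2) * p = (d - 2) / (2 * m - 1)" by (simp add: p_eq)
  then have "(d - 2) / (2 * m - 1) < d - \<gamma>" using \<gamma> by (simp add: d_def)
  then have "d - 2 < (d - \<gamma>) * (2 * m - 1)" using m23 by (simp add: divide_less_eq)
  then have "2 * (1 - m) * (d - \<gamma>) < 2 - \<gamma>" by (simp add: algebra_simps)
  then show ?thesis using \<gamma>2 by (simp add: \<nu>_def \<alpha>_def \<sigma>_def field_simps)
qed

lemma \<nu>_pos: "\<nu> > 0"
  using m \<sigma>_pos \<gamma>2 d3 by (simp add: \<nu>_def \<alpha>_def)

sublocale tr: radial_transport m \<sigma> \<alpha> C p \<nu>
proof
  show "1 / 2 < m" "m < 1" "0 < \<sigma>" "0 < C" "p = 1 / (2 * m - 1)" "\<nu> = (1 - m) * \<alpha> / \<sigma>" "\<nu> < 1"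
    using m23 m \<sigma>_pos C p_eq \<nu>_less_1 by (auto simp: \<nu>_def)
  show "\<sigma> \<le> \<alpha>" "1 < \<alpha>" "2 * \<sigma> < \<alpha> + 1" using \<gamma> \<gamma>2 d3 by (auto simp: \<sigma>_def \<alpha>_def)
qed

definition grad_energy :: "('a \<Rightarrow> real) \<Rightarrow> real" where
  "grad_energy w = (LINT x|lborel. (norm (grad w x))\<^sup>2)"

definition power_energy :: "('a \<Rightarrow> real) \<Rightarrow> real" where
  "power_energy w = (LINT x|lborel. \<bar>w x\<bar> powr (p + 1) * norm x powr (-\<gamma>))"

definition mass_energy :: "('a \<Rightarrow> real) \<Rightarrow> real" where
  "mass_energy w = (LINT x|lborel. \<bar>w x\<bar> powr (2 * p) * norm x powr (-\<gamma>))"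

definition area :: real where "area = sphere_area TYPE('a)"

lemma area_pos: "area > 0" using sphere_area_pos[where 'a='a] by (simp add: area_def)

lemma powr_weight: "r > 0 \<Longrightarrow> r powr a * r ^ (DIM('a) - 1) = r powr (a + d - 1)"
  using dim3 by (simp add: d_def powr_realpow[symmetric] powr_add[symmetric] of_nat_diff add_diff_eq)

lemma powr_weight_\<alpha>: "r > 0 \<Longrightarrow> r powr (- \<gamma>) * r ^ (DIM('a) - 1) = r powr (\<alpha> - 1)"
  using powr_weight[of r "-\<gamma>"] by (simp add: \<alpha>_def)

lemma barenblatt_profile: "barenblatt m \<gamma> C x = tr.profile (norm x)"
  unfolding barenblatt_def tr.profile_def two_\<sigma> ..

lemma barenblatt_pos: "barenblatt m \<gamma> C x > 0"
  by (simp add: barenblatt_profile tr.profile_pos)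

lemma barenblatt_powr_m1: "barenblatt m \<gamma> C x powr (m - 1) = C + norm x powr (2 - \<gamma>)"
  using C m by (simp add: barenblatt_def powr_powr add_pos_nonneg)

lemma barenblatt_powr_m: "barenblatt m \<gamma> C x powr m = (C + norm x powr (2 - \<gamma>)) * barenblatt m \<gamma> C x"
  using powr_add[of "barenblatt m \<gamma> C x" "m - 1" 1] barenblatt_pos[of x]
  by (simp add: barenblatt_powr_m1)

lemma profile_measurable [measurable]: "tr.profile \<in> borel_measurable borel"
  unfolding tr.profile_def[abs_def] by measurable

end

section \<open>Integrals of the Barenblatt profile\<close>

locale weighted_ckn_mass = weighted_ckn m \<gamma> C p ty
  for m \<gamma> C p :: real and ty :: "'a::euclidean_space itself" +
  assumes mass_integrable: "integrable lborel (\<lambda>x::'a. barenblatt m \<gamma> C x * norm x powr (-\<gamma>))"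
begin

definition M :: real where "M = wmass \<gamma> (barenblatt m \<gamma> C :: 'a \<Rightarrow> real)"
text \<open>The exponent adds that of the weight, -\<gamma>, and that of the potential, 2 -
  \<gamma>.\<close>

definition S :: real where "S = (LINT x::'a|lborel. barenblatt m \<gamma> C x * norm x powr (2 - 2 * \<gamma>))"
definition Y0 :: real where "Y0 = C * M + S"

lemma mass_limit: "(primitive tr.target \<longlongrightarrow> M / area) at_top"
  unfolding M_def wmass_def area_def barenblatt_profile
proof (rule radial_integral_limit_converse)
  show "tr.profile r * r powr (- \<gamma>) * r ^ (DIM('a) - 1) = tr.target r" if "r > 0" for r
    using powr_weight_\<alpha>[OF that] by (simp add: tr.target_def mult.assoc)
  show "integrable lborel (\<lambda>x::'a. tr.profile (norm x) * norm x powr (- \<gamma>))"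
    using mass_integrable by (simp add: barenblatt_profile)
qed (auto intro: tr.continuous_on_target less_imp_le tr.target_pos)

text \<open>In the limit of \<open>profile_identity\<close> the boundary term vanishes and the mass
  determines the second moment.\<close>

lemma moment_limit: "(primitive tr.weighted_target \<longlongrightarrow> \<alpha> * C * (M / area) / tr.moment_gap) at_top"
proof -
  have "((\<lambda>t. (\<alpha> * C * primitive tr.target t - t powr \<alpha> * tr.profile t powr m) / tr.moment_gap)
      \<longlongrightarrow> (\<alpha> * C * (M / area) - 0) / tr.moment_gap) at_top"
    using tr.moment_gap_pos by (intro tendsto_intros mass_limit tr.profile_powr_tendsto_0) auto
  then have "((\<lambda>t. (\<alpha> * C * primitive tr.target t - t powr \<alpha> * tr.profile t powr m) / tr.moment_gap)
      \<longlongrightarrow> \<alpha> * C * (M / area) / tr.moment_gap) at_top" by simp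
  then show ?thesis
  proof (rule Lim_transform_eventually)
    show "\<forall>\<^sub>F t in at_top. (\<alpha> * C * primitive tr.target t - t powr \<alpha> * tr.profile t powr m) / tr.moment_gap
        = primitive tr.weighted_target t"
      using eventually_ge_at_top[of 0]
      by eventually_elim (use tr.moment_gap_pos in \<open>simp add: tr.profile_identity\<close>)
  qed
qed

lemma moment: "integrable lborel (\<lambda>x::'a. barenblatt m \<gamma> C x * norm x powr (2 - 2 * \<gamma>))"
  and moment_eq: "S = area * (\<alpha> * C * (M / area) / tr.moment_gap)"
  unfolding S_def barenblatt_profile area_def
proof -
  have w: "tr.profile r * r powr (2 - 2 * \<gamma>) * r ^ (DIM('a) - 1) = tr.weighted_target r" if "r > 0" for r
  proof -
    have "r powr (2 - 2 * \<gamma>) = r powr (2 * \<sigma>) * r powr (- \<gamma>)"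
      by (simp add: powr_add[symmetric] two_\<sigma>)
    then show ?thesis
      by (simp add: tr.weighted_target_def tr.target_def powr_weight_\<alpha>[OF that, symmetric] mult_ac)
  qed
  have nn: "tr.weighted_target r \<ge> 0" if "r > 0" for r
    using tr.target_pos[OF that] by (simp add: tr.weighted_target_def)
  note l = radial_integral_limit[OF _ w tr.continuous_on_weighted_target nn moment_limit[unfolded area_def]]
  show "integrable lborel (\<lambda>x::'a. tr.profile (norm x) * norm x powr (2 - 2 * \<gamma>))"
    by (rule l(1)) auto
  show "(LINT x::'a|lborel. tr.profile (norm x) * norm x powr (2 - 2 * \<gamma>))
      = sphere_area TYPE('a) * (\<alpha> * C * (M / sphere_area TYPE('a)) / tr.moment_gap)"
    by (rule l(2)) auto
qed

lemma M_pos: "M > 0"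
proof -
  have "primitive tr.target 1 \<le> M / area"
    by (rule tendsto_lowerbound[OF mass_limit])
      (auto intro!: eventually_mono[OF eventually_ge_at_top[of 1]] tr.primitive_target_mono)
  moreover have "primitive tr.target 0 < primitive tr.target 1" by (rule tr.primitive_target_strict_mono) auto
  ultimately have "M / area > 0" by simp
  then show ?thesis using area_pos by (simp add: zero_less_divide_iff)
qed

text \<open>The relation S * moment_gap = \<alpha> C M, rewritten with \<nu>. It makes the value C M
  + (1 - m) S reached by transport and the term Y0 - m S of the free energy one number, (1 -
  \<nu>/2) Y0.\<close>

lemma S_Y0: "m * S = \<nu> / 2 * Y0"
proof -
  have gap: "tr.moment_gap = \<alpha> * (2 * m - \<nu>) / \<nu>"
  proof -
    have "\<nu> * \<sigma> / (1 - m) = \<alpha>" using \<sigma>_pos m by (simp add: \<nu>_def)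
    moreover have "tr.moment_gap * \<nu> = 2 * m * (\<nu> * \<sigma> / (1 - m)) - \<alpha> * \<nu>"
      by (simp add: tr.moment_gap_def algebra_simps)
    ultimately have "tr.moment_gap * \<nu> = \<alpha> * (2 * m - \<nu>)" by (simp add: algebra_simps)
    then show ?thesis using \<nu>_pos by (simp add: field_simps)
  qed
  have \<alpha>: "\<alpha> > 0" using \<gamma>2 d3 by (simp add: \<alpha>_def)
  have "S * tr.moment_gap = \<alpha> * C * M"
    unfolding moment_eq using area_pos tr.moment_gap_pos by simp
  then have "\<alpha> * (S * (2 * m - \<nu>)) = \<alpha> * (\<nu> * C * M)"
    unfolding gap using \<nu>_pos by (simp add: field_simps)
  then have "S * (2 * m - \<nu>) = \<nu> * C * M"
    using \<alpha> by (simp only: mult_cancel_left) simp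
  then show ?thesis by (simp add: Y0_def algebra_simps)
qed

lemma Y0_pos: "Y0 > 0"
proof -
  have "S \<ge> 0" unfolding S_def by (intro Bochner_Integration.integral_nonneg) (simp add: less_imp_le[OF barenblatt_pos])
  then show ?thesis using M_pos C by (simp add: Y0_def add_pos_nonneg)
qed

lemma level: "C * M + (1 - m) * S = (1 - \<nu> / 2) * Y0"
  using S_Y0 by (simp add: Y0_def algebra_simps)

text \<open>For w = u^(m - 1/2) one has |grad w|^2 = ((2 m - 1) / (2 (1 - m)))^2 u |grad u^(m-1)|^2,
  and \<open>k\<close> times that constant is m / (2 - \<gamma>)^2, the coefficient that the entropy
  inequality requires.\<close>

definition k :: real where "k = m * (1 - m)\<^sup>2 / (\<sigma>\<^sup>2 * (2 * m - 1)\<^sup>2)"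

lemma k_pos: "k > 0" using m m23 \<sigma>_pos by (simp add: k_def)

text \<open>The restriction of \<open>w\<close> to a line through the origin is continuously
  differentiable on all of the reals, whereas the function \<open>g\<close> in \<open>radial\<close>
  is undetermined at negative arguments.\<close>

lemma radial_profile:
  fixes w :: "'a \<Rightarrow> real"
  assumes w: "w \<in> radial_test_functions"
  obtains h h' R where "\<And>r. (h has_real_derivative h' r) (at r)" "continuous_on UNIV h'" "R > 0" "\<And>r. r > R \<Longrightarrow> h r = 0"
    "\<And>x. w x = h (norm x)" "\<And>x. x \<noteq> 0 \<Longrightarrow> norm (grad w x) = \<bar>h' (norm x)\<bar>" "\<And>r. r > R \<Longrightarrow> h' r = 0"
proof -
  have sm: "smooth w" using w by (simp add: radial_test_functions_def test_functions_def)
  obtain g where g: "\<And>x. w x = g (norm x)" using w by (auto simp: radial_test_functions_def radial_def)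
  obtain R where R: "R > 0" "\<And>x. norm x > R \<Longrightarrow> w x = 0"
    using test_function_support w unfolding radial_test_functions_def by blast
  obtain e :: 'a where e: "e \<in> Basis" using nonempty_Basis by blast
  have ne: "norm e = 1" using e by simp
  define h where "h = (\<lambda>r. w (r *\<^sub>R e))"
  define h' where "h' = (\<lambda>r. grad w (r *\<^sub>R e) \<bullet> e)"
  have wh: "w x = h (norm x)" for x
    using g[of x] g[of "norm x *\<^sub>R e"] ne by (simp add: h_def)
  have dh: "(h has_real_derivative h' r) (at r)" for r
  proof -
    have "((\<lambda>r. r *\<^sub>R e) has_derivative (\<lambda>v. v *\<^sub>R e)) (at r)"
      by (auto intro!: derivative_eq_intros)
    from has_derivative_compose[OF this smooth_has_derivative_grad[OF sm]]
    show ?thesis unfolding has_field_derivative_def h_def h'_def by (simp add: mult_commute_abs)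
  qed
  have gr: "norm (grad w x) = \<bar>h' (norm x)\<bar>" if "x \<noteq> 0" for x
  proof -
    have "(w has_derivative (\<lambda>v. h' (norm x) * (v \<bullet> sgn x))) (at x)"
      using DERIV_compose_FDERIV[OF dh has_derivative_norm[OF that]] wh[abs_def] by (simp add: mult.commute)
    then have "(w has_derivative (\<lambda>v. (h' (norm x) *\<^sub>R sgn x) \<bullet> v)) (at x)"
      by (simp add: inner_commute)
    from grad_eqI[OF this] show ?thesis using that by (simp add: norm_sgn)
  qed
  show ?thesis
  proof (rule that[OF dh _ R(1) _ wh gr])
    show "continuous_on UNIV h'" unfolding h'_def
      by (intro continuous_intros continuous_on_compose2[OF continuous_grad[OF sm]]) auto
    show "h r = 0" if "r > R" for r using R that ne by (simp add: h_def)
    show "h' r = 0" if "r > R" for r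
    proof -
      have "grad w (r *\<^sub>R e) = 0" by (rule grad_eq_0_outside[of R w]) (use R that ne in auto)
      then show ?thesis by (simp add: h'_def)
    qed
  qed
qed

text \<open>\<open>transport_inequality\<close> bounds the action up to every finite radius t0 of
  the target; here t0 tends to infinity and polar coordinates lead back to the space.\<close>

lemma radial_inequality:
  assumes w: "w \<in> radial_test_functions" and N: "mass_energy w = M" and \<mu>: "\<mu> > 0"
  shows "\<mu> powr \<nu> * ((1 - \<nu> / 2) * Y0) \<le> (1 - \<nu>) * power_energy w + k * \<mu> powr (2 - \<nu>) * grad_energy w"
proof -
  obtain h h' R where h: "\<And>r. (h has_real_derivative h' r) (at r)" "continuous_on UNIV h'" "R > 0" "\<And>r. r > R \<Longrightarrow> h r = 0"
    and wh: "\<And>x. w x = h (norm x)" and gr: "\<And>x. x \<noteq> 0 \<Longrightarrow> norm (grad w x) = \<bar>h' (norm x)\<bar>"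
    and h0: "\<And>r. r > R \<Longrightarrow> h' r = 0"
    using radial_profile[OF w] by metis
  have [measurable]: "h \<in> borel_measurable borel"
    using h(1) by (intro borel_measurable_continuous_onI) (meson DERIV_isCont continuous_at_imp_continuous_on)
  have [measurable]: "h' \<in> borel_measurable borel" using h(2) by (rule borel_measurable_continuous_onI)
  note src = tr.continuous_on_source[OF h] and pow = tr.continuous_on_power_density[OF h]
    and slo = tr.continuous_on_slope_density[OF h]
  have sd: "tr.slope_density h' r = (h' r)\<^sup>2 * r powr (\<alpha> + 1 - 2 * \<sigma>)" for r
    by (rule tr.slope_density_def[OF h]) auto
  have N': "mass_energy w = area * primitive (tr.source h) R"
    unfolding mass_energy_def wh area_def
    by (rule radial_integral_compact(2)[where g="\<lambda>r. \<bar>h r\<bar> powr (2 * p) * r powr (-\<gamma>)"])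
      (use src h p1 powr_weight_\<alpha> in \<open>auto simp: tr.source_def[OF h] mult.assoc\<close>)
  have Y: "power_energy w = area * primitive (tr.power_density h) R"
    unfolding power_energy_def wh area_def
    by (rule radial_integral_compact(2)[where g="\<lambda>r. \<bar>h r\<bar> powr (p + 1) * r powr (-\<gamma>)"])
      (use pow h p1 powr_weight_\<alpha> in \<open>auto simp: tr.power_density_def[OF h] mult.assoc\<close>)
  have X: "grad_energy w = area * primitive (tr.slope_density h') R"
  proof -
    have "grad_energy w = (LINT x::'a|lborel. (h' (norm x))\<^sup>2)"
      unfolding grad_energy_def
    proof (rule integral_cong_AE)
      have "smooth w" using w by (simp add: radial_test_functions_def test_functions_def)
      then show "(\<lambda>x. (norm (grad w x))\<^sup>2) \<in> borel_measurable lborel"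
        using borel_measurable_continuous_onI[OF continuous_grad[of w UNIV]] by simp
      show "AE x in lborel. (norm (grad w x))\<^sup>2 = (h' (norm x))\<^sup>2"
        using AE_lborel_singleton[of 0] by eventually_elim (simp add: gr)
    qed auto
    also have "\<dots> = area * primitive (tr.slope_density h') R"
      unfolding area_def
    proof (rule radial_integral_compact(2))
      show "(h' r)\<^sup>2 * r ^ (DIM('a) - 1) = tr.slope_density h' r" if "r > 0" for r
      proof -
        \<comment> \<open>The exponent of the slope density is d - 1: the gradient term carries no
          weight.\<close>
        have eq: "\<alpha> + 1 - 2 * \<sigma> = d - 1" unfolding two_\<sigma> \<alpha>_def by simp
        show ?thesis unfolding sd eq
          using that powr_weight[of r 0] by simp
      qed
    qed (use slo h h0 in \<open>auto simp: sd\<close>)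
    finally show ?thesis .
  qed
  have mass: "(primitive tr.target \<longlongrightarrow> primitive (tr.source h) R) at_top"
    using mass_limit N' N area_pos by (simp add: field_simps)
  have "((\<lambda>t. \<mu> powr \<nu> * primitive tr.action t) \<longlongrightarrow>
      \<mu> powr \<nu> * (C * (M / area) + (1 - m) * (\<alpha> * C * (M / area) / tr.moment_gap))) at_top"
  proof (rule Lim_transform_eventually)
    show "((\<lambda>t. \<mu> powr \<nu> * (C * primitive tr.target t + (1 - m) * primitive tr.weighted_target t)) \<longlongrightarrow>
      \<mu> powr \<nu> * (C * (M / area) + (1 - m) * (\<alpha> * C * (M / area) / tr.moment_gap))) at_top"
      by (intro tendsto_intros mass_limit moment_limit)
    show "\<forall>\<^sub>F t in at_top. \<mu> powr \<nu> * (C * primitive tr.target t + (1 - m) * primitive tr.weighted_target t) = \<mu> powr \<nu> * primitive tr.action t"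
      using eventually_ge_at_top[of 0] by eventually_elim (simp add: tr.primitive_action)
  qed
  then have "\<mu> powr \<nu> * (C * (M / area) + (1 - m) * (\<alpha> * C * (M / area) / tr.moment_gap))
      \<le> (1 - \<nu>) * primitive (tr.power_density h) R + k * \<mu> powr (2 - \<nu>) * primitive (tr.slope_density h') R"
    by (rule tendsto_upperbound)
      (use tr.transport_inequality[OF h mass \<mu>] in \<open>auto simp: k_def intro!: eventually_mono[OF eventually_ge_at_top[of 0]]\<close>)
  then have "area * (\<mu> powr \<nu> * (C * (M / area) + (1 - m) * (\<alpha> * C * (M / area) / tr.moment_gap)))
      \<le> area * ((1 - \<nu>) * primitive (tr.power_density h) R + k * \<mu> powr (2 - \<nu>) * primitive (tr.slope_density h') R)"
    using area_pos by (intro mult_left_mono) auto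
  moreover have "area * (\<mu> powr \<nu> * (C * (M / area) + (1 - m) * (\<alpha> * C * (M / area) / tr.moment_gap)))
      = \<mu> powr \<nu> * (C * M + (1 - m) * S)"
  proof -
    have e: "area * (a * (C * x + (1 - m) * z)) = a * (C * (area * x) + (1 - m) * (area * z))" for a x z
      by (simp add: algebra_simps)
    have M: "area * (M / area) = M" using area_pos by simp
    show ?thesis unfolding e M moment_eq ..
  qed
  moreover have "area * ((1 - \<nu>) * primitive (tr.power_density h) R + k * \<mu> powr (2 - \<nu>) * primitive (tr.slope_density h') R)
      = (1 - \<nu>) * power_energy w + k * \<mu> powr (2 - \<nu>) * grad_energy w"
    unfolding X Y by (simp add: algebra_simps)
  ultimately show ?thesis unfolding level by (simp only:)
qed

end


text \<open>Normalized so that x = y = \<mu> = 1 gives equality. Eliminating \<mu> leaves the form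
  that can be compared with the quotient, a product of powers.\<close>

lemma optimize_scaling:
  fixes x y \<nu> :: real
  assumes \<nu>: "0 < \<nu>" "\<nu> < 1" and xy: "x \<ge> 0" "y \<ge> 0"
    and le: "\<And>\<mu>. \<mu> > 0 \<Longrightarrow> \<mu> powr \<nu> * (1 - \<nu> / 2) \<le> (1 - \<nu>) * y + \<nu> / 2 * \<mu> powr (2 - \<nu>) * x"
  shows "x > 0" "y > 0" "x powr (\<nu> / 2) * y powr (1 - \<nu>) \<ge> 1"
proof -
  show x: "x > 0"
  proof (rule ccontr)
    assume "\<not> x > 0"
    then have "x = 0" using xy by simp
    \<comment> \<open>Without the gradient term the right side does not grow with \<mu>;
      \<open>\<mu> powr \<nu> = y + 1\<close> already violates the inequality.\<close>
    moreover have "((y + 1) powr (1 / \<nu>)) powr \<nu> = y + 1" using \<nu> xy by (simp add: powr_powr)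
    ultimately have "(y + 1) * (1 - \<nu> / 2) \<le> (1 - \<nu>) * y"
      using le[of "(y + 1) powr (1 / \<nu>)"] xy by simp
    moreover have "0 \<le> \<nu> * y" using \<nu> xy by simp
    ultimately show False using \<nu> by (simp add: algebra_simps)
  qed
  show y: "y > 0"
  proof (rule ccontr)
    assume "\<not> y > 0"
    then have y0: "y = 0" using xy by simp
    \<comment> \<open>Small enough that \<open>\<mu> powr (2 - 2 * \<nu>) * x < 1\<close>; then the
      left side wins, since 1 - \<nu>/2 > \<nu>/2.\<close>
    define \<mu> where "\<mu> = (1 / (x + 1)) powr (1 / (2 - 2 * \<nu>))"
    have \<mu>: "\<mu> > 0" using xy by (simp add: \<mu>_def)
    have "\<mu> powr (2 - 2 * \<nu>) = 1 / (x + 1)" using \<nu> xy by (simp add: \<mu>_def powr_powr)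
    moreover have "\<mu> powr (2 - \<nu>) = \<mu> powr \<nu> * \<mu> powr (2 - 2 * \<nu>)" by (simp flip: powr_add)
    ultimately have "\<mu> powr \<nu> * (1 - \<nu> / 2) \<le> \<mu> powr \<nu> * (\<nu> / 2 * (1 / (x + 1)) * x)"
      using le[OF \<mu>] y0 by (simp add: algebra_simps)
    then have "1 - \<nu> / 2 \<le> \<nu> / 2 * (1 / (x + 1)) * x"
      by (rule mult_left_le_imp_le) (use \<mu> in simp)
    also have "\<dots> \<le> \<nu> / 2 * 1" using \<nu> xy by (simp add: field_simps)
    finally show False using \<nu> by simp
  qed
  \<comment> \<open>Chosen so that \<open>\<mu> powr (2 - \<nu>) * x = y\<close>; the right side
    collapses to (1 - \<nu>/2) y.\<close>
  define \<mu> where "\<mu> = (y / x) powr (1 / (2 - \<nu>))"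
  have \<mu>: "\<mu> > 0" using x y by (simp add: \<mu>_def)
  have m2: "\<mu> powr (2 - \<nu>) * x = y" using \<nu> x y by (simp add: \<mu>_def powr_powr)
  have "\<mu> powr \<nu> * (1 - \<nu> / 2) \<le> y * (1 - \<nu> / 2)"
    using le[OF \<mu>] m2 by (simp add: algebra_simps)
  then have "\<mu> powr \<nu> \<le> y" using \<nu> by (simp add: mult_le_cancel_right)
  then have "\<nu> * ln \<mu> \<le> ln y" using \<mu> y by (metis ln_le_cancel_iff ln_powr powr_gt_zero less_irrefl)
  moreover have "ln \<mu> = (ln y - ln x) / (2 - \<nu>)" using x y by (simp add: \<mu>_def ln_powr ln_div)
  ultimately have "\<nu> * (ln y - ln x) \<le> (2 - \<nu>) * ln y" using \<nu> by (simp add: field_simps)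
  then have "0 \<le> \<nu> / 2 * ln x + (1 - \<nu>) * ln y" by (simp add: algebra_simps)
  then have "1 \<le> exp (\<nu> / 2 * ln x + (1 - \<nu>) * ln y)" by simp
  then show "x powr (\<nu> / 2) * y powr (1 - \<nu>) \<ge> 1"
    using x y by (simp add: powr_def exp_add)
qed

context weighted_ckn_mass
begin

text \<open>\<open>Y0\<close> and \<open>X0\<close> are the values of \<open>power_energy\<close> and \<open>grad_energy\<close> at the optimal function, the power
  \<open>m - 1/2\<close> of the Barenblatt profile.\<close>

definition X0 :: real where "X0 = \<nu> / 2 * Y0 / k"

lemma X0_pos: "X0 > 0" using \<nu>_pos Y0_pos k_pos by (simp add: X0_def)

lemma energy_nonneg: "grad_energy w \<ge> 0" "power_energy w \<ge> 0" "mass_energy w \<ge> 0"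
  unfolding grad_energy_def power_energy_def mass_energy_def
  by (auto intro!: Bochner_Integration.integral_nonneg)

lemma normalized_energies:
  "Y0 * ((1 - \<nu>) * (P / Y0) + \<nu> / 2 * c * (G / X0)) = (1 - \<nu>) * P + k * c * G"
proof -
  have a: "Y0 * ((1 - \<nu>) * (P / Y0)) = (1 - \<nu>) * P" using Y0_pos by simp
  have b: "Y0 * (\<nu> / 2 * c * (G / X0)) = (\<nu> / 2 * Y0 / X0) * c * G" by simp
  have e: "\<nu> / 2 * Y0 / X0 = k" using k_pos Y0_pos \<nu>_pos by (simp add: X0_def)
  show ?thesis unfolding distrib_left a b e ..
qed

lemma radial_product_inequality:
  assumes "w \<in> radial_test_functions" "mass_energy w = M"
  shows "(grad_energy w / X0) powr (\<nu> / 2) * (power_energy w / Y0) powr (1 - \<nu>) \<ge> 1"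
proof (rule optimize_scaling(3)[OF \<nu>_pos \<nu>_less_1])
  show "0 \<le> grad_energy w / X0" "0 \<le> power_energy w / Y0"
    using energy_nonneg X0_pos Y0_pos by auto
  fix \<mu> :: real assume "\<mu> > 0"
  from radial_inequality[OF assms this]
  have "Y0 * (\<mu> powr \<nu> * (1 - \<nu> / 2)) \<le> Y0 * ((1 - \<nu>) * (power_energy w / Y0) + \<nu> / 2 * \<mu> powr (2 - \<nu>) * (grad_energy w / X0))"
    unfolding normalized_energies by (simp add: mult_ac)
  then show "\<mu> powr \<nu> * (1 - \<nu> / 2) \<le> (1 - \<nu>) * (power_energy w / Y0) + \<nu> / 2 * \<mu> powr (2 - \<nu>) * (grad_energy w / X0)"
    using Y0_pos by simp
qed

definition \<theta> :: real where "\<theta> = ckn_exponent (real DIM('a)) p \<gamma>"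
text \<open>The common denominator: \<theta>/2 = (\<nu>/2) / D and (1 - \<theta>) / (p + 1) = (1 -
  \<nu>) / D, so the numerator of the quotient is the power 1 / D of a product as in
  \<open>optimize_scaling\<close>.\<close>

definition D :: real where "D = p + 1 - p * \<nu>"

lemma D_pos: "D > 0"
proof -
  have "p * \<nu> < p" using \<nu>_less_1 p1 by simp
  then show ?thesis by (simp add: D_def)
qed

lemma \<theta>_eq: "\<theta> = \<nu> / D"
proof -
  have m: "m = (p + 1) / (2 * p)" using m23 by (simp add: p_eq field_simps)
  have \<nu>: "\<nu> = (p - 1) * (d - \<gamma>) / (p * (2 - \<gamma>))"
  proof -
    have "1 - m = (p - 1) / (2 * p)" using p1 by (simp add: m field_simps)
    then show ?thesis by (simp add: \<nu>_def \<alpha>_def \<sigma>_def)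
  qed
  have D: "D * (2 - \<gamma>) = d + 2 - 2 * \<gamma> - p * (d - 2)"
  proof -
    have "p * \<nu> * (2 - \<gamma>) = (p - 1) * (d - \<gamma>)" using p1 \<gamma>2 by (simp add: \<nu>)
    then show ?thesis by (simp add: D_def algebra_simps)
  qed
  have "\<theta> = (d - \<gamma>) * (p - 1) / (p * (D * (2 - \<gamma>)))"
    by (simp add: \<theta>_def ckn_exponent_def D d_def[symmetric])
  also have "\<dots> = \<nu> / D" using p1 \<gamma>2 D_pos by (simp add: \<nu> field_simps)
  finally show ?thesis .
qed

lemma \<theta>_complement: "(1 - \<theta>) / (p + 1) = (1 - \<nu>) / D"
proof -
  have "1 - \<theta> = (p + 1) * (1 - \<nu>) / D" using D_pos by (simp add: \<theta>_eq D_def field_simps)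
  then show ?thesis using p1 by simp
qed

end

section \<open>Energies of test functions and the quotient\<close>

context weighted_ckn
begin

lemma \<gamma>_less_dim: "\<gamma> < real DIM('a)"
  using \<gamma>2 dim3 by simp

lemma weighted_test_integrable:
  assumes "w \<in> test_functions" "q > 0"
  shows "integrable lborel (\<lambda>x::'a. \<bar>w x\<bar> powr q * norm x powr (-\<gamma>))"
proof -
  obtain R where R: "R > 0" "\<And>x. norm x > R \<Longrightarrow> w x = 0" using test_function_support[OF assms(1)] by blast
  have "continuous_on UNIV (\<lambda>x. \<bar>w x\<bar> powr q)"
    using assms by (intro continuous_on_powr' continuous_intros smooth_continuous test_function_smooth) auto
  from locally_integrable_mult[OF locally_integrable_norm_powr[OF \<gamma>_less_dim] this, of R]
  show ?thesis using R(2) by (simp add: mult.commute)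
qed

lemma mass_energy_pos:
  assumes w: "w \<in> test_functions" "w \<noteq> (\<lambda>x. 0)"
  shows "mass_energy w > 0"
proof -
  have int: "integrable lborel (\<lambda>x::'a. \<bar>w x\<bar> powr (2 * p) * norm x powr (-\<gamma>))"
    using p1 by (intro weighted_test_integrable w) auto
  have "mass_energy w \<noteq> 0"
  proof
    assume "mass_energy w = 0"
    then have "AE x in lborel. \<bar>w x\<bar> powr (2 * p) * norm x powr (-\<gamma>) = 0"
      using integral_nonneg_eq_0_iff_AE[OF int] unfolding mass_energy_def by simp
    then have ae: "AE x in lborel. w x = 0"
      using AE_lborel_singleton[of 0] by eventually_elim auto
    have op: "open {x. w x \<noteq> 0}"
      by (intro open_Collect_neq smooth_continuous test_function_smooth w continuous_intros)
    have "{x. w x \<noteq> 0} \<in> null_sets lborel"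
      using ae op by (subst AE_iff_null_sets) (auto simp: borel_open)
    then have "negligible {x. w x \<noteq> 0}"
      by (simp add: negligible_iff_null_sets null_sets_completionI)
    then show False using op open_not_negligible[of "{x. w x \<noteq> 0}"] w(2) by auto
  qed
  moreover have "mass_energy w \<ge> 0"
    unfolding mass_energy_def by (intro Bochner_Integration.integral_nonneg) auto
  ultimately show ?thesis by simp
qed

lemma wnorm_grad:
  assumes "w \<in> test_functions"
  shows "wnorm 2 0 (grad w) = grad_energy w powr (1 / 2)"
proof -
  have [measurable]: "grad w \<in> borel_measurable borel"
    by (intro borel_measurable_continuous_onI continuous_grad test_function_smooth assms)
  have "(LINT x|lborel. norm (grad w x) powr 2 * norm x powr - 0) = grad_energy w"
    unfolding grad_energy_def
  proof (rule integral_cong_AE)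
    show "AE x in lborel. norm (grad w x) powr 2 * norm x powr - 0 = (norm (grad w x))\<^sup>2"
      using AE_lborel_singleton[of 0] by eventually_elim (simp add: powr_realpow')
  qed measurable
  then show ?thesis by (simp add: wnorm_def)
qed

lemma ckn_quotient_eq:
  assumes "w \<in> test_functions"
  shows "ckn_quotient p \<gamma> w = grad_energy w powr (ckn_exponent (real DIM('a)) p \<gamma> / 2)
    * power_energy w powr ((1 - ckn_exponent (real DIM('a)) p \<gamma>) / (p + 1)) / mass_energy w powr (1 / (2 * p))"
  unfolding ckn_quotient_def wnorm_grad[OF assms]
  by (simp add: Let_def wnorm_def power_energy_def mass_energy_def powr_powr)

lemma scaled_test_function: "w \<in> test_functions \<Longrightarrow> (\<lambda>x. t * w x) \<in> test_functions"
  by (rule test_functions_mult[OF smooth_const])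

lemma energy_scale:
  assumes "w \<in> test_functions" "t > 0"
  shows "grad_energy (\<lambda>x. t * w x) = t\<^sup>2 * grad_energy w"
    "power_energy (\<lambda>x. t * w x) = t powr (p + 1) * power_energy w"
    "mass_energy (\<lambda>x. t * w x) = t powr (2 * p) * mass_energy w"
proof -
  have "grad (\<lambda>x. t * w x) x = t *\<^sub>R grad w x" for x
    by (rule grad_eqI)
      (use has_derivative_mult_right[OF smooth_has_derivative_grad[OF test_function_smooth[OF assms(1)], of x], of t] in simp)
  then show "grad_energy (\<lambda>x. t * w x) = t\<^sup>2 * grad_energy w"
    by (simp add: grad_energy_def power_mult_distrib)
  show "power_energy (\<lambda>x. t * w x) = t powr (p + 1) * power_energy w"
    "mass_energy (\<lambda>x. t * w x) = t powr (2 * p) * mass_energy w"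
    using assms(2) by (simp_all add: power_energy_def mass_energy_def abs_mult powr_mult mult.assoc)
qed

end

context weighted_ckn_mass
begin

lemma normalize_mass:
  assumes w: "w \<in> test_functions" "w \<noteq> (\<lambda>x. 0)"
  shows "mass_energy (\<lambda>x. (M / mass_energy w) powr (1 / (2 * p)) * w x) = M"
proof -
  have N: "mass_energy w > 0" by (rule mass_energy_pos[OF w])
  have "((M / mass_energy w) powr (1 / (2 * p))) powr (2 * p) = M / mass_energy w"
    using M_pos N p1 by (simp add: powr_powr)
  then show ?thesis using energy_scale(3)[OF w(1), of "(M / mass_energy w) powr (1 / (2 * p))"] N M_pos by simp
qed

text \<open>The formula of the quotient at the energies X0, Y0 and the mass M of the power m - 1/2
  of the Barenblatt profile.\<close>

definition Q0 :: real where
  "Q0 = X0 powr (\<theta> / 2) * Y0 powr ((1 - \<theta>) / (p + 1)) / M powr (1 / (2 * p))"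

lemma product_root:
  assumes "x \<ge> 0" "y \<ge> 0"
  shows "x powr (\<theta> / 2) * y powr ((1 - \<theta>) / (p + 1)) = (x powr (\<nu> / 2) * y powr (1 - \<nu>)) powr (1 / D)"
  using assms D_pos unfolding \<theta>_complement by (simp add: \<theta>_eq powr_mult powr_powr field_simps)

lemma radial_quotient_ge:
  fixes w :: "'a \<Rightarrow> real"
  assumes w: "w \<in> radial_test_functions" "w \<noteq> (\<lambda>x. 0)"
  shows "Q0 \<le> ckn_quotient p \<gamma> w"
proof -
  have wt: "w \<in> test_functions" using w by (simp add: radial_test_functions_def)
  define t where "t = (M / mass_energy w) powr (1 / (2 * p))"
  have N: "mass_energy w > 0" by (rule mass_energy_pos[OF wt w(2)])
  have t: "t > 0" using N M_pos by (simp add: t_def)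
  have rad: "(\<lambda>x. t * w x) \<in> radial_test_functions"
  proof -
    obtain g where "\<And>x. w x = g (norm x)" using w by (auto simp: radial_test_functions_def radial_def)
    then have "radial (\<lambda>x. t * w x)" unfolding radial_def by (intro exI[of _ "\<lambda>r. t * g r"]) simp
    then show ?thesis using scaled_test_function[OF wt] by (simp add: radial_test_functions_def)
  qed
  have "1 \<le> (grad_energy (\<lambda>x. t * w x) / X0) powr (\<nu> / 2) * (power_energy (\<lambda>x. t * w x) / Y0) powr (1 - \<nu>)"
    by (rule radial_product_inequality[OF rad]) (simp add: t_def normalize_mass[OF wt w(2)])
  then have "1 powr (1 / D) \<le> ((grad_energy (\<lambda>x. t * w x) / X0) powr (\<nu> / 2) * (power_energy (\<lambda>x. t * w x) / Y0) powr (1 - \<nu>)) powr (1 / D)"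
    using D_pos by (intro powr_mono2) auto
  also have "\<dots> = (grad_energy (\<lambda>x. t * w x) / X0) powr (\<theta> / 2) * (power_energy (\<lambda>x. t * w x) / Y0) powr ((1 - \<theta>) / (p + 1))"
    using energy_nonneg X0_pos Y0_pos by (intro product_root[symmetric]) auto
  also have "\<dots> = (t\<^sup>2) powr (\<theta> / 2) * (t powr (p + 1)) powr ((1 - \<theta>) / (p + 1))
      * (grad_energy w powr (\<theta> / 2) * power_energy w powr ((1 - \<theta>) / (p + 1)))
      / (X0 powr (\<theta> / 2) * Y0 powr ((1 - \<theta>) / (p + 1)))"
    unfolding energy_scale[OF wt t] using energy_nonneg X0_pos Y0_pos
    by (simp add: powr_mult powr_divide)
  \<comment> \<open>The numerator of the quotient is homogeneous of degree one in \<open>w\<close>,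
    like its denominator, so the normalizing factor cancels.\<close>
  also have "(t\<^sup>2) powr (\<theta> / 2) * (t powr (p + 1)) powr ((1 - \<theta>) / (p + 1)) = t"
  proof -
    have "(t\<^sup>2) powr (\<theta> / 2) = t powr \<theta>"
      using t powr_powr[of t 2 "\<theta> / 2"] by simp
    moreover have "(t powr (p + 1)) powr ((1 - \<theta>) / (p + 1)) = t powr (1 - \<theta>)"
      using p1 by (simp add: powr_powr)
    ultimately show ?thesis using t by (simp flip: powr_add)
  qed
  finally have "X0 powr (\<theta> / 2) * Y0 powr ((1 - \<theta>) / (p + 1))
      \<le> t * (grad_energy w powr (\<theta> / 2) * power_energy w powr ((1 - \<theta>) / (p + 1)))"
    using X0_pos Y0_pos by (simp add: le_divide_eq)
  moreover have "t = M powr (1 / (2 * p)) / mass_energy w powr (1 / (2 * p))"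
    using M_pos N by (simp add: t_def powr_divide)
  ultimately show ?thesis
    unfolding Q0_def ckn_quotient_eq[OF wt] \<theta>_def[symmetric] using M_pos N
    by (simp add: divide_le_eq mult_ac)
qed

text \<open>The radial lower bound Q0 is one for the common infimum, hence for every test function.
  The product form so obtained is relaxed to a sum, with equality at the energies X0 and Y0.\<close>

lemma ckn_inequality:
  assumes sym: "ckn_const TYPE('a) p \<gamma> = ckn_const_radial TYPE('a) p \<gamma>"
    and w: "w \<in> test_functions" "mass_energy w = M"
  shows "(1 - \<nu> / 2) * Y0 \<le> k * grad_energy w + (1 - \<nu>) * power_energy w"
proof -
  have w0: "w \<noteq> (\<lambda>x. 0)" using w(2) M_pos by (auto simp: mass_energy_def)
  have bump0: "bump \<noteq> (\<lambda>x::'a. 0)" using bump_0 by (metis zero_neq_one)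
  have "Q0 \<le> (INF w \<in> (radial_test_functions :: ('a \<Rightarrow> real) set) - {\<lambda>x. 0}. ckn_quotient p \<gamma> w)"
    using bump_test_function radial_bump bump0
    by (intro cINF_greatest) (auto simp: radial_test_functions_def intro!: radial_quotient_ge[unfolded radial_test_functions_def])
  \<comment> \<open>\<open>inverse\<close> is injective on the reals, with the value 0 at 0, so
    equal constants mean equal infima.\<close>
  also have "\<dots> = (INF w \<in> (test_functions :: ('a \<Rightarrow> real) set) - {\<lambda>x. 0}. ckn_quotient p \<gamma> w)"
    using sym unfolding ckn_const_def ckn_const_radial_def by (simp only: inverse_eq_iff_eq)
  also have "\<dots> \<le> ckn_quotient p \<gamma> w"
  proof (rule cINF_lower)
    show "bdd_below ((ckn_quotient p \<gamma> :: ('a \<Rightarrow> real) \<Rightarrow> real) ` (test_functions - {\<lambda>x. 0}))"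
      by (rule bdd_belowI[of _ 0]) (auto simp: ckn_quotient_def wnorm_def Let_def)
  qed (use w w0 in auto)
  finally have "X0 powr (\<theta> / 2) * Y0 powr ((1 - \<theta>) / (p + 1))
      \<le> grad_energy w powr (\<theta> / 2) * power_energy w powr ((1 - \<theta>) / (p + 1))"
    unfolding Q0_def ckn_quotient_eq[OF w(1)] \<theta>_def[symmetric] w(2) using M_pos by (simp add: divide_le_cancel)
  then have "1 \<le> (grad_energy w / X0) powr (\<theta> / 2) * (power_energy w / Y0) powr ((1 - \<theta>) / (p + 1))"
    using X0_pos Y0_pos energy_nonneg by (simp add: powr_divide le_divide_eq)
  also have "\<dots> = ((grad_energy w / X0) powr (\<nu> / 2) * (power_energy w / Y0) powr (1 - \<nu>)) powr (1 / D)"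
    using energy_nonneg X0_pos Y0_pos by (intro product_root) auto
  finally have "1 powr D \<le> (((grad_energy w / X0) powr (\<nu> / 2) * (power_energy w / Y0) powr (1 - \<nu>)) powr (1 / D)) powr D"
    using D_pos by (intro powr_mono2) auto
  then have 1: "1 \<le> (grad_energy w / X0) powr (\<nu> / 2) * (power_energy w / Y0) powr (1 - \<nu>)"
    using D_pos energy_nonneg X0_pos Y0_pos by (simp add: powr_powr)
  \<comment> \<open>As \<open>0 powr a = 0\<close>, a vanishing energy would make the product
    0.\<close>
  have pos: "grad_energy w / X0 > 0" "power_energy w / Y0 > 0"
  proof -
    have "grad_energy w \<noteq> 0" "power_energy w \<noteq> 0" using 1 by auto
    then show "grad_energy w / X0 > 0" "power_energy w / Y0 > 0"
      using energy_nonneg[of w] X0_pos Y0_pos by (auto simp: less_le)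
  qed
  \<comment> \<open>The weights \<nu>/2, 1 - \<nu> and \<nu>/2 add up to 1; the third belongs to the
    number 1.\<close>
  have "(grad_energy w / X0) powr (\<nu> / 2) * (power_energy w / Y0) powr (1 - \<nu>)
      \<le> \<nu> / 2 * (grad_energy w / X0) + (1 - \<nu>) * (power_energy w / Y0) + \<nu> / 2"
    by (rule weighted_amgm3) (use pos \<nu>_pos \<nu>_less_1 in auto)
  then have "Y0 * (1 - \<nu> / 2) \<le> Y0 * (\<nu> / 2 * (grad_energy w / X0) + (1 - \<nu>) * (power_energy w / Y0))"
    using 1 Y0_pos by (intro mult_left_mono) auto
  also have "\<dots> = k * grad_energy w + (1 - \<nu>) * power_energy w"
    using normalized_energies[of "power_energy w" 1 "grad_energy w"] by (simp add: add.commute)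
  finally show ?thesis by (simp add: mult.commute)
qed

lemma ckn_inequality_normalized:
  fixes w :: "'a \<Rightarrow> real"
  assumes sym: "ckn_const TYPE('a) p \<gamma> = ckn_const_radial TYPE('a) p \<gamma>"
    and w: "w \<in> test_functions" "w \<noteq> (\<lambda>x. 0)"
  defines "t \<equiv> (M / mass_energy w) powr (1 / (2 * p))"
  shows "(1 - \<nu> / 2) * Y0 \<le> k * (t\<^sup>2 * grad_energy w) + (1 - \<nu>) * (t powr (p + 1) * power_energy w)"
proof -
  have t: "t > 0" using mass_energy_pos[OF w] M_pos by (simp add: t_def)
  have "mass_energy (\<lambda>x. t * w x) = M" unfolding t_def by (rule normalize_mass[OF w])
  from ckn_inequality[OF sym scaled_test_function[OF w(1)] this] show ?thesis
    by (simp add: energy_scale[OF w(1) t])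
qed

end

subsection \<open>Bounded functions with square integrable weak gradient\<close>

text \<open>Split \<open>a k * f k - a0 * f0\<close> into \<open>a k * (f k - f0)\<close>, small by
  the L1 convergence and the bound A, and \<open>(a k - a0) * f0\<close>, treated by dominated
  convergence. In this way nonlinear functions of mollified fields are paired with mollified
  gradients.\<close>

lemma tendsto_integral_mult:
  fixes a f :: "nat \<Rightarrow> 'a::euclidean_space \<Rightarrow> real" and a0 f0 :: "'a \<Rightarrow> real"
  assumes meas [measurable]: "\<And>k. a k \<in> borel_measurable borel" "a0 \<in> borel_measurable borel"
    and bound: "\<And>k x. \<bar>a k x\<bar> \<le> A" "\<And>x. \<bar>a0 x\<bar> \<le> A"
    and supp: "\<And>k x. norm x > R \<Longrightarrow> a k x = 0" "\<And>x. norm x > R \<Longrightarrow> a0 x = 0"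
    and ae: "AE x in lborel. norm x \<le> R \<longrightarrow> (\<lambda>k. a k x) \<longlonglongrightarrow> a0 x"
    and f: "\<And>k. locally_integrable (f k)" "locally_integrable f0"
    and lim: "(\<lambda>k. LINT x|lborel. indicator (cball 0 R) x * \<bar>f k x - f0 x\<bar>) \<longlonglongrightarrow> 0"
  shows "(\<lambda>k. LINT x|lborel. a k x * f k x) \<longlonglongrightarrow> (LINT x|lborel. a0 x * f0 x)"
    and "\<And>k. integrable lborel (\<lambda>x. a k x * f k x)" "integrable lborel (\<lambda>x. a0 x * f0 x)"
proof -
  have A: "A \<ge> 0" using bound(2)[of 0] by linarith
  have bi: "integrable lborel (\<lambda>x. c x * h x)"
    if [measurable]: "c \<in> borel_measurable borel" and c: "\<And>x. \<bar>c x\<bar> \<le> B" "\<And>x. norm x > R \<Longrightarrow> c x = 0"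
      and h: "locally_integrable h" for c h :: "'a \<Rightarrow> real" and B
  proof (rule Bochner_Integration.integrable_bound)
    have [measurable]: "h \<in> borel_measurable borel" using locally_integrable_measurable[OF h] by simp
    show "(\<lambda>x. c x * h x) \<in> borel_measurable lborel" by simp
    have "integrable lborel (\<lambda>x. indicator (cball 0 R) x *\<^sub>R h x)"
      using h unfolding locally_integrable_def set_integrable_def by simp
    then show "integrable lborel (\<lambda>x. B * (indicator (cball 0 R) x *\<^sub>R h x))" by simp
    show "AE x in lborel. norm (c x * h x) \<le> norm (B * (indicator (cball 0 R) x *\<^sub>R h x))"
    proof (rule AE_I2)
      fix x
      have "B \<ge> 0" using c(1)[of x] by linarith
      then show "norm (c x * h x) \<le> norm (B * (indicator (cball 0 R) x *\<^sub>R h x))"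
        using c(1)[of x] c(2)[of x] by (cases "norm x \<le> R") (auto simp: abs_mult intro!: mult_right_mono)
    qed
  qed
  show ik: "integrable lborel (\<lambda>x. a k x * f k x)" for k
    by (rule bi[OF meas(1) bound(1) supp(1) f(1)])
  show i0: "integrable lborel (\<lambda>x. a0 x * f0 x)"
    by (rule bi[OF meas(2) bound(2) supp(2) f(2)])
  have ik0: "integrable lborel (\<lambda>x. a k x * f0 x)" for k
    by (rule bi[OF meas(1) bound(1) supp(1) f(2)])
  have idf: "integrable lborel (\<lambda>x. A * (indicator (cball 0 R) x * \<bar>f k x - f0 x\<bar>))" for k
  proof -
    have "integrable lborel (\<lambda>x. indicator (cball 0 R) x *\<^sub>R f k x - indicator (cball 0 R) x *\<^sub>R f0 x)"
      using f unfolding locally_integrable_def set_integrable_def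
      by (intro Bochner_Integration.integrable_diff) auto
    then have "integrable lborel (\<lambda>x. A * \<bar>indicator (cball 0 R) x *\<^sub>R f k x - indicator (cball 0 R) x *\<^sub>R f0 x\<bar>)"
      by (intro integrable_mult_right integrable_abs)
    moreover have "(\<lambda>x. A * \<bar>indicator (cball 0 R) x *\<^sub>R f k x - indicator (cball 0 R) x *\<^sub>R f0 x\<bar>)
        = (\<lambda>x. A * (indicator (cball 0 R) x * \<bar>f k x - f0 x\<bar>))"
      by (auto simp: indicator_def)
    ultimately show ?thesis by (simp only:)
  qed
  have 1: "(\<lambda>k. LINT x|lborel. a k x * f0 x) \<longlonglongrightarrow> (LINT x|lborel. a0 x * f0 x)"
  proof (rule integral_dominated_convergence)
    have "integrable lborel (\<lambda>x. indicator (cball 0 R) x *\<^sub>R f0 x)"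
      using f(2) unfolding locally_integrable_def set_integrable_def by simp
    then show "integrable lborel (\<lambda>x. A * \<bar>indicator (cball 0 R) x *\<^sub>R f0 x\<bar>)" by (intro integrable_mult_right integrable_abs)
    show "AE x in lborel. (\<lambda>k. a k x * f0 x) \<longlonglongrightarrow> a0 x * f0 x"
      using ae
    proof eventually_elim
      case (elim x)
      show ?case
      proof (cases "norm x \<le> R")
        case True
        then show ?thesis using elim by (intro tendsto_intros) auto
      next
        case False
        then show ?thesis using supp[of x] by simp
      qed
    qed
    show "AE x in lborel. norm (a k x * f0 x) \<le> A * \<bar>indicator (cball 0 R) x *\<^sub>R f0 x\<bar>" for k
    proof (rule AE_I2)
      fix x
      show "norm (a k x * f0 x) \<le> A * \<bar>indicator (cball 0 R) x *\<^sub>R f0 x\<bar>"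
        using bound(1)[of k x] supp(1)[of x k] by (cases "norm x \<le> R") (auto simp: abs_mult intro!: mult_right_mono)
    qed
  qed (use ik0 i0 in auto)
  have 2: "(\<lambda>k. LINT x|lborel. a k x * f k x - a k x * f0 x) \<longlonglongrightarrow> 0"
  proof (rule Lim_null_comparison)
    show "(\<lambda>k. A * (LINT x|lborel. indicator (cball 0 R) x * \<bar>f k x - f0 x\<bar>)) \<longlonglongrightarrow> 0"
      using tendsto_mult[OF tendsto_const[of A] lim] by simp
    show "\<forall>\<^sub>F k in sequentially. norm (LINT x|lborel. a k x * f k x - a k x * f0 x)
        \<le> A * (LINT x|lborel. indicator (cball 0 R) x * \<bar>f k x - f0 x\<bar>)"
    proof (rule always_eventually, rule allI)
      fix k
      have "norm (LINT x|lborel. a k x * f k x - a k x * f0 x) \<le> (LINT x|lborel. A * (indicator (cball 0 R) x * \<bar>f k x - f0 x\<bar>))"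
      proof (rule Bochner_Integration.integral_norm_bound_integral)
        show "norm (a k x * f k x - a k x * f0 x) \<le> A * (indicator (cball 0 R) x * \<bar>f k x - f0 x\<bar>)" for x
          using bound(1)[of k x] supp(1)[of x k]
          by (cases "norm x \<le> R") (auto simp: abs_mult simp flip: right_diff_distrib intro!: mult_right_mono)
      qed (use ik ik0 idf in auto)
      then show "norm (LINT x|lborel. a k x * f k x - a k x * f0 x) \<le> A * (LINT x|lborel. indicator (cball 0 R) x * \<bar>f k x - f0 x\<bar>)"
        by simp
    qed
  qed
  have "(\<lambda>k. (LINT x|lborel. a k x * f0 x) + (LINT x|lborel. a k x * f k x - a k x * f0 x)) \<longlonglongrightarrow> (LINT x|lborel. a0 x * f0 x) + 0"
    by (rule tendsto_add[OF 1 2])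
  then show "(\<lambda>k. LINT x|lborel. a k x * f k x) \<longlonglongrightarrow> (LINT x|lborel. a0 x * f0 x)"
    using ik ik0 by simp
qed

text \<open>For \<open>s = max u \<epsilon> powr (m - 1)\<close> and \<open>b = \<epsilon> powr (m - 1)\<close> this is a regularization of
  \<open>u powr ((1 - m) * a)\<close> which vanishes where \<open>u \<le> \<epsilon>\<close>.\<close>

definition shifted_power :: "real \<Rightarrow> real \<Rightarrow> real \<Rightarrow> real \<Rightarrow> real" where
  "shifted_power a \<eta> b s = (s + \<eta>) powr (-a) - (b + \<eta>) powr (-a)"

lemma shifted_power_bounds:
  assumes "a > 0" "\<eta> > 0" "0 \<le> s" "s \<le> b"
  shows "0 \<le> shifted_power a \<eta> b s" "shifted_power a \<eta> b s \<le> \<eta> powr (-a)"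
    "s > 0 \<Longrightarrow> shifted_power a \<eta> b s \<le> s powr (-a)"
proof -
  have "(b + \<eta>) powr (-a) \<le> (s + \<eta>) powr (-a)" using assms by (intro powr_mono2') auto
  then show "0 \<le> shifted_power a \<eta> b s" by (simp add: shifted_power_def)
  have "(s + \<eta>) powr (-a) \<le> \<eta> powr (-a)" using assms by (intro powr_mono2') auto
  then show "shifted_power a \<eta> b s \<le> \<eta> powr (-a)"
    using powr_ge_zero[of "b + \<eta>" "-a"] unfolding shifted_power_def by linarith
  show "shifted_power a \<eta> b s \<le> s powr (-a)" if "s > 0"
  proof -
    have "(s + \<eta>) powr (-a) \<le> s powr (-a)" using assms that by (intro powr_mono2') auto
    then show ?thesis using powr_ge_zero[of "b + \<eta>" "-a"] unfolding shifted_power_def by linarith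
  qed
qed

lemma locally_integrable_continuous:
  fixes f :: "'a::euclidean_space \<Rightarrow> 'b::euclidean_space"
  assumes "continuous_on UNIV f" shows "locally_integrable f"
  unfolding locally_integrable_def set_integrable_def
  by (intro allI impI borel_integrable_compact continuous_on_subset[OF assms]) auto

text \<open>Abstracts the truncated pressure; the bound \<open>b\<close> is its value where the
  density is at most \<epsilon>.\<close>

locale bounded_weak_gradient =
  fixes P :: "'a::euclidean_space \<Rightarrow> real" and g :: "'a \<Rightarrow> 'a" and b :: real
  assumes weak: "has_weak_gradient P g"
    and P_bounds: "\<And>x. 0 \<le> P x" "\<And>x. P x \<le> b"
    and g_square: "integrable lborel (\<lambda>x. (norm (g x))\<^sup>2)"
begin

lemma P_loc: "locally_integrable P" and g_loc: "locally_integrable g"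
  using weak by (auto simp: has_weak_gradient_def)

lemma P_meas [measurable]: "P \<in> borel_measurable borel"
  using locally_integrable_measurable[OF P_loc] by simp

lemma g_meas [measurable]: "g \<in> borel_measurable borel"
  using locally_integrable_measurable[OF g_loc] by simp

abbreviation "mol k \<equiv> convolution P (mollifier k)"

lemma mol_smooth: "smooth (mol k)"
  by (rule smooth_convolution[OF P_loc mollifier_test])

lemma mol_meas [measurable]: "mol k \<in> borel_measurable borel"
  by (intro borel_measurable_continuous_onI smooth_continuous mol_smooth)

lemma mol_bounds: "0 \<le> mol k x" "mol k x \<le> b"
proof -
  show "0 \<le> mol k x" unfolding convolution_def
    by (intro Bochner_Integration.integral_nonneg mult_nonneg_nonneg P_bounds mollifier_nonneg)
  have "mol k x \<le> (LINT y|lborel. b * mollifier k (x - y))"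
    unfolding convolution_def
    by (intro integral_mono convolution_integrable[OF P_loc mollifier_test] integrable_mult_right
      mollifier_integrable_shift mult_right_mono P_bounds mollifier_nonneg)
  then show "mol k x \<le> b" by (simp add: mollifier_integral_shift)
qed

lemma grad_mol_inner: "grad (mol k) x \<bullet> c = convolution (\<lambda>y. g y \<bullet> c) (mollifier k) x"
proof -
  obtain R where R: "\<And>x. norm x > R \<Longrightarrow> mollifier k (x::'a) = 0" using test_function_support[OF mollifier_test] by metis
  have "integrable lborel (\<lambda>y. mollifier k (x - y) *\<^sub>R g y)"
    by (rule locally_integrable_scaleR[OF g_loc, of _ "norm x + R"])
      (auto intro!: continuous_intros continuous_on_compose2[OF smooth_continuous[OF test_function_smooth[OF mollifier_test]]]
        R reflect_support)
  from integral_inner_left[OF this, of c] show ?thesis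
    unfolding grad_convolution_weak[OF weak mollifier_test] convolution_def by (simp add: mult.commute)
qed

text \<open>Jensen's inequality in each coordinate. It bounds the gradients of mollifications
  without any strong convergence in L2.\<close>

lemma grad_mol_square: "(norm (grad (mol k) x))\<^sup>2 \<le> convolution (\<lambda>y. (norm (g y))\<^sup>2) (mollifier k) x"
proof -
  have comp: "locally_integrable (\<lambda>y. (g y \<bullet> c)\<^sup>2)" if "c \<in> Basis" for c
  proof (rule integrable_locally_integrable, rule Bochner_Integration.integrable_bound[OF g_square])
    show "AE x in lborel. norm ((g x \<bullet> c)\<^sup>2) \<le> norm ((norm (g x))\<^sup>2)"
    proof (rule AE_I2)
      show "norm ((g x \<bullet> c)\<^sup>2) \<le> norm ((norm (g x))\<^sup>2)" for x
        using power_mono[OF Basis_le_norm[OF that, of "g x"] abs_ge_zero, of 2] by simp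
    qed
  qed measurable
  have "(norm (grad (mol k) x))\<^sup>2 = (\<Sum>c\<in>Basis. (grad (mol k) x \<bullet> c)\<^sup>2)"
    unfolding power2_norm_eq_inner by (subst euclidean_inner) (simp add: power2_eq_square)
  also have "\<dots> \<le> (\<Sum>c\<in>Basis. convolution (\<lambda>y. (g y \<bullet> c)\<^sup>2) (mollifier k) x)"
    unfolding grad_mol_inner
    by (intro sum_mono convolution_square_le locally_integrable_inner g_loc comp)
  also have "\<dots> = (LINT y|lborel. (\<Sum>c\<in>Basis. (g y \<bullet> c)\<^sup>2 * mollifier k (x - y)))"
    unfolding convolution_def
    by (intro Bochner_Integration.integral_sum[symmetric] convolution_integrable comp mollifier_test)
  also have "\<dots> = convolution (\<lambda>y. (norm (g y))\<^sup>2) (mollifier k) x"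
    unfolding convolution_def
    unfolding power2_norm_eq_inner sum_distrib_right[symmetric]
    by (subst euclidean_inner) (simp add: power2_eq_square)
  finally show ?thesis .
qed

text \<open>L1 convergence gives convergence almost everywhere along a subsequence, which is what
  passing to the limit inside a nonlinear function takes.\<close>

lemma mol_subsequence:
  obtains r where "strict_mono r" "AE x in lborel. norm x \<le> R \<longrightarrow> (\<lambda>k. mol (r k) x) \<longlonglongrightarrow> P x"
proof -
  have int: "integrable lborel (\<lambda>x. indicator (cball 0 R) x * (mol k x - P x))" for k
  proof -
    have "integrable lborel (\<lambda>x. indicator (cball 0 R) x *\<^sub>R mol k x - indicator (cball 0 R) x *\<^sub>R P x)"
      using P_loc locally_integrable_continuous[OF smooth_continuous[OF mol_smooth]]
      unfolding locally_integrable_def set_integrable_def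
      by (intro Bochner_Integration.integrable_diff) auto
    then show ?thesis by (simp add: right_diff_distrib)
  qed
  have "(\<lambda>k. LINT x|lborel. norm (indicator (cball 0 R) x * (mol k x - P x))) \<longlonglongrightarrow> 0"
    using convolution_local_approx[OF P_loc, of R] by (simp add: abs_mult)
  from tendsto_L1_AE_subseq[OF int this]
  obtain r where r: "strict_mono r" "AE x in lborel. (\<lambda>k. indicator (cball 0 R) x * (mol (r k) x - P x)) \<longlonglongrightarrow> 0"
    by blast
  have "AE x in lborel. norm x \<le> R \<longrightarrow> (\<lambda>k. mol (r k) x) \<longlonglongrightarrow> P x"
    using r(2)
  proof eventually_elim
    case (elim x)
    show ?case
    proof
      assume "norm x \<le> R"
      then have "(\<lambda>k. mol (r k) x - P x) \<longlonglongrightarrow> 0" using elim by simp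
      then show "(\<lambda>k. mol (r k) x) \<longlonglongrightarrow> P x" by (simp add: LIM_zero_iff)
    qed
  qed
  then show ?thesis using that r(1) by blast
qed

context
  fixes a \<eta> :: real
  assumes a: "a > 0" and \<eta>: "\<eta> > 0"
begin

text \<open>The shift \<eta> keeps \<Psi> and its derivative \<psi> smooth and bounded for s \<ge>
  0; the pressure comes close to 0 where the density is large.\<close>

abbreviation "\<Psi> \<equiv> shifted_power a \<eta> b"
abbreviation "\<psi> \<equiv> (\<lambda>s. - a * (s + \<eta>) powr (- a - 1))"

lemma \<Psi>_continuous: "s \<ge> 0 \<Longrightarrow> isCont \<Psi> s"
  unfolding shifted_power_def[abs_def] using \<eta> by (intro continuous_intros) auto

lemma \<psi>_continuous: "s \<ge> 0 \<Longrightarrow> isCont \<psi> s"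
  using \<eta> by (intro continuous_intros) auto

lemma \<psi>_bound: "s \<ge> 0 \<Longrightarrow> \<bar>\<psi> s\<bar> \<le> a * \<eta> powr (- a - 1)"
  using a \<eta> by (auto simp: abs_mult intro!: mult_left_mono powr_mono2')

lemma \<Psi>_meas [measurable]: "\<Psi> \<in> borel_measurable borel"
  unfolding shifted_power_def[abs_def] by measurable

lemma \<Psi>_mol_bounds: "0 \<le> \<Psi> (mol k x)" "\<Psi> (mol k x) \<le> \<eta> powr (-a)"
  by (intro shifted_power_bounds a \<eta> mol_bounds)+

lemma \<Psi>_P_bounds: "0 \<le> \<Psi> (P x)" "\<Psi> (P x) \<le> \<eta> powr (-a)"
  by (intro shifted_power_bounds a \<eta> P_bounds)+

lemma \<Psi>_tendsto: "s \<ge> 0 \<Longrightarrow> (f \<longlongrightarrow> s) F \<Longrightarrow> ((\<lambda>k. \<Psi> (f k)) \<longlongrightarrow> \<Psi> s) F"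
  by (rule isCont_tendsto_compose[OF \<Psi>_continuous])

lemma \<psi>_tendsto: "s \<ge> 0 \<Longrightarrow> (f \<longlongrightarrow> s) F \<Longrightarrow> ((\<lambda>k. \<psi> (f k)) \<longlongrightarrow> \<psi> s) F"
  by (rule isCont_tendsto_compose[OF \<psi>_continuous])

lemma \<Psi>_mol_smooth: "smooth (\<lambda>x. \<Psi> (mol k x))"
  unfolding shifted_power_def
  using mol_bounds(1) \<eta> by (intro smooth_diff smooth_powr smooth_add mol_smooth smooth_const) (simp add: add_nonneg_pos)

lemma grad_\<Psi>_mol: "grad (\<lambda>x. \<Psi> (mol k x)) x = \<psi> (mol k x) *\<^sub>R grad (mol k) x"
proof (rule grad_eqI)
  have "(\<Psi> has_real_derivative \<psi> (mol k x)) (at (mol k x))"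
    unfolding shifted_power_def[abs_def] using \<eta> mol_bounds(1)[of k x]
    by (auto intro!: derivative_eq_intros)
  from DERIV_compose_FDERIV[OF this smooth_has_derivative_grad[OF mol_smooth]]
  show "((\<lambda>x. \<Psi> (mol k x)) has_derivative (\<lambda>h. (\<psi> (mol k x) *\<^sub>R grad (mol k) x) \<bullet> h)) (at x)"
    by (simp add: mult.commute)
qed

text \<open>For a mollified P the two integrals add up to the integral of a partial derivative of a
  test function. In the limit the bounded factors converge almost everywhere and the gradients
  locally in L1. The outcome is the chain rule: \<Psi> (P) has the weak gradient \<psi> (P)
  g.\<close>

lemma weak_product_rule:
  assumes \<zeta>: "\<zeta> \<in> test_functions" and c: "c \<in> Basis"
  shows "(LINT x|lborel. (\<psi> (P x) * \<zeta> x) * (g x \<bullet> c)) + (LINT x|lborel. \<Psi> (P x) * (grad \<zeta> x \<bullet> c)) = 0"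
    "integrable lborel (\<lambda>x. (\<psi> (P x) * \<zeta> x) * (g x \<bullet> c))"
    "integrable lborel (\<lambda>x. \<Psi> (P x) * (grad \<zeta> x \<bullet> c))"
proof -
  obtain R where R: "\<And>x. norm x > R \<Longrightarrow> \<zeta> x = 0" using test_function_support[OF \<zeta>] by metis
  have sm: "smooth \<zeta>" using test_function_smooth[OF \<zeta>] .
  obtain B where B: "B > 0" "\<And>x. norm (\<zeta> x) \<le> B"
    using bounded_compact_support[OF smooth_continuous[OF sm] R] by metis
  have R': "\<And>x. norm x > R \<Longrightarrow> grad \<zeta> x = 0" by (rule grad_eq_0_outside[of R \<zeta>]) (use R in auto)
  have [measurable]: "\<zeta> \<in> borel_measurable borel" by (intro borel_measurable_continuous_onI smooth_continuous sm)
  have [measurable]: "grad \<zeta> \<in> borel_measurable borel" by (intro borel_measurable_continuous_onI continuous_grad sm)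
  have [measurable]: "cball (0::'a) R \<in> sets borel" by simp
  obtain r where r: "strict_mono r" "AE x in lborel. norm x \<le> R \<longrightarrow> (\<lambda>k. mol (r k) x) \<longlonglongrightarrow> P x"
    using mol_subsequence by blast
  have gl: "locally_integrable (\<lambda>x. g x \<bullet> c)" by (rule locally_integrable_inner[OF g_loc])
  have lim: "(\<lambda>k. LINT x|lborel. indicator (cball 0 R) x * \<bar>convolution (\<lambda>x. g x \<bullet> c) (mollifier (r k)) x - g x \<bullet> c\<bar>) \<longlonglongrightarrow> 0"
    using LIMSEQ_subseq_LIMSEQ[OF convolution_local_approx[OF gl, of R] r(1)] by (simp add: o_def)
  have cl: "locally_integrable (convolution (\<lambda>x. g x \<bullet> c) (mollifier (r k)))" for k
    by (intro locally_integrable_continuous smooth_continuous smooth_convolution gl mollifier_test)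
  have ae1: "AE x in lborel. norm x \<le> R \<longrightarrow> (\<lambda>k. \<psi> (mol (r k) x) * \<zeta> x) \<longlonglongrightarrow> \<psi> (P x) * \<zeta> x"
    using r(2)
  proof eventually_elim
    case (elim x)
    show ?case
      by (rule impI, rule tendsto_mult[OF \<psi>_tendsto[OF P_bounds(1)] tendsto_const], use elim in simp)
  qed
  have bnd: "\<bar>\<psi> s * \<zeta> x\<bar> \<le> a * \<eta> powr (- a - 1) * B" if "s \<ge> 0" for s x
    unfolding abs_mult using \<psi>_bound[OF that] B(2)[of x] a by (intro mult_mono) auto
  have m1: "(\<lambda>x. \<psi> (mol (r k) x) * \<zeta> x) \<in> borel_measurable borel" for k by measurable
  have m2: "(\<lambda>x. \<psi> (P x) * \<zeta> x) \<in> borel_measurable borel" by measurable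
  note l1 = tendsto_integral_mult[where R=R, OF m1 m2 bnd[OF mol_bounds(1)] bnd[OF P_bounds(1)] _ _ ae1 cl gl lim]
  \<comment> \<open>\<Psi> (P) need not have compact support; the indicator supplies it and changes
    nothing, as \<open>grad \<zeta>\<close> vanishes outside the ball.\<close>
  have ae2: "AE x in lborel. norm x \<le> R \<longrightarrow> (\<lambda>k. \<Psi> (mol (r k) x) * indicator (cball 0 R) x) \<longlonglongrightarrow> \<Psi> (P x) * indicator (cball 0 R) x"
    using r(2)
  proof eventually_elim
    case (elim x)
    show ?case
      by (rule impI, rule tendsto_mult[OF \<Psi>_tendsto[OF P_bounds(1)] tendsto_const], use elim in simp)
  qed
  have m3: "(\<lambda>x. \<Psi> (mol (r k) x) * indicator (cball 0 R) x) \<in> borel_measurable borel" for k by measurable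
  have m4: "(\<lambda>x. \<Psi> (P x) * indicator (cball 0 R) x) \<in> borel_measurable borel" by measurable
  have gzl: "locally_integrable (\<lambda>x. grad \<zeta> x \<bullet> c)"
    by (intro locally_integrable_inner locally_integrable_continuous continuous_grad sm)
  have bnd2: "\<bar>\<Psi> (mol k x) * indicator (cball 0 R) x\<bar> \<le> \<eta> powr (-a)" "\<bar>\<Psi> (P x) * indicator (cball 0 R) x\<bar> \<le> \<eta> powr (-a)" for k x
    using \<Psi>_mol_bounds[of k x] \<Psi>_P_bounds[of x] by (auto simp: indicator_def)
  note l2 = tendsto_integral_mult[where R=R and f="\<lambda>k x. grad \<zeta> x \<bullet> c", OF m3 m4 bnd2(1) bnd2(2) _ _ ae2 gzl gzl]
  have rw: "\<Psi> s * indicator (cball 0 R) x * (grad \<zeta> x \<bullet> c) = \<Psi> s * (grad \<zeta> x \<bullet> c)" for s x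
    using R'[of x] by (auto simp: indicator_def)
  have zero: "(LINT x|lborel. (\<psi> (mol (r k) x) * \<zeta> x) * convolution (\<lambda>x. g x \<bullet> c) (mollifier (r k)) x)
      + (LINT x|lborel. \<Psi> (mol (r k) x) * (grad \<zeta> x \<bullet> c)) = 0" for k
  proof -
    have "(LINT x|lborel. grad (\<lambda>x. \<Psi> (mol (r k) x) * \<zeta> x) x \<bullet> c) = 0"
      by (intro integral_partial_eq_0 test_functions_mult \<Psi>_mol_smooth \<zeta> c)
    also have "(\<lambda>x. grad (\<lambda>x. \<Psi> (mol (r k) x) * \<zeta> x) x \<bullet> c) =
        (\<lambda>x. (\<psi> (mol (r k) x) * \<zeta> x) * convolution (\<lambda>x. g x \<bullet> c) (mollifier (r k)) x + \<Psi> (mol (r k) x) * (grad \<zeta> x \<bullet> c))"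
    proof
      fix x
      have "grad (\<lambda>x. \<Psi> (mol (r k) x) * \<zeta> x) x
          = \<Psi> (mol (r k) x) *\<^sub>R grad \<zeta> x + \<zeta> x *\<^sub>R (\<psi> (mol (r k) x) *\<^sub>R grad (mol (r k)) x)"
        unfolding grad_mult[OF \<Psi>_mol_smooth sm] grad_\<Psi>_mol ..
      then show "grad (\<lambda>x. \<Psi> (mol (r k) x) * \<zeta> x) x \<bullet> c
          = (\<psi> (mol (r k) x) * \<zeta> x) * convolution (\<lambda>x. g x \<bullet> c) (mollifier (r k)) x + \<Psi> (mol (r k) x) * (grad \<zeta> x \<bullet> c)"
        by (simp only: inner_add_left inner_scaleR_left grad_mol_inner mult_ac add_ac)
    qed
    finally show ?thesis
      using l1(2)[of k] l2(2)[of k] R by (simp add: rw)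
  qed
  have "(\<lambda>k. (LINT x|lborel. (\<psi> (mol (r k) x) * \<zeta> x) * convolution (\<lambda>x. g x \<bullet> c) (mollifier (r k)) x)
      + (LINT x|lborel. \<Psi> (mol (r k) x) * (grad \<zeta> x \<bullet> c))) \<longlonglongrightarrow>
      (LINT x|lborel. (\<psi> (P x) * \<zeta> x) * (g x \<bullet> c)) + (LINT x|lborel. \<Psi> (P x) * (grad \<zeta> x \<bullet> c))"
    using l1(1) l2(1) R by (intro tendsto_add) (simp_all add: rw)
  from LIMSEQ_unique[OF this[unfolded zero] tendsto_const]
  show "(LINT x|lborel. (\<psi> (P x) * \<zeta> x) * (g x \<bullet> c)) + (LINT x|lborel. \<Psi> (P x) * (grad \<zeta> x \<bullet> c)) = 0" .
  show "integrable lborel (\<lambda>x. (\<psi> (P x) * \<zeta> x) * (g x \<bullet> c))" using l1(3) R by simp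
  show "integrable lborel (\<lambda>x. \<Psi> (P x) * (grad \<zeta> x \<bullet> c))" using l2(3) R by (simp add: rw)
qed

text \<open>Jensen's inequality bounds the gradients of mollifications from above, the useful
  direction: the gradient energy stands on the larger side of the inequality into which it will be
  inserted. The factors 1 + s and 1 + 1 / s separate the two terms of the product rule.\<close>

lemma test_function_approx:
  assumes \<xi>: "\<xi> \<in> test_functions" and s: "s > 0" and \<gamma>: "\<gamma> < real DIM('a)"
  obtains W :: "nat \<Rightarrow> 'a \<Rightarrow> real" and X where "\<And>k. W k \<in> test_functions"
    "\<And>q. q > 0 \<Longrightarrow> (\<lambda>k. LINT x|lborel. \<bar>W k x\<bar> powr q * norm x powr (-\<gamma>))
        \<longlonglongrightarrow> (LINT x|lborel. \<bar>\<Psi> (P x) * \<xi> x\<bar> powr q * norm x powr (-\<gamma>))"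
    "\<And>k. (LINT x|lborel. (norm (grad (W k) x))\<^sup>2) \<le> X k"
    "X \<longlonglongrightarrow> (1 + s) * (LINT x|lborel. (\<psi> (P x) * \<xi> x)\<^sup>2 * (norm (g x))\<^sup>2)
        + (1 + 1 / s) * (LINT x|lborel. (\<Psi> (P x))\<^sup>2 * (norm (grad \<xi> x))\<^sup>2)"
proof -
  obtain R where R: "\<And>x. norm x > R \<Longrightarrow> \<xi> x = 0" using test_function_support[OF \<xi>] by metis
  have sm: "smooth \<xi>" using test_function_smooth[OF \<xi>] .
  obtain B where B: "B > 0" "\<And>x. norm (\<xi> x) \<le> B"
    using bounded_compact_support[OF smooth_continuous[OF sm] R] by metis
  have R': "\<And>x. norm x > R \<Longrightarrow> grad \<xi> x = 0" by (rule grad_eq_0_outside[of R \<xi>]) (use R in auto)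
  have [measurable]: "\<xi> \<in> borel_measurable borel" by (intro borel_measurable_continuous_onI smooth_continuous sm)
  have [measurable]: "grad \<xi> \<in> borel_measurable borel" by (intro borel_measurable_continuous_onI continuous_grad sm)
  have [measurable]: "cball (0::'a) R \<in> sets borel" by simp
  obtain r where r: "strict_mono r" "AE x in lborel. norm x \<le> R \<longrightarrow> (\<lambda>k. mol (r k) x) \<longlonglongrightarrow> P x"
    using mol_subsequence by blast
  define W where "W = (\<lambda>k x. \<Psi> (mol (r k) x) * \<xi> x)"
  have W: "W k \<in> test_functions" for k
    unfolding W_def by (intro test_functions_mult \<Psi>_mol_smooth \<xi>)
  have ae\<Psi>: "AE x in lborel. norm x \<le> R \<longrightarrow> (\<lambda>k. \<Psi> (mol (r k) x)) \<longlonglongrightarrow> \<Psi> (P x)"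
    using r(2) by eventually_elim (auto intro: \<Psi>_tendsto[OF P_bounds(1)])
  have \<Psi>\<xi>: "\<bar>\<Psi> (mol k x) * \<xi> x\<bar> \<le> \<eta> powr (-a) * B" "\<bar>\<Psi> (P x) * \<xi> x\<bar> \<le> \<eta> powr (-a) * B" for k x
    unfolding abs_mult using \<Psi>_mol_bounds[of k x] \<Psi>_P_bounds[of x] B(2)[of x] by (auto intro!: mult_mono)
  have lW: "(\<lambda>k. LINT x|lborel. \<bar>W k x\<bar> powr q * norm x powr (-\<gamma>))
        \<longlonglongrightarrow> (LINT x|lborel. \<bar>\<Psi> (P x) * \<xi> x\<bar> powr q * norm x powr (-\<gamma>))" if q: "q > 0" for q
  proof (rule tendsto_integral_mult(1)[where R=R and A="(\<eta> powr (-a) * B) powr q"])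
    show "(\<lambda>x. \<bar>W k x\<bar> powr q) \<in> borel_measurable borel" for k unfolding W_def by measurable
    show "(\<lambda>x. \<bar>\<Psi> (P x) * \<xi> x\<bar> powr q) \<in> borel_measurable borel" by measurable
    show "\<bar>\<bar>W k x\<bar> powr q\<bar> \<le> (\<eta> powr (-a) * B) powr q" "\<bar>\<bar>\<Psi> (P x) * \<xi> x\<bar> powr q\<bar> \<le> (\<eta> powr (-a) * B) powr q" for k x
      using \<Psi>\<xi>(1)[of "r k" x] \<Psi>\<xi>(2)[of x] q by (auto simp: W_def intro!: powr_mono2)
    show "AE x in lborel. norm x \<le> R \<longrightarrow> (\<lambda>k. \<bar>W k x\<bar> powr q) \<longlonglongrightarrow> \<bar>\<Psi> (P x) * \<xi> x\<bar> powr q"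
      using ae\<Psi>
    proof eventually_elim
      case (elim x)
      show ?case
      proof
        assume "norm x \<le> R"
        then show "(\<lambda>k. \<bar>W k x\<bar> powr q) \<longlonglongrightarrow> \<bar>\<Psi> (P x) * \<xi> x\<bar> powr q"
          unfolding W_def using elim q
          by (intro tendsto_powr' tendsto_rabs tendsto_mult tendsto_const) auto
      qed
    qed
    show "locally_integrable (\<lambda>x::'a. norm x powr (-\<gamma>))" by (rule locally_integrable_norm_powr[OF \<gamma>])
    then show "locally_integrable (\<lambda>x::'a. norm x powr (-\<gamma>))" .
  qed (use R q in \<open>auto simp: W_def\<close>)
  have g2: "locally_integrable (\<lambda>x. (norm (g x))\<^sup>2)" by (rule integrable_locally_integrable[OF g_square])
  define X where "X = (\<lambda>k. (1 + s) * (LINT x|lborel. (\<psi> (mol (r k) x) * \<xi> x)\<^sup>2 * convolution (\<lambda>x. (norm (g x))\<^sup>2) (mollifier (r k)) x)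
      + (1 + 1 / s) * (LINT x|lborel. ((\<Psi> (mol (r k) x))\<^sup>2 * indicator (cball 0 R) x) * (norm (grad \<xi> x))\<^sup>2))"
  have bnd1: "\<bar>(\<psi> t * \<xi> x)\<^sup>2\<bar> \<le> (a * \<eta> powr (- a - 1) * B)\<^sup>2" if "t \<ge> 0" for t x
  proof -
    have "\<bar>\<psi> t * \<xi> x\<bar> \<le> a * \<eta> powr (- a - 1) * B"
      unfolding abs_mult using \<psi>_bound[OF that] B(2)[of x] a by (intro mult_mono) auto
    then show ?thesis by (metis abs_ge_zero abs_power2 power2_abs power_mono)
  qed
  have ae1: "AE x in lborel. norm x \<le> R \<longrightarrow> (\<lambda>k. (\<psi> (mol (r k) x) * \<xi> x)\<^sup>2) \<longlonglongrightarrow> (\<psi> (P x) * \<xi> x)\<^sup>2"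
    using r(2)
  proof eventually_elim
    case (elim x)
    show ?case
      by (rule impI, rule tendsto_power[OF tendsto_mult[OF \<psi>_tendsto[OF P_bounds(1)] tendsto_const]], use elim in simp)
  qed
  have m1: "(\<lambda>x. (\<psi> (mol (r k) x) * \<xi> x)\<^sup>2) \<in> borel_measurable borel" for k by measurable
  have m2: "(\<lambda>x. (\<psi> (P x) * \<xi> x)\<^sup>2) \<in> borel_measurable borel" by measurable
  have lim: "(\<lambda>k. LINT x|lborel. indicator (cball 0 R) x * \<bar>convolution (\<lambda>x. (norm (g x))\<^sup>2) (mollifier (r k)) x - (norm (g x))\<^sup>2\<bar>) \<longlonglongrightarrow> 0"
    using LIMSEQ_subseq_LIMSEQ[OF convolution_local_approx[OF g2, of R] r(1)] by (simp add: o_def)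
  have cl: "locally_integrable (convolution (\<lambda>x. (norm (g x))\<^sup>2) (mollifier (r k)))" for k
    by (intro locally_integrable_continuous smooth_continuous smooth_convolution g2 mollifier_test)
  note l1 = tendsto_integral_mult[where R=R, OF m1 m2 bnd1[OF mol_bounds(1)] bnd1[OF P_bounds(1)] _ _ ae1 cl g2 lim]
  have ae2: "AE x in lborel. norm x \<le> R \<longrightarrow> (\<lambda>k. (\<Psi> (mol (r k) x))\<^sup>2 * indicator (cball 0 R) x) \<longlonglongrightarrow> (\<Psi> (P x))\<^sup>2 * indicator (cball 0 R) x"
    using ae\<Psi> by eventually_elim (auto intro!: tendsto_mult tendsto_power)
  have m3: "(\<lambda>x. (\<Psi> (mol (r k) x))\<^sup>2 * indicator (cball 0 R) x) \<in> borel_measurable borel" for k by measurable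
  have m4: "(\<lambda>x. (\<Psi> (P x))\<^sup>2 * indicator (cball 0 R) x) \<in> borel_measurable borel" by measurable
  have bnd2: "\<bar>(\<Psi> (mol k x))\<^sup>2 * indicator (cball 0 R) x\<bar> \<le> (\<eta> powr (-a))\<^sup>2" "\<bar>(\<Psi> (P x))\<^sup>2 * indicator (cball 0 R) x\<bar> \<le> (\<eta> powr (-a))\<^sup>2" for k x
    using \<Psi>_mol_bounds[of k x] \<Psi>_P_bounds[of x] by (auto simp: indicator_def intro!: power_mono)
  have gxl: "locally_integrable (\<lambda>x. (norm (grad \<xi> x))\<^sup>2)"
    by (intro locally_integrable_continuous continuous_intros continuous_grad sm)
  note l2 = tendsto_integral_mult[where R=R and f="\<lambda>k x. (norm (grad \<xi> x))\<^sup>2", OF m3 m4 bnd2(1) bnd2(2) _ _ ae2 gxl gxl]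
  have rw: "(\<Psi> t)\<^sup>2 * indicator (cball 0 R) x * (norm (grad \<xi> x))\<^sup>2 = (\<Psi> t)\<^sup>2 * (norm (grad \<xi> x))\<^sup>2" for t x
    using R'[of x] by (auto simp: indicator_def)
  show ?thesis
  proof (rule that[of W X])
    show "(LINT x|lborel. (norm (grad (W k) x))\<^sup>2) \<le> X k" for k
    proof -
      have i1: "integrable lborel (\<lambda>x. (\<psi> (mol (r k) x) * \<xi> x)\<^sup>2 * convolution (\<lambda>x. (norm (g x))\<^sup>2) (mollifier (r k)) x)"
        using l1(2)[of k] R by simp
      have i2: "integrable lborel (\<lambda>x. ((\<Psi> (mol (r k) x))\<^sup>2 * indicator (cball 0 R) x) * (norm (grad \<xi> x))\<^sup>2)"
        using l2(2)[of k] R by simp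
      have "(LINT x|lborel. (norm (grad (W k) x))\<^sup>2) \<le>
        (LINT x|lborel. (1 + s) * ((\<psi> (mol (r k) x) * \<xi> x)\<^sup>2 * convolution (\<lambda>x. (norm (g x))\<^sup>2) (mollifier (r k)) x)
          + (1 + 1 / s) * (((\<Psi> (mol (r k) x))\<^sup>2 * indicator (cball 0 R) x) * (norm (grad \<xi> x))\<^sup>2))"
      proof (rule integral_mono')
        fix x
        define v where "v = (\<psi> (mol (r k) x) * \<xi> x) *\<^sub>R grad (mol (r k)) x"
        define z where "z = \<Psi> (mol (r k) x) *\<^sub>R grad \<xi> x"
        have "grad (W k) x = v + z"
          unfolding W_def v_def z_def grad_mult[OF \<Psi>_mol_smooth sm] grad_\<Psi>_mol by (simp add: mult.commute)
        then have "norm (grad (W k) x) \<le> norm v + norm z" using norm_triangle_ineq by simp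
        then have "(norm (grad (W k) x))\<^sup>2 \<le> (norm v + norm z)\<^sup>2" by (intro power_mono) auto
        also have "\<dots> \<le> (1 + s) * (norm v)\<^sup>2 + (1 + 1 / s) * (norm z)\<^sup>2"
        proof -
          have "0 \<le> (s * norm v - norm z)\<^sup>2 / s" using s by simp
          also have "\<dots> = s * (norm v)\<^sup>2 + (norm z)\<^sup>2 / s - 2 * (norm v * norm z)"
            using s by (simp add: power2_eq_square field_simps)
          finally show ?thesis by (simp add: power2_sum algebra_simps)
        qed
        also have "(norm v)\<^sup>2 \<le> (\<psi> (mol (r k) x) * \<xi> x)\<^sup>2 * convolution (\<lambda>x. (norm (g x))\<^sup>2) (mollifier (r k)) x"
        proof -
          have "(norm v)\<^sup>2 = (\<psi> (mol (r k) x) * \<xi> x)\<^sup>2 * (norm (grad (mol (r k)) x))\<^sup>2"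
            unfolding v_def norm_scaleR power_mult_distrib power2_abs ..
          then show ?thesis using grad_mol_square[of "r k" x] by (simp add: mult_left_mono)
        qed
        also have "(norm z)\<^sup>2 = (\<Psi> (mol (r k) x))\<^sup>2 * indicator (cball 0 R) x * (norm (grad \<xi> x))\<^sup>2"
          unfolding rw by (simp add: z_def power_mult_distrib)
        finally show "(norm (grad (W k) x))\<^sup>2 \<le> (1 + s) * ((\<psi> (mol (r k) x) * \<xi> x)\<^sup>2 * convolution (\<lambda>x. (norm (g x))\<^sup>2) (mollifier (r k)) x)
          + (1 + 1 / s) * (((\<Psi> (mol (r k) x))\<^sup>2 * indicator (cball 0 R) x) * (norm (grad \<xi> x))\<^sup>2)"
          using s by simp
        then show "0 \<le> (1 + s) * ((\<psi> (mol (r k) x) * \<xi> x)\<^sup>2 * convolution (\<lambda>x. (norm (g x))\<^sup>2) (mollifier (r k)) x)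
          + (1 + 1 / s) * (((\<Psi> (mol (r k) x))\<^sup>2 * indicator (cball 0 R) x) * (norm (grad \<xi> x))\<^sup>2)"
          by (rule order_trans[rotated]) simp
      qed (use i1 i2 in auto)
      also have "\<dots> = X k" unfolding X_def using i1 i2 by simp
      finally show ?thesis .
    qed
    have "X \<longlonglongrightarrow> (1 + s) * (LINT x|lborel. (\<psi> (P x) * \<xi> x)\<^sup>2 * (norm (g x))\<^sup>2)
        + (1 + 1 / s) * (LINT x|lborel. ((\<Psi> (P x))\<^sup>2 * indicator (cball 0 R) x) * (norm (grad \<xi> x))\<^sup>2)"
      unfolding X_def using l1(1) l2(1) R by (intro tendsto_add tendsto_mult tendsto_const) simp_all
    then show "X \<longlonglongrightarrow> (1 + s) * (LINT x|lborel. (\<psi> (P x) * \<xi> x)\<^sup>2 * (norm (g x))\<^sup>2)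
        + (1 + 1 / s) * (LINT x|lborel. (\<Psi> (P x))\<^sup>2 * (norm (grad \<xi> x))\<^sup>2)"
      by (simp only: rw)
  qed (use W lW in auto)
qed

end

end

subsection \<open>Densities with a pressure gradient\<close>

definition cutoff :: "real \<Rightarrow> 'a::euclidean_space \<Rightarrow> real" where
  "cutoff R x = bump ((1 / R) *\<^sub>R x)"

lemma cutoff_test: "R > 0 \<Longrightarrow> cutoff R \<in> test_functions"
  using test_function_affine[OF bump_test_function, of "1 / R" 0] by (simp add: cutoff_def[abs_def])

lemma cutoff_bounds: "0 \<le> cutoff R x" "cutoff R x \<le> 1"
  by (simp_all add: cutoff_def bump_nonneg bump_le_1)

lemma cutoff_tendsto:
  fixes x :: "'a::euclidean_space"
  assumes "filterlim R at_top F"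
  shows "((\<lambda>j. cutoff (R j) x) \<longlongrightarrow> 1) F"
proof -
  have "((\<lambda>j. (1 / R j) *\<^sub>R x) \<longlongrightarrow> 0 *\<^sub>R x) F"
    by (intro tendsto_intros tendsto_divide_0[OF tendsto_const] filterlim_at_top_imp_at_infinity assms)
  moreover have "isCont bump (0 *\<^sub>R x)"
    using smooth_continuous[OF smooth_bump, of "UNIV :: 'a set"] by (simp add: continuous_on_eq_continuous_at)
  ultimately have "((\<lambda>j. bump ((1 / R j) *\<^sub>R x)) \<longlongrightarrow> bump (0 *\<^sub>R x)) F"
    using isCont_tendsto_compose by blast
  then show ?thesis by (simp add: cutoff_def bump_0)
qed

lemma cutoff_grad:
  obtains L where "L > 0" "\<And>R (x :: 'a::euclidean_space). R > 0 \<Longrightarrow> norm (grad (cutoff R) x) \<le> L / R"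
    "\<And>R (x :: 'a). R > 0 \<Longrightarrow> norm x > R \<Longrightarrow> grad (cutoff R) x = 0"
proof -
  have z: "norm x > 1 \<Longrightarrow> grad bump x = 0" for x :: 'a
    by (rule grad_eq_0_outside[of 1 bump]) (auto simp: bump_eq_0)
  obtain L where L: "L > 0" "\<And>x::'a. norm (grad bump x) \<le> L"
    using bounded_compact_support[OF continuous_grad[OF smooth_bump] z] by metis
  have g: "grad (cutoff R) x = (1 / R) *\<^sub>R grad bump ((1 / R) *\<^sub>R x)" for R and x :: 'a
    using grad_affine[OF smooth_bump, of 0 "1 / R" x] by (simp add: cutoff_def[abs_def])
  show ?thesis
  proof (rule that[OF L(1)])
    show "norm (grad (cutoff R) x) \<le> L / R" if "R > 0" for R and x :: 'a
      using that L(2)[of "(1 / R) *\<^sub>R x"] by (simp add: g divide_right_mono)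
    show "grad (cutoff R) x = 0" if "R > 0" "norm x > R" for R and x :: 'a
      using that z[of "(1 / R) *\<^sub>R x"] by (simp add: g)
  qed
qed

text \<open>The component along \<open>c\<close> of a smooth compactly supported substitute for the field \<open>|x|\<^bsup>-\<gamma>\<^esup> x\<close>,
  and the divergence of that field.\<close>

definition regular_field :: "real \<Rightarrow> real \<Rightarrow> real \<Rightarrow> 'a::euclidean_space \<Rightarrow> 'a \<Rightarrow> real" where
  "regular_field \<gamma> R \<kappa> c x = ((x \<bullet> c) * (x \<bullet> x + \<kappa>) powr (- \<gamma> / 2)) * cutoff R x"

definition regular_field_div :: "real \<Rightarrow> real \<Rightarrow> real \<Rightarrow> 'a::euclidean_space \<Rightarrow> real" where
  "regular_field_div \<gamma> R \<kappa> x = cutoff R x * (real DIM('a) * (x \<bullet> x + \<kappa>) powr (- \<gamma> / 2) - \<gamma> * (x \<bullet> x) * (x \<bullet> x + \<kappa>) powr (- \<gamma> / 2 - 1))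
    + (grad (cutoff R) x \<bullet> x) * (x \<bullet> x + \<kappa>) powr (- \<gamma> / 2)"

lemma radial_weight_smooth: "\<kappa> > 0 \<Longrightarrow> smooth (\<lambda>x::'a::euclidean_space. (x \<bullet> x + \<kappa>) powr a)"
  by (intro smooth_powr smooth_add smooth_inner_self smooth_const) (simp add: add_nonneg_pos)

lemma regular_field_test: "R > 0 \<Longrightarrow> \<kappa> > 0 \<Longrightarrow> regular_field \<gamma> R \<kappa> c \<in> test_functions"
  unfolding regular_field_def[abs_def]
  by (intro test_functions_mult smooth_mult smooth_inner radial_weight_smooth cutoff_test)

lemma regular_field_div_eq:
  assumes "R > 0" "\<kappa> > 0"
  shows "(\<Sum>c\<in>Basis. grad (regular_field \<gamma> R \<kappa> c) x \<bullet> c) = regular_field_div \<gamma> R \<kappa> x"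
proof -
  let ?w = "(x \<bullet> x + \<kappa>) powr (- \<gamma> / 2)" and ?w' = "(x \<bullet> x + \<kappa>) powr (- \<gamma> / 2 - 1)"
  have pos: "x \<bullet> x + \<kappa> > 0" using assms by (simp add: add_nonneg_pos)
  have dw: "((\<lambda>x. (x \<bullet> x + \<kappa>) powr (- \<gamma> / 2)) has_derivative (\<lambda>h. - \<gamma> * ?w' * (x \<bullet> h))) (at x)"
  proof -
    have "((\<lambda>x. x \<bullet> x + \<kappa>) has_derivative (\<lambda>h. 2 * (x \<bullet> h))) (at x)"
      by (auto intro!: derivative_eq_intros simp: inner_commute)
    from DERIV_compose_FDERIV[OF has_real_derivative_powr[OF pos, of "- \<gamma> / 2"] this]
    show ?thesis by (simp add: mult_ac)
  qed
  have gc: "grad (regular_field \<gamma> R \<kappa> c) x \<bullet> c = cutoff R x * (?w * (c \<bullet> c) - \<gamma> * ?w' * ((x \<bullet> c) * (x \<bullet> c)))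
      + ((x \<bullet> c) * (grad (cutoff R) x \<bullet> c)) * ?w" if "c \<in> Basis" for c
  proof -
    have "((\<lambda>x. x \<bullet> c) has_derivative (\<lambda>h. h \<bullet> c)) (at x)" by (auto intro!: derivative_eq_intros)
    from has_derivative_mult[OF has_derivative_mult[OF this dw] smooth_has_derivative_grad[OF test_function_smooth[OF cutoff_test[OF assms(1)]], of x]]
    have "(regular_field \<gamma> R \<kappa> c has_derivative (\<lambda>h. ((x \<bullet> c) * ?w) * (grad (cutoff R) x \<bullet> h) + ((x \<bullet> c) * (- \<gamma> * ?w' * (x \<bullet> h)) + (h \<bullet> c) * ?w) * cutoff R x)) (at x)"
      unfolding regular_field_def[abs_def] .
    then have "(regular_field \<gamma> R \<kappa> c has_derivative (\<lambda>h. (((x \<bullet> c) * ?w) *\<^sub>R grad (cutoff R) x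
        + cutoff R x *\<^sub>R ((- \<gamma> * ?w' * (x \<bullet> c)) *\<^sub>R x + ?w *\<^sub>R c)) \<bullet> h)) (at x)"
      by (rule has_derivative_eq_rhs) (auto simp: inner_add_left inner_commute algebra_simps)
    note gf = grad_eqI[OF this]
    show ?thesis unfolding gf by (simp add: inner_add_left algebra_simps)
  qed
  have "(\<Sum>c\<in>Basis. grad (regular_field \<gamma> R \<kappa> c) x \<bullet> c) = (\<Sum>c\<in>Basis. cutoff R x * (?w * (c \<bullet> c) - \<gamma> * ?w' * ((x \<bullet> c) * (x \<bullet> c)))
      + ((x \<bullet> c) * (grad (cutoff R) x \<bullet> c)) * ?w)"
    by (rule sum.cong[OF refl gc])
  also have "\<dots> = cutoff R x * (?w * (\<Sum>c\<in>(Basis::'a set). c \<bullet> c) - \<gamma> * ?w' * (\<Sum>c\<in>Basis. (x \<bullet> c) * (x \<bullet> c)))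
      + (\<Sum>c\<in>Basis. (x \<bullet> c) * (grad (cutoff R) x \<bullet> c)) * ?w"
    by (simp only: sum.distrib sum_subtractf sum_distrib_left[symmetric] sum_distrib_right[symmetric])
  also have "(\<Sum>c\<in>(Basis::'a set). c \<bullet> c) = real DIM('a)" by simp
  also have "(\<Sum>c\<in>Basis. (x \<bullet> c) * (x \<bullet> c)) = x \<bullet> x" by (rule euclidean_inner[symmetric])
  also have "(\<Sum>c\<in>Basis. (x \<bullet> c) * (grad (cutoff R) x \<bullet> c)) = grad (cutoff R) x \<bullet> x"
    by (subst inner_commute) (rule euclidean_inner[symmetric])
  finally show ?thesis by (simp add: regular_field_div_def mult_ac)
qed

text \<open>Kept apart from the finite energy assumed in \<open>pressure_density\<close>: the
  measurability derived here goes into the proof that this energy is finite.\<close>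

locale pressure_field =
  fixes m :: real and u :: "'a::euclidean_space \<Rightarrow> real" and G :: "'a \<Rightarrow> 'a"
  assumes m01: "0 < m" "m < 1"
    and u_nonneg: "\<And>x. u x \<ge> 0"
    and u_meas [measurable]: "u \<in> borel_measurable borel"
    and pressure: "is_pressure_gradient m u G"
begin

definition trunc_pressure :: "real \<Rightarrow> 'a \<Rightarrow> real" where
  "trunc_pressure \<epsilon> x = max (u x) \<epsilon> powr (m - 1)"

definition trunc_gradient :: "real \<Rightarrow> 'a \<Rightarrow> 'a" where
  "trunc_gradient \<epsilon> x = indicator {y. u y > \<epsilon>} x *\<^sub>R G x"

lemma trunc_gradient_meas: "\<epsilon> > 0 \<Longrightarrow> trunc_gradient \<epsilon> \<in> borel_measurable borel"
  using pressure locally_integrable_measurable[of "trunc_gradient \<epsilon>"]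
  unfolding is_pressure_gradient_def has_weak_gradient_def trunc_gradient_def[abs_def] by simp

lemma trunc_gradient_tendsto:
  assumes e: "e \<longlonglongrightarrow> 0" and u: "u x > 0"
  shows "(\<lambda>j::nat. trunc_gradient (e j) x) \<longlonglongrightarrow> G x"
  using order_tendstoD(2)[OF e u] by (intro tendsto_eventually) (auto elim: eventually_mono simp: trunc_gradient_def)

text \<open>\<open>G\<close> is arbitrary where \<open>u\<close> vanishes, so it need not be
  measurable itself. On {u > 0} it is the limit of the truncated gradients, and the factor
  \<open>u\<close> removes the rest.\<close>

lemma uG_meas: "(\<lambda>x. u x *\<^sub>R G x) \<in> borel_measurable borel"
proof (rule borel_measurable_LIMSEQ_metric)
  show "(\<lambda>x. u x *\<^sub>R trunc_gradient (1 / real (Suc j)) x) \<in> borel_measurable borel" for j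
    using trunc_gradient_meas[of "1 / real (Suc j)"] by measurable
  show "(\<lambda>j. u x *\<^sub>R trunc_gradient (1 / real (Suc j)) x) \<longlonglongrightarrow> u x *\<^sub>R G x" for x
  proof (cases "u x = 0")
    case False
    then have "u x > 0" using u_nonneg[of x] by simp
    then show ?thesis by (intro tendsto_intros trunc_gradient_tendsto LIMSEQ_inverse_real_of_nat[unfolded inverse_eq_divide])
  qed simp
qed

lemma u_G_square_meas: "(\<lambda>x. u x * (norm (G x))\<^sup>2) \<in> borel_measurable borel"
proof -
  have "(\<lambda>x. (norm (u x *\<^sub>R G x))\<^sup>2 / u x) \<in> borel_measurable borel"
    using uG_meas by measurable
  \<comment> \<open>The square of the norm of \<open>u x *\<^sub>R G x\<close> is divided by
    \<open>u\<close>; on the zero set of \<open>u\<close> this is 0 / 0 = 0.\<close>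
  moreover have "(norm (u x *\<^sub>R G x))\<^sup>2 / u x = u x * (norm (G x))\<^sup>2" for x
    using u_nonneg[of x] by (cases "u x = 0") (simp_all add: power_mult_distrib power2_eq_square)
  ultimately show ?thesis by simp
qed

end

locale pressure_density = pressure_field m u G
  for m :: real and u :: "'a::euclidean_space \<Rightarrow> real" and G :: "'a \<Rightarrow> 'a" +
  assumes G_energy: "integrable lborel (\<lambda>x. u x * (norm (G x))\<^sup>2)"
begin

lemma bounded_weak_gradient:
  assumes "\<epsilon> > 0"
  shows "bounded_weak_gradient (trunc_pressure \<epsilon>) (trunc_gradient \<epsilon>) (\<epsilon> powr (m - 1))"
proof
  show "has_weak_gradient (trunc_pressure \<epsilon>) (trunc_gradient \<epsilon>)"
    using pressure assms unfolding is_pressure_gradient_def trunc_pressure_def[abs_def] trunc_gradient_def[abs_def] by blast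
  show "0 \<le> trunc_pressure \<epsilon> x" for x by (simp add: trunc_pressure_def)
  show "trunc_pressure \<epsilon> x \<le> \<epsilon> powr (m - 1)" for x
    unfolding trunc_pressure_def using assms m01 by (intro powr_mono2') auto
  show "integrable lborel (\<lambda>x. (norm (trunc_gradient \<epsilon> x))\<^sup>2)"
  proof (rule Bochner_Integration.integrable_bound)
    show "integrable lborel (\<lambda>x. 1 / \<epsilon> * (u x * (norm (G x))\<^sup>2))" using G_energy by (rule integrable_mult_right)
    show "(\<lambda>x. (norm (trunc_gradient \<epsilon> x))\<^sup>2) \<in> borel_measurable lborel" using trunc_gradient_meas[OF assms] by simp
    show "AE x in lborel. norm ((norm (trunc_gradient \<epsilon> x))\<^sup>2) \<le> norm (1 / \<epsilon> * (u x * (norm (G x))\<^sup>2))"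
    proof (rule AE_I2)
      fix x
      show "norm ((norm (trunc_gradient \<epsilon> x))\<^sup>2) \<le> norm (1 / \<epsilon> * (u x * (norm (G x))\<^sup>2))"
      proof (cases "u x > \<epsilon>")
        case True
        then have "1 * (norm (G x))\<^sup>2 \<le> (u x / \<epsilon>) * (norm (G x))\<^sup>2"
          using assms by (intro mult_right_mono) auto
        then show ?thesis using True u_nonneg[of x] assms by (simp add: trunc_gradient_def abs_mult)
      qed (simp add: trunc_gradient_def)
    qed
  qed
qed

lemma trunc_pressure_eq: "u x > \<epsilon> \<Longrightarrow> trunc_pressure \<epsilon> x = u x powr (m - 1)"
  and trunc_pressure_eq': "u x \<le> \<epsilon> \<Longrightarrow> trunc_pressure \<epsilon> x = \<epsilon> powr (m - 1)"
  by (auto simp: trunc_pressure_def max_def)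

lemma shifted_pressure_bounds:
  assumes "\<epsilon> > 0" "\<eta> > 0" "q > 0"
  shows "0 \<le> shifted_power q \<eta> (\<epsilon> powr (m - 1)) (trunc_pressure \<epsilon> x)"
    "shifted_power q \<eta> (\<epsilon> powr (m - 1)) (trunc_pressure \<epsilon> x) \<le> indicator {y. u y > \<epsilon>} x * u x powr ((1 - m) * q)"
proof -
  interpret bounded_weak_gradient "trunc_pressure \<epsilon>" "trunc_gradient \<epsilon>" "\<epsilon> powr (m - 1)"
    by (rule bounded_weak_gradient[OF assms(1)])
  show "0 \<le> shifted_power q \<eta> (\<epsilon> powr (m - 1)) (trunc_pressure \<epsilon> x)"
    by (rule shifted_power_bounds(1)[OF assms(3,2) P_bounds])
  show "shifted_power q \<eta> (\<epsilon> powr (m - 1)) (trunc_pressure \<epsilon> x) \<le> indicator {y. u y > \<epsilon>} x * u x powr ((1 - m) * q)"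
  proof (cases "u x > \<epsilon>")
    case True
    then have "shifted_power q \<eta> (\<epsilon> powr (m - 1)) (trunc_pressure \<epsilon> x) \<le> trunc_pressure \<epsilon> x powr (-q)"
      using assms by (intro shifted_power_bounds(3) P_bounds) (auto simp: trunc_pressure_eq)
    also have "\<dots> = u x powr ((1 - m) * q)" using True by (simp add: trunc_pressure_eq powr_powr algebra_simps)
    finally show ?thesis using True by simp
  qed (simp add: trunc_pressure_eq' shifted_power_def)
qed

lemma shifted_pressure_slope_bound:
  assumes "\<epsilon> > 0" "\<eta> > 0" "q > 0" "u x > \<epsilon>"
  shows "\<bar>- q * (trunc_pressure \<epsilon> x + \<eta>) powr (- q - 1)\<bar> \<le> q * u x powr ((1 - m) * (q + 1))"
proof -
  have "(trunc_pressure \<epsilon> x + \<eta>) powr (- q - 1) \<le> trunc_pressure \<epsilon> x powr (- q - 1)"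
    using assms by (intro powr_mono2') (auto simp: trunc_pressure_eq)
  also have "\<dots> = u x powr ((1 - m) * (q + 1))"
    using assms by (simp add: trunc_pressure_eq powr_powr algebra_simps)
  finally show ?thesis using assms by (simp add: abs_mult)
qed

text \<open>Truncation level and shift are the same null sequence \<open>e\<close>. The constant
  subtracted in \<open>shifted_power\<close> is at most \<open>e j powr ((1 - m) * q)\<close> and
  disappears in the limit.\<close>

lemma shifted_pressure_tendsto:
  assumes e: "e \<longlonglongrightarrow> 0" "\<And>j. e j > 0" and q: "q > 0"
  shows "(\<lambda>j::nat. shifted_power q (e j) (e j powr (m - 1)) (trunc_pressure (e j) x)) \<longlonglongrightarrow> u x powr ((1 - m) * q)"
proof (cases "u x = 0")
  case True
  then have "shifted_power q (e j) (e j powr (m - 1)) (trunc_pressure (e j) x) = 0" for j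
    using e(2)[of j] by (simp add: trunc_pressure_eq' shifted_power_def)
  then show ?thesis using True by simp
next
  case False
  then have u: "u x > 0" using u_nonneg[of x] by simp
  have ev: "eventually (\<lambda>j. u x > e j) sequentially" using order_tendstoD(2)[OF e(1) u] .
  have "(\<lambda>j. (u x powr (m - 1) + e j) powr (-q)) \<longlonglongrightarrow> (u x powr (m - 1) + 0) powr (-q)"
    using u e by (intro tendsto_intros) auto
  moreover have "(\<lambda>j. (e j powr (m - 1) + e j) powr (-q)) \<longlonglongrightarrow> 0"
  proof (rule Lim_null_comparison)
    show "\<forall>\<^sub>F j in sequentially. norm ((e j powr (m - 1) + e j) powr (-q)) \<le> e j powr ((1 - m) * q)"
    proof (rule always_eventually, rule allI)
      fix j
      have "(e j powr (m - 1) + e j) powr (-q) \<le> (e j powr (m - 1)) powr (-q)"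
        using e(2)[of j] q by (intro powr_mono2') auto
      then show "norm ((e j powr (m - 1) + e j) powr (-q)) \<le> e j powr ((1 - m) * q)"
        using e(2)[of j] by (simp add: powr_powr algebra_simps)
    qed
    have "(\<lambda>j. e j powr ((1 - m) * q)) \<longlonglongrightarrow> 0 powr ((1 - m) * q)"
      using e q m01 by (intro tendsto_powr') (auto simp: less_imp_le)
    then show "(\<lambda>j. e j powr ((1 - m) * q)) \<longlonglongrightarrow> 0" by simp
  qed
  ultimately have "(\<lambda>j. (u x powr (m - 1) + e j) powr (-q) - (e j powr (m - 1) + e j) powr (-q)) \<longlonglongrightarrow> (u x powr (m - 1) + 0) powr (-q) - 0"
    by (rule tendsto_diff)
  then have "(\<lambda>j. (u x powr (m - 1) + e j) powr (-q) - (e j powr (m - 1) + e j) powr (-q)) \<longlonglongrightarrow> u x powr ((1 - m) * q)"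
    using u by (simp add: powr_powr algebra_simps)
  then show ?thesis
    by (rule Lim_transform_eventually)
      (use ev in \<open>eventually_elim, simp add: shifted_power_def trunc_pressure_eq\<close>)
qed

lemma shifted_pressure_slope_tendsto:
  assumes e: "e \<longlonglongrightarrow> 0" "\<And>j. e j > 0" and u: "u x > 0"
  shows "(\<lambda>j::nat. - q * (trunc_pressure (e j) x + e j) powr (- q - 1)) \<longlonglongrightarrow> - q * u x powr ((1 - m) * (q + 1))"
proof -
  have ev: "eventually (\<lambda>j. u x > e j) sequentially" using order_tendstoD(2)[OF e(1) u] .
  have "(\<lambda>j. - q * (u x powr (m - 1) + e j) powr (- q - 1)) \<longlonglongrightarrow> - q * (u x powr (m - 1) + 0) powr (- q - 1)"
    using u e by (intro tendsto_intros) auto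
  then have "(\<lambda>j. - q * (u x powr (m - 1) + e j) powr (- q - 1)) \<longlonglongrightarrow> - q * u x powr ((1 - m) * (q + 1))"
    using u by (simp add: powr_powr algebra_simps)
  then show ?thesis
    by (rule Lim_transform_eventually) (use ev in \<open>eventually_elim, simp add: trunc_pressure_eq\<close>)
qed

text \<open>\<open>weak_product_rule\<close> with the components of the regularized field as test
  functions, summed over the coordinates.\<close>

lemma truncated_flux_identity:
  assumes "\<epsilon> > 0" "\<eta> > 0" "q > 0" "R > 0" "\<kappa> > 0"
  defines "\<Psi> \<equiv> shifted_power q \<eta> (\<epsilon> powr (m - 1))"
  shows "(LINT x|lborel. - q * (trunc_pressure \<epsilon> x + \<eta>) powr (- q - 1) * (cutoff R x * (x \<bullet> x + \<kappa>) powr (- \<gamma> / 2) * (trunc_gradient \<epsilon> x \<bullet> x)))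
    + (LINT x|lborel. \<Psi> (trunc_pressure \<epsilon> x) * regular_field_div \<gamma> R \<kappa> x) = 0"
proof -
  interpret bounded_weak_gradient "trunc_pressure \<epsilon>" "trunc_gradient \<epsilon>" "\<epsilon> powr (m - 1)"
    by (rule bounded_weak_gradient[OF assms(1)])
  note wpr = weak_product_rule[OF assms(3,2) regular_field_test[OF assms(4,5)]]
  let ?\<psi> = "\<lambda>x. - q * (trunc_pressure \<epsilon> x + \<eta>) powr (- q - 1)"
  have "(\<Sum>c\<in>Basis. (LINT x|lborel. (?\<psi> x * regular_field \<gamma> R \<kappa> c x) * (trunc_gradient \<epsilon> x \<bullet> c))
      + (LINT x|lborel. \<Psi> (trunc_pressure \<epsilon> x) * (grad (regular_field \<gamma> R \<kappa> c) x \<bullet> c))) = 0"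
    unfolding \<Psi>_def by (intro sum.neutral ballI wpr(1))
  then have "(LINT x|lborel. (\<Sum>c\<in>Basis. (?\<psi> x * regular_field \<gamma> R \<kappa> c x) * (trunc_gradient \<epsilon> x \<bullet> c)))
      + (LINT x|lborel. (\<Sum>c\<in>Basis. \<Psi> (trunc_pressure \<epsilon> x) * (grad (regular_field \<gamma> R \<kappa> c) x \<bullet> c))) = 0"
    using wpr(2,3) unfolding \<Psi>_def sum.distrib
    by (subst (1 2) Bochner_Integration.integral_sum) auto
  moreover have "(\<Sum>c\<in>Basis. (?\<psi> x * regular_field \<gamma> R \<kappa> c x) * (trunc_gradient \<epsilon> x \<bullet> c))
      = ?\<psi> x * (cutoff R x * (x \<bullet> x + \<kappa>) powr (- \<gamma> / 2) * (trunc_gradient \<epsilon> x \<bullet> x))" for x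
    unfolding euclidean_inner[of "trunc_gradient \<epsilon> x" x] sum_distrib_left
    by (rule sum.cong) (simp_all add: regular_field_def mult_ac)
  moreover have "(\<Sum>c\<in>Basis. \<Psi> (trunc_pressure \<epsilon> x) * (grad (regular_field \<gamma> R \<kappa> c) x \<bullet> c)) = \<Psi> (trunc_pressure \<epsilon> x) * regular_field_div \<gamma> R \<kappa> x" for x
    unfolding sum_distrib_left[symmetric] regular_field_div_eq[OF assms(4,5)] ..
  ultimately show ?thesis by simp
qed

text \<open>Formally u grad u^(m-1) = - (1 - m)/m grad u^m, and the field |x|^(-\<gamma>) x has the
  divergence (d - \<gamma>) |x|^(-\<gamma>). In the limit of the truncated identity, energy and
  second moment dominate one integral, and u^m with its weight the other.\<close>

lemma flux_identity:
  assumes \<gamma>: "0 < \<gamma>" "\<gamma> < real DIM('a)"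
    and um: "integrable lborel (\<lambda>x. u x powr m * norm x powr (-\<gamma>))"
    and mom: "integrable lborel (\<lambda>x. u x * norm x powr (2 - 2 * \<gamma>))"
  shows "(LINT x|lborel. u x * (G x \<bullet> x) * norm x powr (-\<gamma>))
      = (1 - m) / m * (real DIM('a) - \<gamma>) * (LINT x|lborel. u x powr m * norm x powr (-\<gamma>))"
    and "integrable lborel (\<lambda>x. u x * (G x \<bullet> x) * norm x powr (-\<gamma>))"
proof -
  \<comment> \<open>With this exponent \<open>shifted_power\<close> of the pressure tends to u^m and
    its slope to - q u.\<close>
  define q where "q = m / (1 - m)"
  have q: "q > 0" "(1 - m) * q = m" "(1 - m) * (q + 1) = 1"
    using m01 by (auto simp: q_def field_simps)
  define e where "e = (\<lambda>j::nat. 1 / real (Suc j))"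
  have e: "e \<longlonglongrightarrow> 0" "\<And>j. e j > 0"
    unfolding e_def using LIMSEQ_inverse_real_of_nat by (auto simp: inverse_eq_divide)
  define Rj where "Rj = (\<lambda>j::nat. real (Suc j))"
  have Rj: "filterlim Rj at_top sequentially" "\<And>j. Rj j > 0"
    unfolding Rj_def using filterlim_compose[OF filterlim_real_sequentially filterlim_Suc] by auto
  obtain L where L: "L > 0" "\<And>R (x :: 'a). R > 0 \<Longrightarrow> norm (grad (cutoff R) x) \<le> L / R"
    "\<And>R (x :: 'a). R > 0 \<Longrightarrow> norm x > R \<Longrightarrow> grad (cutoff R) x = 0"
    using cutoff_grad by metis
  define w where "w = (\<lambda>j x::'a. (x \<bullet> x + e j) powr (- \<gamma> / 2))"
  have w_le: "0 \<le> w j x" "x \<noteq> 0 \<Longrightarrow> w j x \<le> norm x powr (-\<gamma>)" for j x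
  proof -
    show "0 \<le> w j x" by (simp add: w_def)
    assume x: "x \<noteq> 0"
    have "w j x \<le> (x \<bullet> x) powr (- \<gamma> / 2)"
      unfolding w_def using \<gamma> e(2)[of j] x by (intro powr_mono2') auto
    also have "\<dots> = norm x powr (-\<gamma>)"
      using x by (simp add: dot_square_norm powr_powr flip: powr_numeral)
    finally show "w j x \<le> norm x powr (-\<gamma>)" .
  qed
  have w_lim: "(\<lambda>j. w j x) \<longlonglongrightarrow> norm x powr (-\<gamma>)" if "x \<noteq> 0" for x
  proof -
    have "(\<lambda>j. w j x) \<longlonglongrightarrow> (x \<bullet> x + 0) powr (- \<gamma> / 2)"
      unfolding w_def using that e by (intro tendsto_intros) auto
    then show ?thesis using that by (simp add: dot_square_norm powr_powr flip: powr_numeral)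
  qed
  define F where "F = (\<lambda>j x. - q * (trunc_pressure (e j) x + e j) powr (- q - 1) * (cutoff (Rj j) x * w j x * (trunc_gradient (e j) x \<bullet> x)))"
  define H where "H = (\<lambda>j x. shifted_power q (e j) (e j powr (m - 1)) (trunc_pressure (e j) x) * regular_field_div \<gamma> (Rj j) (e j) x)"
  have id: "(LINT x|lborel. F j x) + (LINT x|lborel. H j x) = 0" for j
    unfolding F_def H_def w_def by (rule truncated_flux_identity) (use e(2) Rj(2) q in auto)
  have [measurable]: "trunc_pressure t \<in> borel_measurable borel" for t unfolding trunc_pressure_def[abs_def] by measurable
  have [measurable]: "cutoff (Rj j) \<in> borel_measurable borel" for j
    by (intro borel_measurable_continuous_onI smooth_continuous test_function_smooth cutoff_test Rj)
  have [measurable]: "grad (cutoff (Rj j)) \<in> borel_measurable borel" for j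
    by (intro borel_measurable_continuous_onI continuous_grad test_function_smooth cutoff_test Rj)
  have [measurable]: "trunc_gradient (e j) \<in> borel_measurable borel" for j by (rule trunc_gradient_meas[OF e(2)])
  have [measurable]: "(\<lambda>x. u x *\<^sub>R G x) \<in> borel_measurable borel" by (rule uG_meas)
  have ae0: "AE x in lborel. x \<noteq> (0::'a)" by (rule AE_lborel_singleton)
  \<comment> \<open>The dominating function of the flux: 2 a b \<le> a^2 + b^2 with b = |x|^(1 -
    \<gamma>), whose square carries the weight of the second moment.\<close>
  have CS: "u x * norm (G x) * (norm x * norm x powr (-\<gamma>)) \<le> u x * (norm (G x))\<^sup>2 + u x * norm x powr (2 - 2 * \<gamma>)" for x
  proof -
    let ?b = "norm x * norm x powr (-\<gamma>)"
    have b: "?b\<^sup>2 = norm x powr (2 - 2 * \<gamma>)"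
    proof (cases "x = 0")
      case False
      have "?b = norm x powr (1 - \<gamma>)" using False by (simp add: powr_diff powr_minus divide_inverse)
      then show ?thesis using False by (simp add: power2_eq_square flip: powr_add)
    qed simp
    have "norm (G x) * ?b \<le> (norm (G x))\<^sup>2 + ?b\<^sup>2"
    proof -
      have "2 * norm (G x) * ?b \<le> (norm (G x))\<^sup>2 + ?b\<^sup>2" by (rule sum_squares_bound)
      moreover have "0 \<le> norm (G x) * ?b" by simp
      ultimately show ?thesis unfolding mult.assoc[of 2] by linarith
    qed
    then have "u x * (norm (G x) * ?b) \<le> u x * ((norm (G x))\<^sup>2 + ?b\<^sup>2)"
      by (rule mult_left_mono) (rule u_nonneg)
    then show ?thesis unfolding b by (simp add: algebra_simps)
  qed
  have dom: "integrable lborel (\<lambda>x. q * (u x * (norm (G x))\<^sup>2 + u x * norm x powr (2 - 2 * \<gamma>)))"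
    using G_energy mom by simp
  have flux_int: "integrable lborel (\<lambda>x. (u x *\<^sub>R G x) \<bullet> x * norm x powr (-\<gamma>))"
  proof (rule Bochner_Integration.integrable_bound)
    show "integrable lborel (\<lambda>x. u x * (norm (G x))\<^sup>2 + u x * norm x powr (2 - 2 * \<gamma>))" using G_energy mom by simp
    show "AE x in lborel. norm ((u x *\<^sub>R G x) \<bullet> x * norm x powr (-\<gamma>)) \<le> norm (u x * (norm (G x))\<^sup>2 + u x * norm x powr (2 - 2 * \<gamma>))"
    proof (rule AE_I2)
      fix x
      have "\<bar>(u x *\<^sub>R G x) \<bullet> x\<bar> \<le> u x * norm (G x) * norm x"
        using Cauchy_Schwarz_ineq2[of "u x *\<^sub>R G x" x] u_nonneg[of x] by simp
      then have "\<bar>(u x *\<^sub>R G x) \<bullet> x\<bar> * norm x powr (-\<gamma>) \<le> u x * norm (G x) * norm x * norm x powr (-\<gamma>)"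
        by (rule mult_right_mono) simp
      then show "norm ((u x *\<^sub>R G x) \<bullet> x * norm x powr (-\<gamma>)) \<le> norm (u x * (norm (G x))\<^sup>2 + u x * norm x powr (2 - 2 * \<gamma>))"
        using CS[of x] u_nonneg[of x] by (simp add: abs_mult mult.assoc)
    qed
  qed measurable
  then show flux_int': "integrable lborel (\<lambda>x. u x * (G x \<bullet> x) * norm x powr (-\<gamma>))" by simp
  have limF: "(\<lambda>j. LINT x|lborel. F j x) \<longlonglongrightarrow> (LINT x|lborel. - q * ((u x *\<^sub>R G x) \<bullet> x * norm x powr (-\<gamma>)))"
  proof (rule integral_dominated_convergence[OF _ _ dom])
    show "AE x in lborel. (\<lambda>j. F j x) \<longlonglongrightarrow> - q * ((u x *\<^sub>R G x) \<bullet> x * norm x powr (-\<gamma>))"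
      using ae0
    proof eventually_elim
      case (elim x)
      show ?case
      proof (cases "u x = 0")
        case True
        then have "F j x = 0" for j using e(2)[of j] by (simp add: F_def trunc_gradient_def)
        then show ?thesis using True by simp
      next
        case False
        then have u: "u x > 0" using u_nonneg[of x] by simp
        have "(\<lambda>j. F j x) \<longlonglongrightarrow> - q * u x powr ((1 - m) * (q + 1)) * (1 * norm x powr (-\<gamma>) * (G x \<bullet> x))"
          unfolding F_def
          by (intro tendsto_mult shifted_pressure_slope_tendsto e u cutoff_tendsto Rj w_lim elim tendsto_inner trunc_gradient_tendsto tendsto_const)
        then show ?thesis using q u by (simp add: mult_ac)
      qed
    qed
    show "AE x in lborel. norm (F j x) \<le> q * (u x * (norm (G x))\<^sup>2 + u x * norm x powr (2 - 2 * \<gamma>))" for j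
      using ae0
    proof eventually_elim
      case (elim x)
      show ?case
      proof (cases "u x > e j")
        case True
        have u: "u x > 0" using True e(2)[of j] by linarith
        have 1: "\<bar>- q * (trunc_pressure (e j) x + e j) powr (- q - 1)\<bar> \<le> q * u x"
          using shifted_pressure_slope_bound[OF e(2)[of j] e(2)[of j] q(1) True] q(3) u by simp
        have "\<bar>cutoff (Rj j) x * w j x * (trunc_gradient (e j) x \<bullet> x)\<bar> \<le> (1 * norm x powr (-\<gamma>)) * (norm (G x) * norm x)"
          unfolding abs_mult using cutoff_bounds[of "Rj j" x] w_le(1)[of j x] w_le(2)[OF elim, of j] elim True Cauchy_Schwarz_ineq2[of "G x" x]
          by (intro mult_mono) (auto simp: trunc_gradient_def)
        then have "norm (F j x) \<le> (q * u x) * ((1 * norm x powr (-\<gamma>)) * (norm (G x) * norm x))"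
          unfolding F_def real_norm_def abs_mult[of "- q * (trunc_pressure (e j) x + e j) powr (- q - 1)"]
          using 1 q u by (intro mult_mono) auto
        also have "\<dots> = q * (u x * norm (G x) * (norm x * norm x powr (-\<gamma>)))" by (simp add: mult_ac)
        also have "\<dots> \<le> q * (u x * (norm (G x))\<^sup>2 + u x * norm x powr (2 - 2 * \<gamma>))"
          using CS[of x] q by (intro mult_left_mono) auto
        finally show ?thesis .
      next
        case False
        then have "F j x = 0" by (simp add: F_def trunc_gradient_def)
        then show ?thesis using q u_nonneg[of x] by simp
      qed
    qed
    show "(\<lambda>x. - q * ((u x *\<^sub>R G x) \<bullet> x * norm x powr (-\<gamma>))) \<in> borel_measurable lborel" by measurable
    show "F j \<in> borel_measurable lborel" for j unfolding F_def w_def by measurable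
  qed
  let ?d = "real DIM('a)"
  have limH: "(\<lambda>j. LINT x|lborel. H j x) \<longlonglongrightarrow> (LINT x|lborel. (?d - \<gamma>) * (u x powr m * norm x powr (-\<gamma>)))"
  proof (rule integral_dominated_convergence)
    show "integrable lborel (\<lambda>x. (?d + \<gamma> + L) * (u x powr m * norm x powr (-\<gamma>)))" using um by simp
    show "AE x in lborel. (\<lambda>j. H j x) \<longlonglongrightarrow> (?d - \<gamma>) * (u x powr m * norm x powr (-\<gamma>))"
      using ae0
    proof eventually_elim
      case (elim x)
      have w1: "(\<lambda>j. (x \<bullet> x + e j) powr (- \<gamma> / 2 - 1)) \<longlonglongrightarrow> (x \<bullet> x + 0) powr (- \<gamma> / 2 - 1)"
        using elim e by (intro tendsto_intros) auto
      have xx: "(x \<bullet> x) * (x \<bullet> x) powr (- \<gamma> / 2 - 1) = norm x powr (-\<gamma>)"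
      proof -
        have "(x \<bullet> x) * (x \<bullet> x) powr (- \<gamma> / 2 - 1) = (x \<bullet> x) powr (- \<gamma> / 2)"
          using elim by (simp add: powr_mult_base)
        also have "\<dots> = norm x powr (-\<gamma>)"
          using elim by (simp add: dot_square_norm powr_powr flip: powr_numeral)
        finally show ?thesis .
      qed
      have "(\<lambda>j. L / Rj j) \<longlonglongrightarrow> 0"
        by (intro tendsto_divide_0[OF tendsto_const] filterlim_at_top_imp_at_infinity Rj)
      then have "(\<lambda>j. grad (cutoff (Rj j)) x) \<longlonglongrightarrow> 0"
        by (rule Lim_null_comparison[rotated]) (use L(2)[OF Rj(2)] in auto)
      then have "(\<lambda>j. regular_field_div \<gamma> (Rj j) (e j) x) \<longlonglongrightarrow>
          1 * (?d * norm x powr (-\<gamma>) - \<gamma> * (x \<bullet> x) * (x \<bullet> x + 0) powr (- \<gamma> / 2 - 1)) + (0 \<bullet> x) * norm x powr (-\<gamma>)"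
        unfolding regular_field_div_def
        by (intro tendsto_add tendsto_mult tendsto_diff tendsto_const tendsto_inner cutoff_tendsto Rj w_lim[OF elim, unfolded w_def] w1)
      then have "(\<lambda>j. regular_field_div \<gamma> (Rj j) (e j) x) \<longlonglongrightarrow> (?d - \<gamma>) * norm x powr (-\<gamma>)"
        using xx by (simp add: mult.assoc algebra_simps)
      from tendsto_mult[OF shifted_pressure_tendsto[OF e q(1), of x] this]
      show ?case unfolding H_def q(2) by (simp add: mult_ac)
    qed
    show "AE x in lborel. norm (H j x) \<le> (?d + \<gamma> + L) * (u x powr m * norm x powr (-\<gamma>))" for j
      using ae0
    proof eventually_elim
      case (elim x)
      let ?n = "norm x powr (-\<gamma>)"
      have wj: "0 \<le> w j x" "w j x \<le> ?n" using w_le elim by auto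
      have "(x \<bullet> x) * (x \<bullet> x + e j) powr (- \<gamma> / 2 - 1) \<le> (x \<bullet> x + e j) * (x \<bullet> x + e j) powr (- \<gamma> / 2 - 1)"
        using e(2)[of j] by (intro mult_right_mono) auto
      also have "\<dots> = w j x" unfolding w_def using e(2)[of j] by (simp add: powr_mult_base add_nonneg_pos)
      finally have w2: "(x \<bullet> x) * (x \<bullet> x + e j) powr (- \<gamma> / 2 - 1) \<le> ?n" using wj by simp
      \<comment> \<open>The gradient of the cutoff has size L / R and lives in the ball of radius R,
        so its product with \<open>x\<close> stays bounded while it tends to 0 pointwise.\<close>
      have gx: "\<bar>grad (cutoff (Rj j)) x \<bullet> x\<bar> \<le> L"
      proof (cases "norm x > Rj j")
        case True
        then show ?thesis using L Rj(2) by simp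
      next
        case False
        have "\<bar>grad (cutoff (Rj j)) x \<bullet> x\<bar> \<le> norm (grad (cutoff (Rj j)) x) * norm x"
          by (rule Cauchy_Schwarz_ineq2)
        also have "\<dots> \<le> (L / Rj j) * Rj j"
          using L(2)[OF Rj(2)[of j], of x] False Rj(2)[of j] L(1) by (intro mult_mono) auto
        also have "\<dots> = L" using Rj(2)[of j] by simp
        finally show ?thesis .
      qed
      have "\<bar>regular_field_div \<gamma> (Rj j) (e j) x\<bar> \<le> 1 * (?d * ?n + \<gamma> * ?n) + L * ?n"
      proof -
        have "\<bar>cutoff (Rj j) x * (?d * w j x - \<gamma> * ((x \<bullet> x) * (x \<bullet> x + e j) powr (- \<gamma> / 2 - 1)))\<bar> \<le> 1 * (?d * ?n + \<gamma> * ?n)"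
          unfolding abs_mult[of "cutoff (Rj j) x"]
        proof (intro mult_mono)
          have "\<bar>?d * w j x\<bar> \<le> ?d * ?n" using wj by (simp add: abs_mult mult_left_mono)
          moreover have "\<bar>\<gamma> * ((x \<bullet> x) * (x \<bullet> x + e j) powr (- \<gamma> / 2 - 1))\<bar> \<le> \<gamma> * ?n"
            using w2 \<gamma> by (simp add: abs_mult mult_left_mono)
          ultimately show "\<bar>?d * w j x - \<gamma> * ((x \<bullet> x) * (x \<bullet> x + e j) powr (- \<gamma> / 2 - 1))\<bar> \<le> ?d * ?n + \<gamma> * ?n"
            by linarith
        qed (use cutoff_bounds[of "Rj j" x] in auto)
        moreover have "\<bar>(grad (cutoff (Rj j)) x \<bullet> x) * w j x\<bar> \<le> L * ?n"
          unfolding abs_mult using gx wj L by (intro mult_mono) auto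
        ultimately show ?thesis unfolding regular_field_div_def w_def[symmetric] by (simp add: mult.assoc w_def)
      qed
      also have "\<dots> = (?d + \<gamma> + L) * ?n" by (simp add: algebra_simps)
      finally have fd: "\<bar>regular_field_div \<gamma> (Rj j) (e j) x\<bar> \<le> (?d + \<gamma> + L) * ?n" .
      have "\<bar>shifted_power q (e j) (e j powr (m - 1)) (trunc_pressure (e j) x)\<bar> \<le> u x powr m"
      proof -
        have "indicator {y. u y > e j} x * u x powr ((1 - m) * q) \<le> u x powr m" using q by (simp add: indicator_def)
        then show ?thesis using shifted_pressure_bounds[OF e(2)[of j] e(2)[of j] q(1), of x] by linarith
      qed
      then have "norm (H j x) \<le> u x powr m * ((?d + \<gamma> + L) * ?n)"
        unfolding H_def real_norm_def abs_mult using fd by (intro mult_mono) auto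
      then show ?case by (simp add: mult_ac)
    qed
    show "(\<lambda>x. (?d - \<gamma>) * (u x powr m * norm x powr (-\<gamma>))) \<in> borel_measurable lborel" by measurable
    show "H j \<in> borel_measurable lborel" for j unfolding H_def regular_field_div_def shifted_power_def by measurable
  qed
  have "(\<lambda>j. (LINT x|lborel. F j x) + (LINT x|lborel. H j x)) \<longlonglongrightarrow>
      (LINT x|lborel. - q * ((u x *\<^sub>R G x) \<bullet> x * norm x powr (-\<gamma>))) + (LINT x|lborel. (?d - \<gamma>) * (u x powr m * norm x powr (-\<gamma>)))"
    by (rule tendsto_add[OF limF limH])
  from LIMSEQ_unique[OF this[unfolded id] tendsto_const]
  have "q * (LINT x|lborel. (u x *\<^sub>R G x) \<bullet> x * norm x powr (-\<gamma>)) = (?d - \<gamma>) * (LINT x|lborel. u x powr m * norm x powr (-\<gamma>))"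
    by simp
  then show "(LINT x|lborel. u x * (G x \<bullet> x) * norm x powr (-\<gamma>))
      = (1 - m) / m * (real DIM('a) - \<gamma>) * (LINT x|lborel. u x powr m * norm x powr (-\<gamma>))"
    using m01 by (simp add: q_def field_simps)
qed

end

section \<open>The inequality for densities\<close>

context weighted_ckn_mass
begin

text \<open>The approximants do not have the mass M; the factor that normalizes them converges with
  their mass. Their gradients enter through the upper bounds X j.\<close>

lemma ckn_inequality_limit:
  fixes W :: "nat \<Rightarrow> 'a \<Rightarrow> real"
  assumes sym: "ckn_const TYPE('a) p \<gamma> = ckn_const_radial TYPE('a) p \<gamma>"
    and W: "\<And>j. W j \<in> test_functions"
    and lim: "(\<lambda>j. mass_energy (W j)) \<longlonglongrightarrow> N" "(\<lambda>j. power_energy (W j)) \<longlonglongrightarrow> Y"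
      "\<And>j. grad_energy (W j) \<le> X j" "X \<longlonglongrightarrow> X'"
    and N: "N > 0"
  defines "t \<equiv> (M / N) powr (1 / (2 * p))"
  shows "(1 - \<nu> / 2) * Y0 \<le> k * (t\<^sup>2 * X') + (1 - \<nu>) * (t powr (p + 1) * Y)"
proof (rule tendsto_lowerbound)
  let ?t = "\<lambda>j. (M / mass_energy (W j)) powr (1 / (2 * p))"
  have "(\<lambda>j. M / mass_energy (W j)) \<longlonglongrightarrow> M / N"
    using N by (intro tendsto_intros lim) auto
  then have t: "?t \<longlonglongrightarrow> t"
    unfolding t_def using N M_pos by (intro tendsto_powr tendsto_const) auto
  have tpos: "t > 0" using N M_pos by (simp add: t_def)
  show "(\<lambda>j. k * ((?t j)\<^sup>2 * X j) + (1 - \<nu>) * (?t j powr (p + 1) * power_energy (W j)))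
      \<longlonglongrightarrow> k * (t\<^sup>2 * X') + (1 - \<nu>) * (t powr (p + 1) * Y)"
    using tpos by (intro tendsto_intros t lim) auto
  have "\<forall>\<^sub>F j in sequentially. mass_energy (W j) > 0" using order_tendstoD(1)[OF lim(1) N] .
  then show "\<forall>\<^sub>F j in sequentially. (1 - \<nu> / 2) * Y0 \<le> k * ((?t j)\<^sup>2 * X j) + (1 - \<nu>) * (?t j powr (p + 1) * power_energy (W j))"
  proof eventually_elim
    case (elim j)
    then have "W j \<noteq> (\<lambda>x. 0)" using p1 by (auto simp: mass_energy_def)
    from ckn_inequality_normalized[OF sym W this]
    have "(1 - \<nu> / 2) * Y0 \<le> k * ((?t j)\<^sup>2 * grad_energy (W j)) + (1 - \<nu>) * (?t j powr (p + 1) * power_energy (W j))" .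
    also have "\<dots> \<le> k * ((?t j)\<^sup>2 * X j) + (1 - \<nu>) * (?t j powr (p + 1) * power_energy (W j))"
      using k_pos lim(3)[of j] by (intro add_right_mono mult_left_mono) auto
    finally show ?case .
  qed
qed simp

end

locale weighted_density = weighted_ckn_mass m \<gamma> C p ty + pressure_density m u G
  for m \<gamma> C p :: real and ty :: "'a::euclidean_space itself" and u :: "'a \<Rightarrow> real" and G :: "'a \<Rightarrow> 'a" +
  assumes u_mass: "integrable lborel (\<lambda>x. u x * norm x powr (-\<gamma>))" "wmass \<gamma> u = M"
    and u_power: "integrable lborel (\<lambda>x. u x powr m * norm x powr (-\<gamma>))"
    and sym: "ckn_const TYPE('a) p \<gamma> = ckn_const_radial TYPE('a) p \<gamma>"
begin

text \<open>Two limits are taken. For fixed j, test functions approximate \<open>\<Psi> j\<close>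
  times the cutoff; then truncation, shift and cutoff are removed together and the product tends to
  u^(m - 1/2). The parameter \<open>s\<close> pays for the product rule with the cutoff.\<close>

lemma ckn_density_relaxed:
  assumes s: "s > 0"
  shows "(1 - \<nu> / 2) * Y0 \<le> k * ((1 + s) * (((2 * m - 1) / (2 * (1 - m)))\<^sup>2 * (LINT x|lborel. u x * (norm (G x))\<^sup>2)))
    + (1 - \<nu>) * (LINT x|lborel. u x powr m * norm x powr (-\<gamma>))"
proof -
  \<comment> \<open>Gives the limit u^(m - 1/2) for the function and a slope of size q u^(1/2),
    whose square leads to q^2 u |G|^2.\<close>
  define q where "q = (m - 1 / 2) / (1 - m)"
  have q: "q > 0" "(1 - m) * q = m - 1 / 2" "(1 - m) * (q + 1) = 1 / 2"
    using m m23 by (auto simp: q_def field_simps)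
  have q': "q = (2 * m - 1) / (2 * (1 - m))" using m by (simp add: q_def field_simps)
  define Xu where "Xu = (LINT x|lborel. u x * (norm (G x))\<^sup>2)"
  define Yu where "Yu = (LINT x|lborel. u x powr m * norm x powr (-\<gamma>))"
  have Yu: "Yu \<ge> 0" unfolding Yu_def by (intro Bochner_Integration.integral_nonneg) auto
  define e where "e = (\<lambda>j::nat. 1 / real (Suc j))"
  have e: "e \<longlonglongrightarrow> 0" "\<And>j. e j > 0"
    unfolding e_def using LIMSEQ_inverse_real_of_nat by (auto simp: inverse_eq_divide)
  \<comment> \<open>The gradient of the cutoff contributes at most L^2 e^(m-1) R^(\<gamma>-2) times
    the integral of u^m |x|^(-\<gamma>). With e = 1 / (j + 1) the power of e grows like (j + 1)^(1 -
    m); this R makes its own power (j + 1)^(-2).\<close>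
  define Rj where "Rj = (\<lambda>j::nat. real (Suc j) powr (2 / (2 - \<gamma>)))"
  have nlim: "filterlim (\<lambda>j. real (Suc j)) at_top sequentially"
    using filterlim_compose[OF filterlim_real_sequentially filterlim_Suc] .
  have Rj: "filterlim Rj at_top sequentially" "\<And>j. Rj j > 0"
  proof -
    show "filterlim Rj at_top sequentially"
      unfolding Rj_def by (rule filterlim_compose[OF real_powr_at_top nlim]) (use \<gamma>2 in simp)
  qed (simp add: Rj_def)
  obtain L where L: "L > 0" "\<And>R (x :: 'a). R > 0 \<Longrightarrow> norm (grad (cutoff R) x) \<le> L / R"
    "\<And>R (x :: 'a). R > 0 \<Longrightarrow> norm x > R \<Longrightarrow> grad (cutoff R) x = 0"
    using cutoff_grad by metis
  have [measurable]: "trunc_pressure t \<in> borel_measurable borel" for t unfolding trunc_pressure_def[abs_def] by measurable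
  have [measurable]: "cutoff (Rj j) \<in> borel_measurable borel" for j
    by (intro borel_measurable_continuous_onI smooth_continuous test_function_smooth cutoff_test Rj)
  have [measurable]: "grad (cutoff (Rj j)) \<in> borel_measurable borel" for j
    by (intro borel_measurable_continuous_onI continuous_grad test_function_smooth cutoff_test Rj)
  have ae0: "AE x in lborel. x \<noteq> (0::'a)" by (rule AE_lborel_singleton)
  define \<Psi> where "\<Psi> = (\<lambda>j x. shifted_power q (e j) (e j powr (m - 1)) (trunc_pressure (e j) x))"
  have \<Psi>: "0 \<le> \<Psi> j x" "\<Psi> j x \<le> indicator {y. u y > e j} x * u x powr (m - 1 / 2)" for j x
    unfolding \<Psi>_def q(2)[symmetric] using shifted_pressure_bounds[OF e(2)[of j] e(2)[of j] q(1), of x] by auto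
  have \<Psi>_le: "\<Psi> j x \<le> u x powr (m - 1 / 2)" for j x
    using \<Psi>[of j x] by (cases "u x > e j") auto
  have [measurable]: "\<Psi> j \<in> borel_measurable borel" for j
    unfolding \<Psi>_def shifted_power_def by measurable
  have prod_le: "\<bar>\<Psi> j x * cutoff (Rj j) x\<bar> powr r \<le> u x powr ((m - 1 / 2) * r)" if "r > 0" for j x r
  proof -
    have "\<bar>\<Psi> j x * cutoff (Rj j) x\<bar> \<le> u x powr (m - 1 / 2) * 1"
      unfolding abs_mult using \<Psi>[of j x] \<Psi>_le[of j x] cutoff_bounds[of "Rj j" x] by (intro mult_mono) auto
    then have "\<bar>\<Psi> j x * cutoff (Rj j) x\<bar> powr r \<le> (u x powr (m - 1 / 2) * 1) powr r"
      using that by (intro powr_mono2) auto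
    then show ?thesis by (simp add: powr_powr)
  qed
  have e1: "(m - 1 / 2) * (2 * p) = 1" using m23 by (simp add: p_eq field_simps)
  have e2: "(m - 1 / 2) * (p + 1) = m" using m23 by (simp add: p_eq field_simps)
  define N where "N = (\<lambda>j. LINT x|lborel. \<bar>\<Psi> j x * cutoff (Rj j) x\<bar> powr (2 * p) * norm x powr (-\<gamma>))"
  have N_lim: "N \<longlonglongrightarrow> M"
    unfolding N_def u_mass(2)[symmetric] wmass_def
  proof (rule integral_dominated_convergence)
    show "integrable lborel (\<lambda>x. u x * norm x powr (-\<gamma>))" by (rule u_mass(1))
    show "AE x in lborel. norm (\<bar>\<Psi> j x * cutoff (Rj j) x\<bar> powr (2 * p) * norm x powr (-\<gamma>)) \<le> u x * norm x powr (-\<gamma>)" for j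
    proof (rule AE_I2)
      fix x
      show "norm (\<bar>\<Psi> j x * cutoff (Rj j) x\<bar> powr (2 * p) * norm x powr (-\<gamma>)) \<le> u x * norm x powr (-\<gamma>)"
        using prod_le[of "2 * p" j x] p1 u_nonneg[of x] unfolding e1 by (simp add: mult_right_mono)
    qed
    show "AE x in lborel. (\<lambda>j. \<bar>\<Psi> j x * cutoff (Rj j) x\<bar> powr (2 * p) * norm x powr (-\<gamma>)) \<longlonglongrightarrow> u x * norm x powr (-\<gamma>)"
    proof (rule AE_I2)
      fix x
      have "(\<lambda>j. \<bar>\<Psi> j x * cutoff (Rj j) x\<bar> powr (2 * p) * norm x powr (-\<gamma>)) \<longlonglongrightarrow> \<bar>u x powr (m - 1 / 2) * 1\<bar> powr (2 * p) * norm x powr (-\<gamma>)"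
        unfolding \<Psi>_def using p1 shifted_pressure_tendsto[OF e q(1), of x]
        by (intro tendsto_mult tendsto_powr' tendsto_rabs tendsto_const cutoff_tendsto Rj) (auto simp: q)
      then show "(\<lambda>j. \<bar>\<Psi> j x * cutoff (Rj j) x\<bar> powr (2 * p) * norm x powr (-\<gamma>)) \<longlonglongrightarrow> u x * norm x powr (-\<gamma>)"
        using u_nonneg[of x] e1 by (simp add: powr_powr)
    qed
  qed (use u_mass(1) in measurable)
  \<comment> \<open>For the energies, which stand on the larger side, upper bounds suffice; the mass
    requires its exact limit.\<close>
  have Y_le: "(LINT x|lborel. \<bar>\<Psi> j x * cutoff (Rj j) x\<bar> powr (p + 1) * norm x powr (-\<gamma>)) \<le> Yu" for j
    unfolding Yu_def
    by (rule integral_mono'[OF u_power]) (use prod_le[of "p + 1" j] p1 in \<open>auto simp: e2 intro!: mult_right_mono\<close>)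
  have X1_le: "(LINT x|lborel. (- q * (trunc_pressure (e j) x + e j) powr (- q - 1) * cutoff (Rj j) x)\<^sup>2 * (norm (trunc_gradient (e j) x))\<^sup>2) \<le> q\<^sup>2 * Xu" for j
  proof -
    have "(LINT x|lborel. (- q * (trunc_pressure (e j) x + e j) powr (- q - 1) * cutoff (Rj j) x)\<^sup>2 * (norm (trunc_gradient (e j) x))\<^sup>2)
        \<le> (LINT x|lborel. q\<^sup>2 * (u x * (norm (G x))\<^sup>2))"
    proof (rule integral_mono'[OF integrable_mult_right[OF G_energy]])
      fix x
      show "0 \<le> q\<^sup>2 * (u x * (norm (G x))\<^sup>2)" using u_nonneg[of x] by simp
      show "(- q * (trunc_pressure (e j) x + e j) powr (- q - 1) * cutoff (Rj j) x)\<^sup>2 * (norm (trunc_gradient (e j) x))\<^sup>2 \<le> q\<^sup>2 * (u x * (norm (G x))\<^sup>2)"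
      proof (cases "u x > e j")
        case True
        have u: "u x > 0" using True e(2)[of j] by linarith
        have "\<bar>- q * (trunc_pressure (e j) x + e j) powr (- q - 1) * cutoff (Rj j) x\<bar> \<le> (q * u x powr (1 / 2)) * 1"
          unfolding abs_mult[of _ "cutoff (Rj j) x"]
          using shifted_pressure_slope_bound[OF e(2)[of j] e(2)[of j] q(1) True] cutoff_bounds[of "Rj j" x] q
          by (intro mult_mono) auto
        then have "(- q * (trunc_pressure (e j) x + e j) powr (- q - 1) * cutoff (Rj j) x)\<^sup>2 \<le> (q * u x powr (1 / 2))\<^sup>2"
          using power_mono[of "\<bar>- q * (trunc_pressure (e j) x + e j) powr (- q - 1) * cutoff (Rj j) x\<bar>" "q * u x powr (1 / 2)" 2] by simp
        also have "\<dots> = q\<^sup>2 * u x"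
          using u by (simp add: power_mult_distrib power2_eq_square[of "_ powr _"] flip: powr_add)
        finally have "(- q * (trunc_pressure (e j) x + e j) powr (- q - 1) * cutoff (Rj j) x)\<^sup>2 * (norm (trunc_gradient (e j) x))\<^sup>2 \<le> (q\<^sup>2 * u x) * (norm (trunc_gradient (e j) x))\<^sup>2"
          by (rule mult_right_mono) simp
        then show ?thesis using True by (simp add: trunc_gradient_def mult.assoc)
      next
        case False
        then show ?thesis using u_nonneg[of x] by (simp add: trunc_gradient_def)
      qed
    qed
    then show ?thesis by (simp add: Xu_def)
  qed
  define b where "b = (\<lambda>j::nat. L\<^sup>2 * real (Suc j) powr (- 1 - m) * Yu)"
  have b_lim: "b \<longlonglongrightarrow> 0"
  proof -
    have "(\<lambda>j. real (Suc j) powr (- 1 - m)) \<longlonglongrightarrow> 0"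
      using m m23 by (intro tendsto_neg_powr nlim) auto
    from tendsto_mult[OF tendsto_mult[OF tendsto_const[of "L\<^sup>2"] this] tendsto_const[of Yu]] show ?thesis by (simp add: b_def)
  qed
  have X2_le: "(LINT x|lborel. (\<Psi> j x)\<^sup>2 * (norm (grad (cutoff (Rj j)) x))\<^sup>2) \<le> b j" for j
  proof -
    define n where "n = real (Suc j)"
    have n: "n > 0" by (simp add: n_def)
    have coef: "(L / Rj j)\<^sup>2 * e j powr (m - 1) * Rj j powr \<gamma> = L\<^sup>2 * n powr (- 1 - m)"
    proof -
      have "e j powr (m - 1) = n powr (1 - m)"
        unfolding e_def n_def[symmetric] using n by (simp add: powr_divide powr_minus_divide[symmetric] powr_minus)
      moreover have "Rj j powr \<gamma> / (Rj j)\<^sup>2 = n powr (-2)"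
      proof -
        have "Rj j powr \<gamma> / (Rj j)\<^sup>2 = Rj j powr (\<gamma> - 2)"
          using Rj(2)[of j] by (simp add: powr_diff powr_numeral)
        also have "\<dots> = n powr (2 / (2 - \<gamma>) * (\<gamma> - 2))" by (simp add: Rj_def n_def powr_powr)
        also have "2 / (2 - \<gamma>) * (\<gamma> - 2) = -2" using \<gamma>2 by (simp add: field_simps)
        finally show ?thesis .
      qed
      moreover have "(L / Rj j)\<^sup>2 * e j powr (m - 1) * Rj j powr \<gamma> = L\<^sup>2 * (e j powr (m - 1) * (Rj j powr \<gamma> / (Rj j)\<^sup>2))"
        by (simp add: power_divide)
      moreover have "n powr (1 - m) * n powr (-2) = n powr (- 1 - m)" by (simp flip: powr_add)
      ultimately show ?thesis by simp
    qed
    have "(LINT x|lborel. (\<Psi> j x)\<^sup>2 * (norm (grad (cutoff (Rj j)) x))\<^sup>2)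
        \<le> (LINT x|lborel. (L\<^sup>2 * n powr (- 1 - m)) * (u x powr m * norm x powr (-\<gamma>)))"
    proof (rule integral_mono_AE')
      show "integrable lborel (\<lambda>x. (L\<^sup>2 * n powr (- 1 - m)) * (u x powr m * norm x powr (-\<gamma>)))"
        using u_power by (rule integrable_mult_right)
      show "AE x in lborel. 0 \<le> (L\<^sup>2 * n powr (- 1 - m)) * (u x powr m * norm x powr (-\<gamma>))" by simp
      show "AE x in lborel. (\<Psi> j x)\<^sup>2 * (norm (grad (cutoff (Rj j)) x))\<^sup>2 \<le> (L\<^sup>2 * n powr (- 1 - m)) * (u x powr m * norm x powr (-\<gamma>))"
        using ae0
      proof eventually_elim
        case (elim x)
        show ?case
        proof (cases "u x > e j \<and> norm x \<le> Rj j")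
          case True
          have u: "u x > 0" using True e(2)[of j] by linarith
          have "(\<Psi> j x)\<^sup>2 \<le> (u x powr (m - 1 / 2))\<^sup>2"
            by (rule power_mono[OF \<Psi>_le \<Psi>(1)])
          also have "\<dots> = u x powr (m - 1) * u x powr m"
            by (simp add: power2_eq_square flip: powr_add)
          also have "\<dots> \<le> e j powr (m - 1) * u x powr m"
            using True e(2)[of j] m by (intro mult_right_mono powr_mono2') auto
          finally have 1: "(\<Psi> j x)\<^sup>2 \<le> e j powr (m - 1) * u x powr m" .
          have 2: "(norm (grad (cutoff (Rj j)) x))\<^sup>2 \<le> (L / Rj j)\<^sup>2"
            by (rule power_mono[OF L(2)[OF Rj(2)]]) simp
          have 3: "1 \<le> Rj j powr \<gamma> * norm x powr (-\<gamma>)"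
          proof -
            have "norm x powr \<gamma> \<le> Rj j powr \<gamma>" using True \<gamma> by (intro powr_mono2) auto
            then show ?thesis using elim by (simp add: powr_minus field_simps)
          qed
          have "(\<Psi> j x)\<^sup>2 * (norm (grad (cutoff (Rj j)) x))\<^sup>2 \<le> (e j powr (m - 1) * u x powr m) * (L / Rj j)\<^sup>2 * 1"
            using mult_mono[OF 1 2] by simp
          also have "\<dots> \<le> (e j powr (m - 1) * u x powr m) * (L / Rj j)\<^sup>2 * (Rj j powr \<gamma> * norm x powr (-\<gamma>))"
            by (rule mult_left_mono[OF 3]) simp
          also have "\<dots> = ((L / Rj j)\<^sup>2 * e j powr (m - 1) * Rj j powr \<gamma>) * (u x powr m * norm x powr (-\<gamma>))"
            by (simp add: mult_ac)
          finally show ?thesis unfolding coef .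
        next
          case False
          then have "\<Psi> j x = 0 \<or> grad (cutoff (Rj j)) x = 0"
            using \<Psi>[of j x] L(3)[OF Rj(2)[of j], of x] by (auto simp: not_less)
          then show ?thesis by auto
        qed
      qed
    qed
    also have "\<dots> = b j" by (simp add: b_def n_def Yu_def)
    finally show ?thesis .
  qed
  define t where "t = (\<lambda>j. (M / N j) powr (1 / (2 * p)))"
  have step: "(1 - \<nu> / 2) * Y0 \<le> k * ((t j)\<^sup>2 * ((1 + s) * (q\<^sup>2 * Xu) + (1 + 1 / s) * b j)) + (1 - \<nu>) * (t j powr (p + 1) * Yu)"
    if N: "N j > 0" for j
  proof -
    interpret bw: bounded_weak_gradient "trunc_pressure (e j)" "trunc_gradient (e j)" "e j powr (m - 1)"
      by (rule bounded_weak_gradient[OF e(2)])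
    let ?S = "\<lambda>x. shifted_power q (e j) (e j powr (m - 1)) (trunc_pressure (e j) x)"
    obtain W :: "nat \<Rightarrow> 'a \<Rightarrow> real" and X where W': "\<And>k. W k \<in> test_functions"
      "\<And>r. r > 0 \<Longrightarrow> (\<lambda>k. LINT x|lborel. \<bar>W k x\<bar> powr r * norm x powr (-\<gamma>))
        \<longlonglongrightarrow> (LINT x|lborel. \<bar>?S x * cutoff (Rj j) x\<bar> powr r * norm x powr (-\<gamma>))"
      "\<And>k. (LINT x|lborel. (norm (grad (W k) x))\<^sup>2) \<le> X k"
      "X \<longlonglongrightarrow> (1 + s) * (LINT x|lborel. (- q * (trunc_pressure (e j) x + e j) powr (- q - 1) * cutoff (Rj j) x)\<^sup>2 * (norm (trunc_gradient (e j) x))\<^sup>2)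
        + (1 + 1 / s) * (LINT x|lborel. (?S x)\<^sup>2 * (norm (grad (cutoff (Rj j)) x))\<^sup>2)"
    proof (rule bw.test_function_approx[OF q(1) e(2)[of j] cutoff_test[OF Rj(2)[of j]] s \<gamma>_less_dim], goal_cases)
      case (1 W X)
      show thesis by (rule 1(1)) (fact 1)+
    qed
    have S: "?S x = \<Psi> j x" for x by (simp add: \<Psi>_def)
    note W = W'[unfolded S]
    have "(1 - \<nu> / 2) * Y0 \<le> k * ((t j)\<^sup>2 * ((1 + s) * (LINT x|lborel. (- q * (trunc_pressure (e j) x + e j) powr (- q - 1) * cutoff (Rj j) x)\<^sup>2 * (norm (trunc_gradient (e j) x))\<^sup>2)
        + (1 + 1 / s) * (LINT x|lborel. (\<Psi> j x)\<^sup>2 * (norm (grad (cutoff (Rj j)) x))\<^sup>2)))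
        + (1 - \<nu>) * (t j powr (p + 1) * (LINT x|lborel. \<bar>\<Psi> j x * cutoff (Rj j) x\<bar> powr (p + 1) * norm x powr (-\<gamma>)))"
      unfolding t_def
      by (rule ckn_inequality_limit[OF sym W(1) _ _ _ W(4) N])
        (use W(2)[of "2 * p"] W(2)[of "p + 1"] W(3) p1 in \<open>auto simp: mass_energy_def power_energy_def grad_energy_def N_def\<close>)
    also have "\<dots> \<le> k * ((t j)\<^sup>2 * ((1 + s) * (q\<^sup>2 * Xu) + (1 + 1 / s) * b j)) + (1 - \<nu>) * (t j powr (p + 1) * Yu)"
      using k_pos s \<nu>_less_1 X1_le[of j] X2_le[of j] Y_le[of j]
      by (intro add_mono mult_left_mono) auto
    finally show ?thesis .
  qed
  have t_lim: "t \<longlonglongrightarrow> 1"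
  proof -
    have "(\<lambda>j. M / N j) \<longlonglongrightarrow> M / M" using M_pos by (intro tendsto_intros N_lim) auto
    then have "t \<longlonglongrightarrow> (M / M) powr (1 / (2 * p))"
      unfolding t_def using M_pos by (intro tendsto_powr tendsto_const) auto
    then show ?thesis using M_pos by simp
  qed
  have "(1 - \<nu> / 2) * Y0 \<le> k * (1\<^sup>2 * ((1 + s) * (q\<^sup>2 * Xu) + (1 + 1 / s) * 0)) + (1 - \<nu>) * (1 powr (p + 1) * Yu)"
  proof (rule tendsto_lowerbound)
    show "(\<lambda>j. k * ((t j)\<^sup>2 * ((1 + s) * (q\<^sup>2 * Xu) + (1 + 1 / s) * b j)) + (1 - \<nu>) * (t j powr (p + 1) * Yu))
      \<longlonglongrightarrow> k * (1\<^sup>2 * ((1 + s) * (q\<^sup>2 * Xu) + (1 + 1 / s) * 0)) + (1 - \<nu>) * (1 powr (p + 1) * Yu)"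
      by (intro tendsto_intros t_lim b_lim) auto
    show "\<forall>\<^sub>F j in sequentially. (1 - \<nu> / 2) * Y0 \<le> k * ((t j)\<^sup>2 * ((1 + s) * (q\<^sup>2 * Xu) + (1 + 1 / s) * b j)) + (1 - \<nu>) * (t j powr (p + 1) * Yu)"
      using order_tendstoD(1)[OF N_lim M_pos] by eventually_elim (rule step)
  qed simp
  then show ?thesis unfolding q'[symmetric] Xu_def[symmetric] Yu_def[symmetric] by simp
qed

text \<open>The term with the factor 1 + 1 / s has already vanished with the cutoff, so
  \<open>s\<close> may tend to 0.\<close>

lemma ckn_density:
  "(1 - \<nu> / 2) * Y0 \<le> m / (2 - \<gamma>)\<^sup>2 * (LINT x|lborel. u x * (norm (G x))\<^sup>2)
    + (1 - \<nu>) * (LINT x|lborel. u x powr m * norm x powr (-\<gamma>))"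
proof -
  define c where "c = ((2 * m - 1) / (2 * (1 - m)))\<^sup>2"
  have kc: "k * c = m / (2 - \<gamma>)\<^sup>2"
  proof -
    have "m * a\<^sup>2 / (s\<^sup>2 * b\<^sup>2) * (b / (2 * a))\<^sup>2 = m / (2 * s)\<^sup>2" if "a \<noteq> 0" "b \<noteq> 0" "s \<noteq> 0" for a b s :: real
      using that by (simp add: power2_eq_square field_simps)
    from this[of "1 - m" "2 * m - 1" \<sigma>] show ?thesis
      unfolding k_def c_def two_\<sigma>[symmetric] using m m23 \<sigma>_pos by simp
  qed
  let ?X = "LINT x|lborel. u x * (norm (G x))\<^sup>2" and ?Y = "LINT x|lborel. u x powr m * norm x powr (-\<gamma>)"
  have "((\<lambda>s. k * ((1 + s) * (c * ?X)) + (1 - \<nu>) * ?Y) \<longlongrightarrow> k * ((1 + 0) * (c * ?X)) + (1 - \<nu>) * ?Y) (at_right 0)"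
    by (intro tendsto_intros)
  moreover have "eventually (\<lambda>s. (1 - \<nu> / 2) * Y0 \<le> k * ((1 + s) * (c * ?X)) + (1 - \<nu>) * ?Y) (at_right 0)"
    unfolding c_def using ckn_density_relaxed by (auto simp: eventually_at_right_field intro!: exI[of _ 1])
  ultimately have "(1 - \<nu> / 2) * Y0 \<le> k * ((1 + 0) * (c * ?X)) + (1 - \<nu>) * ?Y"
    by (intro tendsto_lowerbound) auto
  then show ?thesis unfolding kc[symmetric] by (simp add: mult.assoc)
qed

end

subsection \<open>Entropy and entropy production\<close>

text \<open>Concavity, as the inequality of means for u / z and 1 with the weights m and 1 -
  m.\<close>

lemma powr_tangent:
  fixes m u z :: real
  assumes "0 < m" "m < 1" "u \<ge> 0" "z > 0"
  shows "u powr m \<le> (1 - m) * z powr m + m * z powr (m - 1) * u"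
proof (cases "u = 0")
  case False
  have "(u / z) powr m * 1 powr 0 \<le> m * (u / z) + 0 * 1 + (1 - m)"
    by (rule weighted_amgm3) (use assms False in auto)
  then have "z powr m * (u / z) powr m \<le> z powr m * (m * (u / z) + (1 - m))"
    by (intro mult_left_mono) auto
  moreover have "z powr m * (u / z) powr m = u powr m" using assms by (simp add: powr_divide)
  moreover have "z powr m * (u / z) = z powr (m - 1) * u" using assms by (simp add: powr_diff)
  moreover have "z powr m * (m * (u / z) + (1 - m)) = m * (z powr m * (u / z)) + (1 - m) * z powr m"
    by (simp only: distrib_left mult_ac)
  ultimately show ?thesis by (simp only: mult.assoc add.commute)
qed (use assms in simp)

text \<open>Away from the origin the weight can be divided out; at the origin it is 0 by the
  convention for \<open>powr\<close>, so that point is treated by hand.\<close>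

lemma weight_measurable_density:
  fixes u :: "'a::euclidean_space \<Rightarrow> real"
  assumes "(\<lambda>x. u x * norm x powr (-\<gamma>)) \<in> borel_measurable lborel"
  shows "u \<in> borel_measurable borel"
proof -
  have [measurable]: "(\<lambda>x. u x * norm x powr (-\<gamma>)) \<in> borel_measurable borel" using assms by simp
  have "(\<lambda>x. if x = 0 then u 0 else (u x * norm x powr (-\<gamma>)) * norm x powr \<gamma>) \<in> borel_measurable borel"
    by measurable
  moreover have "(if x = 0 then u 0 else (u x * norm x powr (-\<gamma>)) * norm x powr \<gamma>) = u x" for x
    by (simp add: mult.assoc powr_add[symmetric])
  ultimately show ?thesis by simp
qed

text \<open>The graph of u^m lies below its tangent at the Barenblatt profile. The negative factor 1
  / (m - 1) then makes the free energy nonnegative.\<close>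

lemma entropy_density_nonpos:
  assumes "0 < m" "m < 1" "C > 0" "u x \<ge> 0"
  shows "entropy_density m \<gamma> C u x \<le> 0"
proof -
  let ?B = "barenblatt m \<gamma> C x"
  have "C + norm x powr (2 - \<gamma>) > 0" using assms by (simp add: add_pos_nonneg)
  then have B: "?B > 0" by (simp add: barenblatt_def)
  have "?B powr m = ?B powr (m - 1) * ?B" using B by (simp add: powr_diff)
  then have "u x powr m - ?B powr m - m * ?B powr (m - 1) * (u x - ?B) \<le> 0"
    using powr_tangent[OF assms(1,2,4) B] by (simp add: algebra_simps)
  then show ?thesis unfolding entropy_density_def by (intro mult_nonpos_nonneg) auto
qed

lemma free_energy_nonneg:
  assumes "0 < m" "m < 1" "C > 0" "\<And>x. u x \<ge> 0"
  shows "free_energy m \<gamma> C u \<ge> 0"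
proof -
  have "(LINT x|lborel. - entropy_density m \<gamma> C u x) \<ge> 0"
    by (intro Bochner_Integration.integral_nonneg) (simp add: entropy_density_nonpos assms)
  then show ?thesis using assms by (simp add: free_energy_def zero_le_mult_iff zero_le_divide_iff)
qed

section \<open>Free energy and entropy production of a single density\<close>

context weighted_ckn_mass
begin

lemma norm_powr_split: "x \<noteq> 0 \<Longrightarrow> norm x powr (2 - \<gamma>) * norm x powr (- \<gamma>) = norm x powr (2 - 2 * \<gamma>)" for x :: 'a
  by (simp flip: powr_add)

lemma norm_weight_square:
  fixes x :: "'a"
  assumes "x \<noteq> 0"
  shows "(norm x powr (-\<gamma>))\<^sup>2 * (norm x)\<^sup>2 = norm x powr (2 - 2 * \<gamma>)"
proof -
  have "norm x powr (- \<gamma> + - \<gamma> + 2) = norm x powr (-\<gamma>) * norm x powr (-\<gamma>) * norm x powr 2"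
    by (simp only: powr_add)
  moreover have "norm x powr 2 = (norm x)\<^sup>2" using assms by simp
  moreover have "- \<gamma> + - \<gamma> + 2 = 2 - 2 * \<gamma>" by simp
  ultimately show ?thesis by (simp only: power2_eq_square)
qed

lemma barenblatt_meas [measurable]: "(barenblatt m \<gamma> C :: 'a \<Rightarrow> real) \<in> borel_measurable borel"
  unfolding barenblatt_def[abs_def] by measurable

lemma barenblatt_power:
  shows "integrable lborel (\<lambda>x::'a. barenblatt m \<gamma> C x powr m * norm x powr (-\<gamma>))"
    "(LINT x::'a|lborel. barenblatt m \<gamma> C x powr m * norm x powr (-\<gamma>)) = Y0"
proof -
  let ?f = "\<lambda>x::'a. C * (barenblatt m \<gamma> C x * norm x powr (-\<gamma>)) + barenblatt m \<gamma> C x * norm x powr (2 - 2 * \<gamma>)"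
  have i: "integrable lborel ?f" using mass_integrable moment by simp
  have ae: "AE x in lborel. ?f x = barenblatt m \<gamma> C x powr m * norm x powr (-\<gamma>)"
    using AE_lborel_singleton[of "0::'a"]
  proof eventually_elim
    case (elim x)
    show ?case unfolding barenblatt_powr_m norm_powr_split[OF elim, symmetric] by (simp add: algebra_simps)
  qed
  show "integrable lborel (\<lambda>x::'a. barenblatt m \<gamma> C x powr m * norm x powr (-\<gamma>))"
    by (rule integrable_cong_AE_imp[OF i]) (use ae in \<open>auto elim: eventually_mono\<close>)
  have "(LINT x|lborel. ?f x) = (LINT x::'a|lborel. barenblatt m \<gamma> C x powr m * norm x powr (-\<gamma>))"
    by (rule integral_cong_AE) (use ae in auto)
  then show "(LINT x::'a|lborel. barenblatt m \<gamma> C x powr m * norm x powr (-\<gamma>)) = Y0"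
    using mass_integrable moment by (simp add: Y0_def M_def S_def wmass_def)
qed

context
  fixes u :: "'a \<Rightarrow> real"
  assumes u_nn: "\<And>x. u x \<ge> 0"
    and u_int: "integrable lborel (\<lambda>x. u x * norm x powr (-\<gamma>))" and u_M: "wmass \<gamma> u = M"
    and ent: "integrable lborel (entropy_density m \<gamma> C u)"
begin

lemma density_meas [measurable]: "u \<in> borel_measurable borel"
  by (rule weight_measurable_density[of u \<gamma>]) (use u_int in auto)

lemma entropy_density_expand:
  assumes "x \<noteq> 0"
  shows "entropy_density m \<gamma> C u x = u x powr m * norm x powr (-\<gamma>) - barenblatt m \<gamma> C x powr m * norm x powr (-\<gamma>)
    - m * (C * (u x * norm x powr (-\<gamma>)) + u x * norm x powr (2 - 2 * \<gamma>))
    + m * (C * (barenblatt m \<gamma> C x * norm x powr (-\<gamma>)) + barenblatt m \<gamma> C x * norm x powr (2 - 2 * \<gamma>))"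
  unfolding entropy_density_def barenblatt_powr_m1 norm_powr_split[OF assms, symmetric] by (simp add: algebra_simps)

text \<open>Comparing \<open>u\<^sup>m\<close> with its tangent at the multiple \<open>z\<close> of the Barenblatt profile for which
  \<open>z\<^sup>m\<^sup>-\<^sup>1 = B\<^sup>m\<^sup>-\<^sup>1 / 2\<close> leaves half of the term \<open>m B\<^sup>m\<^sup>-\<^sup>1 u\<close>.\<close>

lemma density_moment: "integrable lborel (\<lambda>x. u x * norm x powr (2 - 2 * \<gamma>))"
proof -
  have m0: "0 < m" using m23 by simp
  define c where "c = 2 powr (1 / (1 - m))"
  have c: "c > 0" "c powr (m - 1) = 1 / 2"
  proof -
    show "c > 0" by (simp add: c_def)
    have "1 / (1 - m) * (m - 1) = -1" using m by (simp add: field_simps)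
    then show "c powr (m - 1) = 1 / 2" by (simp add: c_def powr_powr powr_minus)
  qed
  define D where "D = (\<lambda>x::'a. (1 - m) * c powr m * (barenblatt m \<gamma> C x powr m * norm x powr (-\<gamma>)) - entropy_density m \<gamma> C u x)"
  have "integrable lborel (\<lambda>x. 2 / m * D x)"
    unfolding D_def by (intro integrable_mult_right Bochner_Integration.integrable_diff barenblatt_power ent)
  then show ?thesis
  proof (rule Bochner_Integration.integrable_bound)
    show "AE x in lborel. norm (u x * norm x powr (2 - 2 * \<gamma>)) \<le> norm (2 / m * D x)"
      using AE_lborel_singleton[of "0::'a"]
    proof eventually_elim
      case (elim x)
      let ?B = "barenblatt m \<gamma> C x" and ?n = "norm x powr (-\<gamma>)"
      have "u x powr m \<le> (1 - m) * (c * ?B) powr m + m * (c * ?B) powr (m - 1) * u x"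
        using c barenblatt_pos[of x] m0 m by (intro powr_tangent u_nn) auto
      also have "\<dots> = (1 - m) * c powr m * ?B powr m + m / 2 * ?B powr (m - 1) * u x"
        using c barenblatt_pos[of x] by (simp add: powr_mult)
      finally have 1: "u x powr m \<le> (1 - m) * c powr m * ?B powr m + m / 2 * ?B powr (m - 1) * u x" .
      have "?B powr (m - 1) * ?B = ?B powr m" using barenblatt_pos[of x] by (simp add: powr_diff)
      then have "m * ?B powr (m - 1) * (u x - ?B) = m * ?B powr (m - 1) * u x - m * ?B powr m"
        by (simp add: algebra_simps)
      moreover have "m * ?B powr m \<le> 1 * ?B powr m" using m by (intro mult_right_mono) auto
      ultimately have "m / 2 * ?B powr (m - 1) * u x \<le> (1 - m) * c powr m * ?B powr m - (u x powr m - ?B powr m - m * ?B powr (m - 1) * (u x - ?B))"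
        using 1 by linarith
      then have "(m / 2 * ?B powr (m - 1) * u x) * ?n \<le> ((1 - m) * c powr m * ?B powr m - (u x powr m - ?B powr m - m * ?B powr (m - 1) * (u x - ?B))) * ?n"
        by (rule mult_right_mono) simp
      then have 2: "m / 2 * (?B powr (m - 1) * u x * ?n) \<le> D x"
        unfolding D_def entropy_density_def by (simp add: algebra_simps)
      have "u x * norm x powr (2 - 2 * \<gamma>) \<le> ?B powr (m - 1) * u x * ?n"
        unfolding barenblatt_powr_m1 norm_powr_split[OF elim, symmetric] using C u_nn[of x] by (simp add: algebra_simps)
      also have "\<dots> \<le> 2 / m * D x" using 2 m0 by (simp add: field_simps)
      also have "\<dots> \<le> \<bar>2 / m * D x\<bar>" by (rule abs_ge_self)
      finally show ?case using u_nn[of x] by simp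
    qed
  qed measurable
qed

text \<open>With mass and second moment finite, all terms of the expanded entropy density but this
  one are known to be integrable.\<close>

lemma density_power: "integrable lborel (\<lambda>x. u x powr m * norm x powr (-\<gamma>))"
proof -
  have "integrable lborel (\<lambda>x. entropy_density m \<gamma> C u x + barenblatt m \<gamma> C x powr m * norm x powr (-\<gamma>)
    + m * (C * (u x * norm x powr (-\<gamma>)) + u x * norm x powr (2 - 2 * \<gamma>))
    - m * (C * (barenblatt m \<gamma> C x * norm x powr (-\<gamma>)) + barenblatt m \<gamma> C x * norm x powr (2 - 2 * \<gamma>)))"
    by (intro Bochner_Integration.integrable_diff Bochner_Integration.integrable_add integrable_mult_right ent
      barenblatt_power u_int density_moment mass_integrable moment)
  then show ?thesis
    by (rule integrable_cong_AE_imp)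
      (use AE_lborel_singleton[of "0::'a"] in \<open>auto elim!: eventually_mono simp: entropy_density_expand\<close>)
qed

text \<open>As \<open>u\<close> and the Barenblatt profile have the same mass, the contributions of
  the constant C cancel.\<close>

lemma free_energy_eq:
  "(1 - m) * free_energy m \<gamma> C u = Y0 - m * S - (LINT x|lborel. u x powr m * norm x powr (-\<gamma>))
    + m * (LINT x|lborel. u x * norm x powr (2 - 2 * \<gamma>))"
proof -
  have "(LINT x|lborel. entropy_density m \<gamma> C u x) = (LINT x|lborel. u x powr m * norm x powr (-\<gamma>) - barenblatt m \<gamma> C x powr m * norm x powr (-\<gamma>)
    - m * (C * (u x * norm x powr (-\<gamma>)) + u x * norm x powr (2 - 2 * \<gamma>))
    + m * (C * (barenblatt m \<gamma> C x * norm x powr (-\<gamma>)) + barenblatt m \<gamma> C x * norm x powr (2 - 2 * \<gamma>)))"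
    by (rule integral_cong_AE)
      (use ent AE_lborel_singleton[of "0::'a"] in \<open>auto elim!: eventually_mono simp: entropy_density_expand\<close>)
  also have "\<dots> = (LINT x|lborel. u x powr m * norm x powr (-\<gamma>)) - Y0
    - m * (C * M + (LINT x|lborel. u x * norm x powr (2 - 2 * \<gamma>))) + m * (C * M + S)"
    using density_power barenblatt_power u_int density_moment mass_integrable moment
    by (simp add: u_M[unfolded wmass_def, symmetric] M_def[symmetric]) (simp add: M_def S_def wmass_def u_M[unfolded wmass_def M_def])
  finally have "(LINT x|lborel. entropy_density m \<gamma> C u x) = - (Y0 - m * S - (LINT x|lborel. u x powr m * norm x powr (-\<gamma>))
    + m * (LINT x|lborel. u x * norm x powr (2 - 2 * \<gamma>)))" by (simp add: algebra_simps)
  moreover have "(1 - m) * free_energy m \<gamma> C u = - (LINT x|lborel. entropy_density m \<gamma> C u x)"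
  proof -
    have "(1 - m) * (1 / (m - 1)) = -1" using m by (simp add: field_simps)
    then show ?thesis unfolding free_energy_def mult.assoc[symmetric] by simp
  qed
  ultimately show ?thesis by simp
qed

lemma entropy_production_inequality:
  assumes sym: "ckn_const TYPE('a) p \<gamma> = ckn_const_radial TYPE('a) p \<gamma>"
    and G: "is_pressure_gradient m u G"
  shows "ennreal ((2 - \<gamma>)\<^sup>2 * free_energy m \<gamma> C u) \<le> entropy_production m \<gamma> u G"
proof (cases "(\<integral>\<^sup>+x. ennreal (u x * (norm (drift \<gamma> G x))\<^sup>2) \<partial>lborel) = \<infinity>")
  case True
  have "m / (1 - m) > 0" using m m23 by simp
  then have "ennreal (m / (1 - m)) * \<infinity> = \<infinity>"
    by (simp add: ennreal_mult_eq_top_iff ennreal_eq_0_iff)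
  then show ?thesis unfolding entropy_production_def True by simp
next
  case False
  interpret pf: pressure_field m u G
    by unfold_locales (use m m23 u_nn G in auto)
  have [measurable]: "(\<lambda>x. u x *\<^sub>R G x) \<in> borel_measurable borel" by (rule pf.uG_meas)
  have [measurable]: "(\<lambda>x. u x * (norm (G x))\<^sup>2) \<in> borel_measurable borel" by (rule pf.u_G_square_meas)
  define cross where "cross = (\<lambda>x. u x * (G x \<bullet> x) * norm x powr (-\<gamma>))"
  have cross_meas [measurable]: "cross \<in> borel_measurable borel"
  proof -
    have "(\<lambda>x. (u x *\<^sub>R G x) \<bullet> x * norm x powr (-\<gamma>)) \<in> borel_measurable borel" by measurable
    then show ?thesis by (simp add: cross_def)
  qed
  let ?J = "\<lambda>x. u x * (norm (G x))\<^sup>2 - 2 * (2 - \<gamma>) * cross x + (2 - \<gamma>)\<^sup>2 * (u x * norm x powr (2 - 2 * \<gamma>))"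
  have expand: "u x * (norm (drift \<gamma> G x))\<^sup>2 = ?J x" if "x \<noteq> 0" for x
  proof -
    have "(norm (drift \<gamma> G x))\<^sup>2 = (norm (G x))\<^sup>2 - 2 * ((2 - \<gamma>) * norm x powr (-\<gamma>)) * (G x \<bullet> x) + ((2 - \<gamma>) * norm x powr (-\<gamma>))\<^sup>2 * (norm x)\<^sup>2"
      unfolding drift_def power2_norm_eq_inner
      by (simp add: inner_diff_left inner_diff_right inner_commute power2_eq_square algebra_simps)
    also have "((2 - \<gamma>) * norm x powr (-\<gamma>))\<^sup>2 * (norm x)\<^sup>2 = (2 - \<gamma>)\<^sup>2 * norm x powr (2 - 2 * \<gamma>)"
      unfolding power_mult_distrib norm_weight_square[OF that, symmetric] by (simp only: mult.assoc)
    finally have dr: "(norm (drift \<gamma> G x))\<^sup>2 = (norm (G x))\<^sup>2 - 2 * ((2 - \<gamma>) * norm x powr (-\<gamma>)) * (G x \<bullet> x)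
      + (2 - \<gamma>)\<^sup>2 * norm x powr (2 - 2 * \<gamma>)" .
    show ?thesis unfolding dr by (simp add: cross_def algebra_simps)
  qed
  have ae: "AE x in lborel. u x * (norm (drift \<gamma> G x))\<^sup>2 = ?J x"
    using AE_lborel_singleton[of "0::'a"] by eventually_elim (rule expand)
  have nnJ: "(\<integral>\<^sup>+x. ennreal (u x * (norm (drift \<gamma> G x))\<^sup>2) \<partial>lborel) = (\<integral>\<^sup>+x. ennreal (?J x) \<partial>lborel)"
    by (rule nn_integral_cong_AE) (use ae in \<open>auto elim: eventually_mono\<close>)
  have J0: "AE x in lborel. 0 \<le> ?J x"
    using ae by eventually_elim (metis u_nn mult_nonneg_nonneg zero_le_power2)
  have J_int: "integrable lborel ?J"
  proof (rule integrableI_nonneg[OF _ J0])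
    show "?J \<in> borel_measurable lborel" by measurable
    show "(\<integral>\<^sup>+x. ennreal (?J x) \<partial>lborel) < \<infinity>" using False unfolding nnJ by (simp add: less_top)
  qed
  \<comment> \<open>Finite production and second moment give finite energy, as |G|^2 \<le> 2
    |drift|^2 + 2 |z|^2 for the gradient z of the potential. After this the expanded square may be
    integrated term by term.\<close>
  have G_energy: "integrable lborel (\<lambda>x. u x * (norm (G x))\<^sup>2)"
  proof (rule Bochner_Integration.integrable_bound)
    show "integrable lborel (\<lambda>x. 2 * ?J x + 2 * (2 - \<gamma>)\<^sup>2 * (u x * norm x powr (2 - 2 * \<gamma>)))"
      by (intro Bochner_Integration.integrable_add integrable_mult_right J_int density_moment)
    show "AE x in lborel. norm (u x * (norm (G x))\<^sup>2) \<le> norm (2 * ?J x + 2 * (2 - \<gamma>)\<^sup>2 * (u x * norm x powr (2 - 2 * \<gamma>)))"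
      using AE_lborel_singleton[of "0::'a"]
    proof eventually_elim
      case (elim x)
      define z where "z = ((2 - \<gamma>) * norm x powr (-\<gamma>)) *\<^sub>R x"
      have z: "(norm z)\<^sup>2 = (2 - \<gamma>)\<^sup>2 * norm x powr (2 - 2 * \<gamma>)"
        unfolding z_def norm_scaleR power_mult_distrib power2_abs norm_weight_square[OF elim, symmetric]
        by (simp only: mult.assoc)
      have "(norm (G x))\<^sup>2 \<le> (norm (drift \<gamma> G x) + norm z)\<^sup>2"
        using norm_triangle_ineq[of "drift \<gamma> G x" z] by (intro power_mono) (auto simp: drift_def z_def)
      also have "\<dots> \<le> 2 * (norm (drift \<gamma> G x))\<^sup>2 + 2 * (norm z)\<^sup>2"
        using sum_squares_bound[of "norm (drift \<gamma> G x)" "norm z"] by (simp add: power2_sum)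
      finally have "u x * (norm (G x))\<^sup>2 \<le> u x * (2 * (norm (drift \<gamma> G x))\<^sup>2 + 2 * (norm z)\<^sup>2)"
        by (rule mult_left_mono) (rule u_nn)
      also have "\<dots> = 2 * ?J x + 2 * (2 - \<gamma>)\<^sup>2 * (u x * norm x powr (2 - 2 * \<gamma>))"
        unfolding expand[OF elim, symmetric] z by (simp add: algebra_simps)
      finally show ?case using u_nn[of x] by simp
    qed
  qed measurable
  interpret pd: weighted_density m \<gamma> C p ty u G
    by unfold_locales (use G_energy u_int u_M density_power sym in auto)
  let ?X = "LINT x|lborel. u x * (norm (G x))\<^sup>2" and ?Y = "LINT x|lborel. u x powr m * norm x powr (-\<gamma>)"
    and ?Z = "LINT x|lborel. u x * norm x powr (2 - 2 * \<gamma>)"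
  note fl = pd.flux_identity[OF \<gamma>(1) \<gamma>_less_dim density_power density_moment]
  have J_eq: "(LINT x|lborel. ?J x) = ?X - 2 * (2 - \<gamma>) * ((1 - m) / m * \<alpha> * ?Y) + (2 - \<gamma>)\<^sup>2 * ?Z"
    using G_energy fl density_moment by (simp add: cross_def \<alpha>_def d_def)
  have "(2 - \<gamma>)\<^sup>2 * ((1 - m) * free_energy m \<gamma> C u) \<le> m * (LINT x|lborel. ?J x)"
  proof -
    \<comment> \<open>By this identity the cross term, integrated by parts, is worth - \<nu> times
      the integral of u^m; with the integral of u^m in the free energy it leaves the coefficient 1 -
      \<nu> of \<open>ckn_density\<close>.\<close>
    have nu: "\<nu> * (2 - \<gamma>) = 2 * (1 - m) * \<alpha>" using \<gamma>2 by (simp add: \<nu>_def \<sigma>_def)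
    have "Y0 - m * S = (1 - \<nu> / 2) * Y0" unfolding S_Y0 by (simp add: algebra_simps)
    then have "(1 - m) * free_energy m \<gamma> C u = (1 - \<nu> / 2) * Y0 - ?Y + m * ?Z" unfolding free_energy_eq by simp
    also have "\<dots> \<le> m / (2 - \<gamma>)\<^sup>2 * ?X - \<nu> * ?Y + m * ?Z"
      using pd.ckn_density by (simp add: algebra_simps)
    finally have "(2 - \<gamma>)\<^sup>2 * ((1 - m) * free_energy m \<gamma> C u) \<le> (2 - \<gamma>)\<^sup>2 * (m / (2 - \<gamma>)\<^sup>2 * ?X - \<nu> * ?Y + m * ?Z)"
      by (rule mult_left_mono) simp
    also have "\<dots> = m * ?X - (2 - \<gamma>) * (\<nu> * (2 - \<gamma>)) * ?Y + m * (2 - \<gamma>)\<^sup>2 * ?Z"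
    proof -
      have "a\<^sup>2 * (m / a\<^sup>2 * x - n * y + m * z) = m * x - a * (n * a) * y + m * a\<^sup>2 * z" if "a \<noteq> 0"
        for a n x y z :: real
        using that by (simp add: power2_eq_square field_simps)
      then show ?thesis using \<gamma>2 by simp
    qed
    also have "\<dots> = m * (LINT x|lborel. ?J x)"
    proof -
      have "m * x - a * (2 * b * n) * y + m * a\<^sup>2 * z = m * (x - 2 * a * (b / m * n * y) + a\<^sup>2 * z)"
        for a b n x y z :: real
        using m23 by (simp add: field_simps)
      then show ?thesis unfolding nu J_eq .
    qed
    finally show ?thesis .
  qed
  then have "(2 - \<gamma>)\<^sup>2 * free_energy m \<gamma> C u \<le> m / (1 - m) * (LINT x|lborel. ?J x)"
    using m by (simp add: field_simps)
  then have "ennreal ((2 - \<gamma>)\<^sup>2 * free_energy m \<gamma> C u) \<le> ennreal (m / (1 - m) * (LINT x|lborel. ?J x))"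
    by (rule ennreal_leI)
  also have "\<dots> = ennreal (m / (1 - m)) * ennreal (LINT x|lborel. ?J x)"
    by (rule ennreal_mult[OF _ integral_nonneg_AE[OF J0]]) (use m m23 in simp)
  also have "ennreal (LINT x|lborel. ?J x) = (\<integral>\<^sup>+x. ennreal (?J x) \<partial>lborel)"
    by (rule nn_integral_eq_integral[OF J_int J0, symmetric])
  finally show ?thesis unfolding entropy_production_def nnJ .
qed

end

end

text \<open>The hypothesis is the implicit Euler step for f' = - \<kappa> f, and (1 + \<kappa> t /
  n)^n tends to exp (\<kappa> t). The argument is free of derivatives, in keeping with the
  integrated form of the entropy identity.\<close>

lemma exponential_decay:
  fixes f :: "real \<Rightarrow> real"
  assumes step: "\<And>s t. 0 \<le> s \<Longrightarrow> s \<le> t \<Longrightarrow> f t * (1 + \<kappa> * (t - s)) \<le> f s"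
    and "\<kappa> \<ge> 0" "t \<ge> 0"
  shows "f t \<le> f 0 * exp (- \<kappa> * t)"
proof -
  have iter: "f (real j * h) * (1 + \<kappa> * h) ^ j \<le> f 0" if "h \<ge> 0" for h j
  proof (induction j)
    case (Suc j)
    have "f (real (Suc j) * h) * (1 + \<kappa> * h) \<le> f (real j * h)"
      using step[of "real j * h" "real (Suc j) * h"] that by (simp add: algebra_simps)
    then have "f (real (Suc j) * h) * (1 + \<kappa> * h) * (1 + \<kappa> * h) ^ j \<le> f (real j * h) * (1 + \<kappa> * h) ^ j"
      using assms(2) that by (intro mult_right_mono) auto
    then show ?case using Suc by (simp add: mult_ac)
  qed simp
  have "(\<lambda>n. f t * (1 + (\<kappa> * t) / real n) ^ n) \<longlonglongrightarrow> f t * exp (\<kappa> * t)"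
    by (intro tendsto_intros tendsto_exp_limit_sequentially)
  moreover have "\<forall>\<^sub>F n in sequentially. f t * (1 + (\<kappa> * t) / real n) ^ n \<le> f 0"
    using eventually_gt_at_top[of 0]
  proof eventually_elim
    case (elim n)
    then show ?case using iter[of "t / real n" n] assms(3) by simp
  qed
  ultimately have "f t * exp (\<kappa> * t) \<le> f 0" by (intro tendsto_upperbound) auto
  then show ?thesis by (simp add: exp_minus field_simps)
qed

theorem corollary1p2:
  fixes m p \<gamma> \<gamma>s C :: real
    and u0 :: "'a::euclidean_space \<Rightarrow> real"
    and v :: "real \<Rightarrow> 'a \<Rightarrow> real"
  assumes "DIM('a) \<ge> 3"
    and "1 - 1 / real DIM('a) < m" and "m < 1"
    and "p = 1 / (2 * m - 1)"
    and "0 < \<gamma>s" and "\<gamma>s \<le> real DIM('a) - (real DIM('a) - 2) * p"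
    and "\<And>g. 0 < g \<Longrightarrow> g < \<gamma>s \<Longrightarrow> ckn_const TYPE('a) p g = ckn_const_radial TYPE('a) p g"
    and "0 < \<gamma>" and "\<gamma> < \<gamma>s"
    and "\<And>x. u0 x \<ge> 0" and "\<not> (AE x in lborel. u0 x = 0)"
    and "integrable lborel (\<lambda>x. u0 x * norm x powr (-\<gamma>))"
    and "integrable lborel (\<lambda>x. u0 x powr m * norm x powr (-\<gamma>))"
    and "integrable lborel (\<lambda>x. u0 x * norm x powr (2 - 2 * \<gamma>))"
    and "C > 0" and "wmass \<gamma> (barenblatt m \<gamma> C :: 'a \<Rightarrow> real) = wmass \<gamma> u0"
    and "fde_solution m \<gamma> C u0 v"
  shows "\<forall>t>0. free_energy m \<gamma> C (v t) \<le> free_energy m \<gamma> C u0 * exp (- ((2 - \<gamma>)\<^sup>2) * t)"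
proof (intro allI impI)
  fix t :: real assume "t > 0"
  interpret weighted_ckn m \<gamma> C p "TYPE('a)"
    by unfold_locales (use assms in auto)
  have "wmass \<gamma> u0 \<noteq> 0"
  proof
    assume "wmass \<gamma> u0 = 0"
    then have "AE x in lborel. u0 x * norm x powr (-\<gamma>) = 0"
      using integral_nonneg_eq_0_iff_AE[OF assms(12)] assms(10) unfolding wmass_def by simp
    then have "AE x in lborel. u0 x = 0"
      using AE_lborel_singleton[of "0::'a"] by eventually_elim auto
    then show False using assms(11) by simp
  qed
  \<comment> \<open>The integral of a nonintegrable function is 0 by convention; the prescribed mass
    is not 0, so the Barenblatt profile is integrable.\<close>
  then have B_int: "integrable lborel (\<lambda>x::'a. barenblatt m \<gamma> C x * norm x powr (-\<gamma>))"
    using assms(16) not_integrable_integral_eq unfolding wmass_def by fastforce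
  interpret weighted_ckn_mass m \<gamma> C p "TYPE('a)"
    by unfold_locales (rule B_int)
  have sym: "ckn_const TYPE('a) p \<gamma> = ckn_const_radial TYPE('a) p \<gamma>" using assms by blast
  have v: "\<And>t x. t \<ge> 0 \<Longrightarrow> v t x \<ge> 0" "v 0 = u0"
    "\<And>t. t \<ge> 0 \<Longrightarrow> integrable lborel (\<lambda>x. v t x * norm x powr (-\<gamma>))"
    "\<And>t. t \<ge> 0 \<Longrightarrow> wmass \<gamma> (v t) = M"
    "\<And>t. t > 0 \<Longrightarrow> integrable lborel (entropy_density m \<gamma> C (v t))"
    using assms(16,17) unfolding fde_solution_def M_def by auto
  have "\<exists>G. (AE t in lborel. t > 0 \<longrightarrow> is_pressure_gradient m (v t) (G t)) \<and> solves_equation \<gamma> v G \<and>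
      (\<forall>s t. 0 \<le> s \<and> s \<le> t \<longrightarrow> ennreal (free_energy m \<gamma> C (v t))
       + (\<integral>\<^sup>+\<tau>\<in>{s..t}. entropy_production m \<gamma> (v \<tau>) (G \<tau>) \<partial>lborel) = ennreal (free_energy m \<gamma> C (v s)))"
    using assms(17) unfolding fde_solution_def by (elim conjE)
  then obtain G where G1: "AE t in lborel. t > 0 \<longrightarrow> is_pressure_gradient m (v t) (G t)"
    and G2: "\<forall>s t. 0 \<le> s \<and> s \<le> t \<longrightarrow> ennreal (free_energy m \<gamma> C (v t))
       + (\<integral>\<^sup>+\<tau>\<in>{s..t}. entropy_production m \<gamma> (v \<tau>) (G \<tau>) \<partial>lborel) = ennreal (free_energy m \<gamma> C (v s))"
    by (elim exE conjE)
  have balance: "ennreal (free_energy m \<gamma> C (v t)) + (\<integral>\<^sup>+\<tau>\<in>{s..t}. entropy_production m \<gamma> (v \<tau>) (G \<tau>) \<partial>lborel)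
      = ennreal (free_energy m \<gamma> C (v s))" if "0 \<le> s" "s \<le> t" for s t
    using G2 that by simp
  define f where "f = (\<lambda>t. free_energy m \<gamma> C (v t))"
  have f_nn: "f t \<ge> 0" if "t \<ge> 0" for t
    unfolding f_def using m23 m C v(1)[OF that] by (intro free_energy_nonneg) auto
  have f_mono: "f t \<le> f s" if "0 \<le> s" "s \<le> t" for s t
  proof -
    have "ennreal (f t) \<le> ennreal (f s)"
      unfolding f_def balance[OF that, symmetric] by simp
    then show ?thesis using f_nn[of s] that by (simp add: ennreal_le_iff)
  qed
  have prod: "AE \<tau> in lborel. \<tau> > 0 \<longrightarrow> ennreal ((2 - \<gamma>)\<^sup>2 * f \<tau>) \<le> entropy_production m \<gamma> (v \<tau>) (G \<tau>)"
    using G1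
  proof eventually_elim
    case (elim \<tau>)
    show ?case unfolding f_def
      using elim v by (intro impI entropy_production_inequality sym) auto
  qed
  have step: "f t * (1 + (2 - \<gamma>)\<^sup>2 * (t - s)) \<le> f s" if st: "0 \<le> s" "s \<le> t" for s t
  proof -
    \<comment> \<open>Over [s, t] the free energy is bounded below by its final value
      \<open>f t\<close>, so that the lower bound for the production is a constant
      integrand.\<close>
    have "ennreal ((2 - \<gamma>)\<^sup>2 * f t * (t - s)) = (\<integral>\<^sup>+\<tau>\<in>{s..t}. ennreal ((2 - \<gamma>)\<^sup>2 * f t) \<partial>lborel)"
      using st f_nn[of t] by (simp add: nn_integral_cmult_indicator ennreal_mult)
    also have "\<dots> \<le> (\<integral>\<^sup>+\<tau>\<in>{s..t}. entropy_production m \<gamma> (v \<tau>) (G \<tau>) \<partial>lborel)"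
    proof (rule nn_integral_mono_AE)
      show "AE \<tau> in lborel. ennreal ((2 - \<gamma>)\<^sup>2 * f t) * indicator {s..t} \<tau> \<le> entropy_production m \<gamma> (v \<tau>) (G \<tau>) * indicator {s..t} \<tau>"
        using prod AE_lborel_singleton[of "0::real"]
      proof eventually_elim
        case (elim \<tau>)
        show ?case
        proof (cases "\<tau> \<in> {s..t}")
          case True
          then have \<tau>: "\<tau> > 0" "f t \<le> f \<tau>" using elim st f_mono[of \<tau> t] by auto
          then have "ennreal ((2 - \<gamma>)\<^sup>2 * f t) \<le> ennreal ((2 - \<gamma>)\<^sup>2 * f \<tau>)"
            by (intro ennreal_leI mult_left_mono) auto
          also have "\<dots> \<le> entropy_production m \<gamma> (v \<tau>) (G \<tau>)" using elim \<tau> by blast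
          finally show ?thesis using True by simp
        qed simp
      qed
    qed
    finally have "ennreal (f t) + ennreal ((2 - \<gamma>)\<^sup>2 * f t * (t - s)) \<le> ennreal (f s)"
      unfolding f_def balance[OF st, symmetric] by (rule add_left_mono)
    then have "ennreal (f t + (2 - \<gamma>)\<^sup>2 * f t * (t - s)) \<le> ennreal (f s)"
      using f_nn[of t] st by (simp add: ennreal_plus)
    then show ?thesis using f_nn[of s] st by (simp add: ennreal_le_iff algebra_simps)
  qed
  have "f t \<le> f 0 * exp (- ((2 - \<gamma>)\<^sup>2) * t)"
    by (rule exponential_decay[OF step]) (use \<open>t > 0\<close> in auto)
  then show "free_energy m \<gamma> C (v t) \<le> free_energy m \<gamma> C u0 * exp (- ((2 - \<gamma>)\<^sup>2) * t)"
    by (simp add: f_def v(2))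
qed

end
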